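(* Let $d\ge 1$, let $M$ be a $d\times d$ integer matrix all of whose eigenvalues $\lambda$ satisfy $|\lambda|>1$, and let $P$ be a $d\times d$ integer matrix with $p:=|\det P|\neq 0$ which is an admissible oversampling matrix for $M$ (see context). Let $\Psi=\{\psi_1,\dots,\psi_n\}\subset L^2(\mathbb{R}^d)$. Then the affine system $$X(\Psi)=\{D^jT_k\psi_i : j\in\mathbb{Z},\ k\in\mathbb{Z}^d,\ i\in\{1,\dots,n\}\}$$ is a frame (respectively, an orthonormal basis) for $L^2(\mathbb{R}^d)$ with frame bounds $A,B$ if and only if $$\mathbf{X}(S\Psi):=\{\mathbf{D}^j\mathbf{T}_{P^{-1}k}S\psi_i : j\in\mathbb{Z},\ k\in\mathbb{Z}^d,\ i\in\{1,\dots,n\}\}$$ is a frame (respectively, an orthonormal basis) for $H$ with the same frame bounds $A,B$. Moreover, the projection of $\mathbf{X}(S\Psi)$ onto the first component of $H$ (the component indexed by $q=0$) is the oversampled affine system $$X^P(\Psi)=\Big\{\tfrac{1}{\sqrt{p}}D^jT_{P^{-1}k}\psi_i : j\in\mathbb{Z},\ k\in\mathbb{Z}^d,\ i\in\{1,\dots,n\}\Big\}.$$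
   Context: For $f\in L^2(\mathbb{R}^d)$: $Df(x)=\sqrt{|\det M|}\,f(Mx)$ and, for $u\in\mathbb{R}^d$, $T_uf(x)=f(x-u)$. A family $\{e_i\}_{i\in I}$ in a Hilbert space $K$ is a frame with bounds $A,B>0$ if $A\|f\|^2\le\sum_i|\langle f,e_i\rangle|^2\le B\|f\|^2$ for all $f\in K$. $P$ is an admissible oversampling matrix for $M$ if $PMP^{-1}$ has integer entries and $M^{-1}\mathbb{Z}^d\cap P^{-1}\mathbb{Z}^d=\mathbb{Z}^d$. Put $M'=PMP^{-1}$. Let $\{\theta_r : 0\le r\le p-1\}$ be a complete set of representatives of $P^{-1}\mathbb{Z}^d/\mathbb{Z}^d$ with $\theta_0=0$, and $\{\theta^*_q : 0\le q\le p-1\}$ a complete set of representatives of $(P^* )^{-1}\mathbb{Z}^d/\mathbb{Z}^d$ with $\theta^*_0=0$ ($P^*$ the transpose). Under admissibility, $M$ induces a permutation $\sigma$ of $\{0,\dots,p-1\}$ by $M\theta_r\equiv\theta_{\sigma(r)}\bmod\mathbb{Z}^d$, and $M'^*$ induces a permutation $\sigma^*$ by $M'^*\theta^*_q\equiv\theta^*_{\sigma^*(q)}\bmod\mathbb{Z}^d$. Let $H=L^2(\mathbb{R}^d)\oplus\cdots\oplus L^2(\mathbb{R}^d)$ ($p$ copies), with elements written $(f_q)_{0\le q\le p-1}$. Define unitaries on $H$: $\mathbf{T}_{P^{-1}k}(f_q)_q=(e^{2\pi i k\cdot\theta^*_q}T_{P^{-1}k}f_q)_q$ for $k\in\mathbb{Z}^d$,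 and $\mathbf{D}(f_q)_q=(Df_{(\sigma^* )^{-1}(q)})_q$. Define the isometry $S:L^2(\mathbb{R}^d)\to H$, $Sf=\frac{1}{\sqrt p}(f,\dots,f)$. *)

theory Defs
  imports "HOL-Analysis.Analysis"
begin

type_synonym 'd fn = "real^'d \<Rightarrow> complex"

definition Zd :: "(real^'d) set" where
  "Zd = {x. \<forall>i. x $ i \<in> \<int>}"

definition vec_of_int :: "int^'d \<Rightarrow> real^'d" where
  "vec_of_int k = (\<chi> i. real_of_int (k $ i))"

definition is_int_matrix :: "real^'d^'d \<Rightarrow> bool" where
  "is_int_matrix A \<longleftrightarrow> (\<forall>i j. A $ i $ j \<in> \<int>)"

definition cmat :: "real^'d^'d \<Rightarrow> complex^'d^'d" where
  "cmat A = (\<chi> i j. complex_of_real (A $ i $ j))"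

definition is_eigenvalue :: "real^'d^'d \<Rightarrow> complex \<Rightarrow> bool" where
  "is_eigenvalue A z \<longleftrightarrow> det (mat z - cmat A) = 0"

definition admissible :: "real^'d^'d \<Rightarrow> real^'d^'d \<Rightarrow> bool" where
  "admissible M P \<longleftrightarrow>
     is_int_matrix (P ** M ** matrix_inv P) \<and>
     ((\<lambda>k. matrix_inv M *v k) ` Zd) \<inter> ((\<lambda>k. matrix_inv P *v k) ` Zd) = Zd"

definition L2 :: "('d::finite) fn set" where
  "L2 = {f. f \<in> borel_measurable lebesgue \<and> integrable lebesgue (\<lambda>x. (cmod (f x))\<^sup>2)}"

definition l2_inner :: "('d::finite) fn \<Rightarrow> 'd fn \<Rightarrow> complex" where
  "l2_inner f g = (LINT x|lebesgue. f x * cnj (g x))"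

definition Hsp :: "nat \<Rightarrow> (nat \<Rightarrow> ('d::finite) fn) set" where
  "Hsp p = {F. (\<forall>q<p. F q \<in> L2) \<and> (\<forall>q\<ge>p. F q = (\<lambda>x. 0))}"

definition H_inner :: "nat \<Rightarrow> (nat \<Rightarrow> ('d::finite) fn) \<Rightarrow> (nat \<Rightarrow> 'd fn) \<Rightarrow> complex" where
  "H_inner p F G = (\<Sum>q<p. l2_inner (F q) (G q))"

definition is_frame :: "'a set \<Rightarrow> ('a \<Rightarrow> 'a \<Rightarrow> complex) \<Rightarrow> 'i set \<Rightarrow> ('i \<Rightarrow> 'a) \<Rightarrow> real \<Rightarrow> real \<Rightarrow> bool" where
  "is_frame K ip I e A B \<longleftrightarrow> A > 0 \<and> B > 0 \<and> (\<forall>i\<in>I. e i \<in> K) \<and>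
     (\<forall>f\<in>K. (\<lambda>i. (cmod (ip f (e i)))\<^sup>2) summable_on I \<and>
        A * Re (ip f f) \<le> (\<Sum>\<^sub>\<infinity>i\<in>I. (cmod (ip f (e i)))\<^sup>2) \<and>
        (\<Sum>\<^sub>\<infinity>i\<in>I. (cmod (ip f (e i)))\<^sup>2) \<le> B * Re (ip f f))"

definition is_onb :: "'a set \<Rightarrow> ('a \<Rightarrow> 'a \<Rightarrow> complex) \<Rightarrow> 'i set \<Rightarrow> ('i \<Rightarrow> 'a) \<Rightarrow> bool" where
  "is_onb K ip I e \<longleftrightarrow> (\<forall>i\<in>I. e i \<in> K) \<and>
     (\<forall>i\<in>I. \<forall>i'\<in>I. ip (e i) (e i') = (if i = i' then 1 else 0)) \<and>
     (\<forall>f\<in>K. (\<forall>i\<in>I. ip f (e i) = 0) \<longrightarrow> ip f f = 0)"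

definition Dil :: "real^'d^'d \<Rightarrow> ('d::finite) fn \<Rightarrow> 'd fn" where
  "Dil M f = (\<lambda>x. complex_of_real (sqrt \<bar>det M\<bar>) * f (M *v x))"

definition DilInv :: "real^'d^'d \<Rightarrow> ('d::finite) fn \<Rightarrow> 'd fn" where
  "DilInv M f = (\<lambda>x. f (matrix_inv M *v x) / complex_of_real (sqrt \<bar>det M\<bar>))"

definition Dpow :: "real^'d^'d \<Rightarrow> int \<Rightarrow> ('d::finite) fn \<Rightarrow> 'd fn" where
  "Dpow M j = (if j \<ge> 0 then Dil M ^^ nat j else DilInv M ^^ nat (- j))"

definition Tr :: "real^'d \<Rightarrow> ('d::finite) fn \<Rightarrow> 'd fn" where
  "Tr u f = (\<lambda>x. f (x - u))"

definition bD :: "real^'d^'d \<Rightarrow> nat \<Rightarrow> (nat \<Rightarrow> nat) \<Rightarrow> (nat \<Rightarrow> ('d::finite) fn) \<Rightarrow> (nat \<Rightarrow> 'd fn)" where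
  "bD M p \<sigma> F = (\<lambda>q. if q < p then Dil M (F (inv_into {..<p} \<sigma> q)) else (\<lambda>x. 0))"

definition bDinv :: "real^'d^'d \<Rightarrow> nat \<Rightarrow> (nat \<Rightarrow> nat) \<Rightarrow> (nat \<Rightarrow> ('d::finite) fn) \<Rightarrow> (nat \<Rightarrow> 'd fn)" where
  "bDinv M p \<sigma> F = (\<lambda>q. if q < p then DilInv M (F (\<sigma> q)) else (\<lambda>x. 0))"

definition bDpow :: "real^'d^'d \<Rightarrow> nat \<Rightarrow> (nat \<Rightarrow> nat) \<Rightarrow> int \<Rightarrow> (nat \<Rightarrow> ('d::finite) fn) \<Rightarrow> (nat \<Rightarrow> 'd fn)" where
  "bDpow M p \<sigma> j = (if j \<ge> 0 then bD M p \<sigma> ^^ nat j else bDinv M p \<sigma> ^^ nat (- j))"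

definition bT :: "real^'d^'d \<Rightarrow> (nat \<Rightarrow> real^'d) \<Rightarrow> int^'d \<Rightarrow> (nat \<Rightarrow> ('d::finite) fn) \<Rightarrow> (nat \<Rightarrow> 'd fn)" where
  "bT P \<theta> k F = (\<lambda>q x. exp (2 * complex_of_real pi * \<i> * complex_of_real (vec_of_int k \<bullet> \<theta> q))
                         * Tr (matrix_inv P *v vec_of_int k) (F q) x)"

definition Sop :: "nat \<Rightarrow> ('d::finite) fn \<Rightarrow> (nat \<Rightarrow> 'd fn)" where
  "Sop p f = (\<lambda>q. if q < p then (\<lambda>x. f x / complex_of_real (sqrt (real p))) else (\<lambda>x. 0))"

end

theory Submission
  imports Defs "HOL-Computational_Algebra.Fundamental_Theorem_Algebra"
begin

text \<open>
  Write \<open>S*\<close> for the adjoint of \<open>S\<close> and \<open>W\<close> for the frame sum of the affine system.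
  The operators satisfy \<open>T_k D = D T_(M'k)\<close> and \<open>T_(Pm) S = S T_m\<close> (with the operators of
  the vector-valued space, except for the last \<open>T_m\<close>), while character sums over the \<open>\<theta>*_q\<close> give \<open>S* T_k S = 0\<close> for \<open>k\<close> outside \<open>P Z^d\<close>. Hence the
  frame sum of \<open>S f\<close> equals \<open>W f\<close>, which is the easy direction.

  For the converse let \<open>r\<close> run over representatives of \<open>Z^d / P Z^d\<close>. By admissibility every \<open>k\<close> is
  uniquely \<open>M'^j r + P m\<close> for each \<open>j \<ge> 0\<close>, so the scales \<open>j \<ge> 0\<close> of the frame sum of \<open>G\<close> equal
  the sum over \<open>r\<close> of the scales \<open>j \<ge> 0\<close> of \<open>W (S* T_(-r) G)\<close>, and the squared norms of the
  \<open>S* T_(-r) G\<close> add up to that of \<open>G\<close>. Taking \<open>G = D^J F\<close> and \<open>J \<rightarrow> \<infinity>\<close> recovers the full frame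
  sum of \<open>F\<close>, provided that the scales \<open>j < 0\<close> of \<open>W (S* T_(-r) D^J F)\<close> become negligible. To see
  this, choose all \<open>r \<noteq> 0\<close>: then \<open>T_(-r) D^J F\<close> concentrates near the nonzero point \<open>- P^(-1) r\<close>,
  and since \<open>M\<close> is expansive a point \<open>y + k\<close>, \<open>k \<in> Z^d\<close>, visits a small ball around it under the powers
  of \<open>M\<close> only boundedly often, and not at all in the limit for almost every \<open>y\<close>.
  The orthonormal case reduces to frame bounds 1 by Parseval's identity.
\<close>

section \<open>The space of square-integrable functions\<close>

text \<open>The obstacle is the coarse scales \<open>j < 0\<close>. A translation by
  \<open>P^(-1) k\<close> passes through \<open>D^j\<close> as the translation indexed by
  \<open>M'^j k\<close>, which is an integer vector for every \<open>k\<close> only if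
  \<open>j \<ge> 0\<close>; so the exact algebra is confined to the fine scales. Dropping coarse
  scales can only decrease a frame sum, hence the upper bound survives without any estimate. Only
  the lower bound needs decay, and there the upper bound is used once more, to discard a tail of
  small norm. The representative of the trivial coset has to be moved off \<open>0\<close>: near
  \<open>0\<close> an orbit can linger arbitrarily long before it is expelled, so visits have no
  uniform bound. A nonzero element of \<open>P Z^d\<close> does equally well, because the counting
  sees only cosets. Expansiveness enters as invertibility and as growth of \<open>M^l\<close> on all
  vectors; the growth comes from complex eigenvalues through polynomials that annihilate a single
  vector. Frame sums are taken in the extended non-negative reals so that they can be split and
  rearranged before they are known to be finite.\<close>

definition l2_sq :: "('d::finite) fn \<Rightarrow> real" where
  "l2_sq f = (LINT x|lebesgue. (cmod (f x))\<^sup>2)"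

lemma L2_measurable [measurable_dest]: "f \<in> L2 \<Longrightarrow> f \<in> borel_measurable lebesgue"
  by (simp add: L2_def)

lemma L2_integrable: "f \<in> L2 \<Longrightarrow> integrable lebesgue (\<lambda>x. (cmod (f x))\<^sup>2)"
  by (simp add: L2_def)

lemma L2I: "f \<in> borel_measurable lebesgue \<Longrightarrow> integrable lebesgue (\<lambda>x. (cmod (f x))\<^sup>2) \<Longrightarrow> f \<in> L2"
  by (simp add: L2_def)

lemma l2_sq_nonneg [simp]: "l2_sq f \<ge> 0"
  by (simp add: l2_sq_def)

lemma cmod_add_sq_le: "(cmod (a + b))\<^sup>2 \<le> 2 * (cmod a)\<^sup>2 + 2 * (cmod b)\<^sup>2"
proof -
  have "(cmod (a + b))\<^sup>2 \<le> (cmod a + cmod b)\<^sup>2"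
    by (intro power_mono norm_triangle_ineq) auto
  also have "\<dots> \<le> 2 * (cmod a)\<^sup>2 + 2 * (cmod b)\<^sup>2"
    using zero_le_power2[of "cmod a - cmod b"] by (simp add: power2_eq_square algebra_simps)
  finally show ?thesis .
qed

lemma L2_zero [simp]: "(\<lambda>x. 0) \<in> L2"
  by (rule L2I) auto

lemma L2_add:
  assumes "f \<in> L2" "g \<in> L2" shows "(\<lambda>x. f x + g x) \<in> L2"
proof (rule L2I)
  note [measurable] = L2_measurable[OF assms(1)] L2_measurable[OF assms(2)]
  show "(\<lambda>x. f x + g x) \<in> borel_measurable lebesgue" by measurable
  show "integrable lebesgue (\<lambda>x. (cmod (f x + g x))\<^sup>2)"
  proof (rule Bochner_Integration.integrable_bound)
    show "integrable lebesgue (\<lambda>x. 2 * (cmod (f x))\<^sup>2 + 2 * (cmod (g x))\<^sup>2)"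
      by (intro Bochner_Integration.integrable_add integrable_mult_right L2_integrable assms)
    show "AE x in lebesgue. norm ((cmod (f x + g x))\<^sup>2) \<le> norm (2 * (cmod (f x))\<^sup>2 + 2 * (cmod (g x))\<^sup>2)"
      using cmod_add_sq_le by (intro AE_I2) (simp add: abs_of_nonneg)
  qed measurable
qed

lemma L2_scale: "f \<in> L2 \<Longrightarrow> (\<lambda>x. c * f x) \<in> L2"
  by (rule L2I) (auto simp: norm_mult power_mult_distrib intro: L2_measurable L2_integrable)

lemma L2_divide: "f \<in> L2 \<Longrightarrow> (\<lambda>x. f x / c) \<in> L2"
  using L2_scale[of f "1/c"] by simp

lemma L2_diff: "f \<in> L2 \<Longrightarrow> g \<in> L2 \<Longrightarrow> (\<lambda>x. f x - g x) \<in> L2"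
  using L2_add[OF _ L2_scale[of g "-1"], of f] by simp

lemma L2_sum: "(\<And>i. i \<in> I \<Longrightarrow> f i \<in> L2) \<Longrightarrow> (\<lambda>x. \<Sum>i\<in>I. f i x) \<in> L2"
  by (induction I rule: infinite_finite_induct) (auto intro: L2_add)

lemma L2_indicator:
  assumes "f \<in> L2" "S \<in> sets lebesgue" shows "(\<lambda>x. f x * indicator S x) \<in> L2"
proof (rule L2I)
  note [measurable] = L2_measurable[OF assms(1)] assms(2)
  show "(\<lambda>x. f x * indicator S x) \<in> borel_measurable lebesgue" by measurable
  show "integrable lebesgue (\<lambda>x. (cmod (f x * indicator S x))\<^sup>2)"
    by (rule Bochner_Integration.integrable_bound[OF L2_integrable[OF assms(1)]])
       (auto simp: indicator_def norm_mult split: split_indicator)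
qed

lemma L2_integrable_mult:
  assumes "f \<in> L2" "g \<in> L2" shows "integrable lebesgue (\<lambda>x. f x * cnj (g x))"
proof (rule Bochner_Integration.integrable_bound)
  note [measurable] = L2_measurable[OF assms(1)] L2_measurable[OF assms(2)]
  show "integrable lebesgue (\<lambda>x. (cmod (f x))\<^sup>2 + (cmod (g x))\<^sup>2)"
    using assms by (auto intro: L2_integrable)
  show "(\<lambda>x. f x * cnj (g x)) \<in> borel_measurable lebesgue"
    by (intro borel_measurable_times L2_measurable assms measurable_compose[OF L2_measurable[OF assms(2)]]
        borel_measurable_continuous_onI continuous_intros)
  have "cmod a * cmod b \<le> (cmod a)\<^sup>2 + (cmod b)\<^sup>2" for a b
    using zero_le_power2[of "cmod a - cmod b"] mult_nonneg_nonneg[of "cmod a" "cmod b"]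
      norm_ge_zero[of a] norm_ge_zero[of b] unfolding power2_diff by linarith
  then show "AE x in lebesgue. norm (f x * cnj (g x)) \<le> norm ((cmod (f x))\<^sup>2 + (cmod (g x))\<^sup>2)"
    by (intro AE_I2) (simp add: norm_mult abs_of_nonneg)
qed

lemma l2_inner_self: "l2_inner f f = complex_of_real (l2_sq f)"
  by (simp add: l2_inner_def l2_sq_def flip: complex_norm_square integral_complex_of_real)

lemma Re_l2_inner_self [simp]: "Re (l2_inner f f) = l2_sq f"
  by (simp add: l2_inner_self)

lemma l2_inner_add_left:
  "f \<in> L2 \<Longrightarrow> g \<in> L2 \<Longrightarrow> h \<in> L2 \<Longrightarrow> l2_inner (\<lambda>x. f x + g x) h = l2_inner f h + l2_inner g h"
  unfolding l2_inner_def
  by (simp add: distrib_right L2_integrable_mult)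

lemma l2_inner_scale_left: "l2_inner (\<lambda>x. c * f x) h = c * l2_inner f h"
  unfolding l2_inner_def by (simp add: mult.assoc)

lemma l2_inner_divide_left: "l2_inner (\<lambda>x. f x / c) h = l2_inner f h / c"
  using l2_inner_scale_left[of "1/c" f h] by simp

lemma l2_inner_commute: "l2_inner g f = cnj (l2_inner f g)"
  unfolding l2_inner_def by (subst Bochner_Integration.integral_cnj[symmetric]) (simp add: mult.commute)

lemma l2_inner_scale_right: "l2_inner f (\<lambda>x. c * h x) = cnj c * l2_inner f h"
  by (subst l2_inner_commute, subst l2_inner_scale_left, subst (2) l2_inner_commute) simp

lemma l2_inner_divide_right: "l2_inner f (\<lambda>x. h x / c) = l2_inner f h / cnj c"
  using l2_inner_scale_right[of f "1/c" h] by simp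

lemma l2_inner_zero_left [simp]: "l2_inner (\<lambda>x. 0) h = 0"
  by (simp add: l2_inner_def)

lemma l2_inner_zero_right [simp]: "l2_inner h (\<lambda>x. 0) = 0"
  by (simp add: l2_inner_def)

lemma l2_inner_sum_left:
  "(\<And>i. i \<in> I \<Longrightarrow> f i \<in> L2) \<Longrightarrow> h \<in> L2 \<Longrightarrow> l2_inner (\<lambda>x. \<Sum>i\<in>I. f i x) h = (\<Sum>i\<in>I. l2_inner (f i) h)"
  by (induction I rule: infinite_finite_induct) (auto simp: l2_inner_add_left L2_sum)

lemma l2_inner_sum_right:
  "(\<And>i. i \<in> I \<Longrightarrow> f i \<in> L2) \<Longrightarrow> h \<in> L2 \<Longrightarrow> l2_inner h (\<lambda>x. \<Sum>i\<in>I. f i x) = (\<Sum>i\<in>I. l2_inner h (f i))"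
  by (subst l2_inner_commute, subst l2_inner_sum_left, auto) (metis l2_inner_commute)

lemma l2_inner_diff_left:
  "f \<in> L2 \<Longrightarrow> g \<in> L2 \<Longrightarrow> h \<in> L2 \<Longrightarrow> l2_inner (\<lambda>x. f x - g x) h = l2_inner f h - l2_inner g h"
  unfolding l2_inner_def
  by (simp add: left_diff_distrib L2_integrable_mult)

lemma l2_inner_diff_right:
  "f \<in> L2 \<Longrightarrow> g \<in> L2 \<Longrightarrow> h \<in> L2 \<Longrightarrow> l2_inner h (\<lambda>x. f x - g x) = l2_inner h f - l2_inner h g"
  by (subst l2_inner_commute, subst l2_inner_diff_left, auto) (metis l2_inner_commute)

lemma l2_sq_scale: "l2_sq (\<lambda>x. c * f x) = (cmod c)\<^sup>2 * l2_sq f"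
  by (simp add: l2_sq_def norm_mult power_mult_distrib)

lemma l2_sq_diff:
  assumes "f \<in> L2" "g \<in> L2"
  shows "l2_sq (\<lambda>x. f x - g x) = l2_sq f - 2 * Re (l2_inner f g) + l2_sq g"
proof -
  have "l2_sq (\<lambda>x. f x - g x) = Re (l2_inner (\<lambda>x. f x - g x) (\<lambda>x. f x - g x))"
    by simp
  also have "l2_inner (\<lambda>x. f x - g x) (\<lambda>x. f x - g x) =
      l2_inner f f - l2_inner f g - (l2_inner g f - l2_inner g g)"
    using assms by (simp add: l2_inner_diff_left l2_inner_diff_right L2_diff)
  finally show ?thesis
    by (simp add: l2_inner_self l2_inner_commute[of g f])
qed

text \<open>The norm of \<open>f - t c g\<close> with \<open>c = l2_inner f g\<close> is expanded;
  this choice of \<open>c\<close> makes the cross term real. The quadratic in \<open>t\<close> is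
  tested at \<open>t = 1 / l2_sq g\<close>, and if \<open>l2_sq g = 0\<close> it is linear in
  \<open>t\<close>, so boundedness below forces \<open>c = 0\<close>.\<close>

lemma l2_cauchy_schwarz:
  assumes "f \<in> L2" "g \<in> L2"
  shows "(cmod (l2_inner f g))\<^sup>2 \<le> l2_sq f * l2_sq g"
proof -
  define c where "c = l2_inner f g"
  define N where "N = (cmod c)\<^sup>2"
  have main: "0 \<le> l2_sq f - 2 * t * N + t\<^sup>2 * N * l2_sq g" for t :: real
  proof -
    have "0 \<le> l2_sq (\<lambda>x. f x - (complex_of_real t * c) * g x)" by simp
    also have "\<dots> = l2_sq f - 2 * Re (l2_inner f (\<lambda>x. (complex_of_real t * c) * g x)) +
        l2_sq (\<lambda>x. (complex_of_real t * c) * g x)"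
      by (intro l2_sq_diff assms L2_scale)
    also have "l2_inner f (\<lambda>x. (complex_of_real t * c) * g x) = of_real (t * N)"
      unfolding l2_inner_scale_right N_def c_def[symmetric]
      by (simp add: complex_norm_square mult.commute mult.assoc del: of_real_power)
    also have "l2_sq (\<lambda>x. (complex_of_real t * c) * g x) = t\<^sup>2 * N * l2_sq g"
      by (simp add: l2_sq_scale N_def norm_mult power_mult_distrib)
    finally show ?thesis by simp
  qed
  show ?thesis
  proof (cases "l2_sq g = 0")
    case True
    have "N \<le> 0"
    proof (rule ccontr)
      assume "\<not> N \<le> 0"
      then show False
        using main[of "(l2_sq f + 1) / (2 * N)"] True by (simp add: field_simps)
    qed
    then show ?thesis using True by (simp add: N_def c_def)
  next
    case False
    then have "l2_sq g > 0" using l2_sq_nonneg[of g] by linarith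
    then show ?thesis
      using main[of "1 / l2_sq g"] by (simp add: N_def c_def field_simps power2_eq_square)
  qed
qed

lemma l2_sq_add_le:
  assumes "f \<in> L2" "g \<in> L2"
  shows "l2_sq (\<lambda>x. f x + g x) \<le> 2 * l2_sq f + 2 * l2_sq g"
proof -
  have "l2_sq (\<lambda>x. f x + g x) \<le> (LINT x|lebesgue. 2 * (cmod (f x))\<^sup>2 + 2 * (cmod (g x))\<^sup>2)"
    unfolding l2_sq_def
    by (intro integral_mono L2_integrable L2_add assms Bochner_Integration.integrable_add
        integrable_mult_right cmod_add_sq_le)
  also have "\<dots> = 2 * l2_sq f + 2 * l2_sq g"
    unfolding l2_sq_def using assms by (simp add: L2_integrable)
  finally show ?thesis .
qed

lemma ennreal_l2_sq:
  assumes "f \<in> L2" shows "ennreal (l2_sq f) = (\<integral>\<^sup>+x. ennreal ((cmod (f x))\<^sup>2) \<partial>lebesgue)"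
  unfolding l2_sq_def by (rule nn_integral_eq_integral[symmetric]) (auto intro: L2_integrable assms)

text \<open>Concentration of \<open>f\<close> becomes smallness of its coefficients in this way:
  only the mass that \<open>g\<close> carries on \<open>S\<close> counts.\<close>

lemma l2_cauchy_schwarz_support:
  assumes "f \<in> L2" "g \<in> L2" "S \<in> sets lebesgue" "\<And>x. x \<notin> S \<Longrightarrow> f x = 0"
  shows "(cmod (l2_inner f g))\<^sup>2 \<le> l2_sq f * l2_sq (\<lambda>x. g x * indicator S x)"
proof -
  have "l2_inner f g = l2_inner f (\<lambda>x. g x * indicator S x)"
    unfolding l2_inner_def
    by (intro Bochner_Integration.integral_cong) (use assms(4) in \<open>auto split: split_indicator\<close>)
  then show ?thesis using l2_cauchy_schwarz[OF assms(1) L2_indicator[OF assms(2,3)]] by simp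
qed

lemma l2_sq_truncate_tendsto:
  assumes f: "f \<in> L2"
  shows "(\<lambda>R::nat. l2_sq (\<lambda>x. f x - f x * indicator (ball 0 (real R)) x)) \<longlonglongrightarrow> 0"
proof -
  note [measurable] = L2_measurable[OF f]
  have "(\<lambda>R::nat. LINT x|lebesgue. (cmod (f x - f x * indicator (ball 0 (real R)) x))\<^sup>2)
      \<longlonglongrightarrow> (LINT x::real^'a|lebesgue. 0)"
  proof (rule integral_dominated_convergence[where w="\<lambda>x. (cmod (f x))\<^sup>2"])
    show "AE x in lebesgue. (\<lambda>R. (cmod (f x - f x * indicator (ball 0 (real R)) x))\<^sup>2) \<longlonglongrightarrow> 0"
    proof (rule AE_I2)
      fix x :: "real^'a"
      obtain N :: nat where N: "norm x < real N" using reals_Archimedean2 by blast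
      show "(\<lambda>R. (cmod (f x - f x * indicator (ball 0 (real R)) x))\<^sup>2) \<longlonglongrightarrow> 0"
        by (rule tendsto_eventually, rule eventually_sequentiallyI[of N]) (use N in auto)
    qed
    show "AE x in lebesgue. norm ((cmod (f x - f x * indicator (ball 0 (real R)) x))\<^sup>2) \<le> (cmod (f x))\<^sup>2" for R
      by (intro AE_I2) (auto split: split_indicator)
    show "(\<lambda>x. (cmod (f x - f x * indicator (ball 0 (real R)) x))\<^sup>2) \<in> borel_measurable lebesgue" for R
    proof -
      have [measurable]: "ball 0 (real R) \<in> sets (lebesgue :: (real^'a) measure)"
        by simp
      show ?thesis by measurable
    qed
  qed (simp_all add: L2_integrable f)
  then show ?thesis by (simp add: l2_sq_def)
qed

section \<open>Linear change of variables for the Lebesgue measure\<close>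

text \<open>The linear change of variables in the library asks for a well-ordered index type. An
  arbitrary finite index type is therefore replaced by a well-ordered copy of itself.\<close>

typedef 'a wo = "UNIV :: 'a set" by simp

lemma bij_Rep_wo: "bij Rep_wo"
  by (rule o_bij[of Abs_wo]) (auto simp: fun_eq_iff Rep_wo_inverse Abs_wo_inverse)

instance wo :: (finite) finite
proof
  have "inj (Rep_wo :: 'a wo \<Rightarrow> 'a)" using bij_Rep_wo by (rule bij_is_inj)
  then show "finite (UNIV :: 'a wo set)"
    by (rule inj_on_finite[where B=UNIV]) auto
qed

instantiation wo :: (finite) wellorder
begin

definition less_eq_wo :: "'a wo \<Rightarrow> 'a wo \<Rightarrow> bool" where
  "less_eq_wo x y \<longleftrightarrow> to_nat_on (UNIV :: 'a set) (Rep_wo x) \<le> to_nat_on (UNIV :: 'a set) (Rep_wo y)"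

definition less_wo :: "'a wo \<Rightarrow> 'a wo \<Rightarrow> bool" where
  "less_wo x y \<longleftrightarrow> to_nat_on (UNIV :: 'a set) (Rep_wo x) < to_nat_on (UNIV :: 'a set) (Rep_wo y)"

instance
proof
  fix x y z :: "'a wo" and P :: "'a wo \<Rightarrow> bool"
  show "(x < y) = (x \<le> y \<and> \<not> y \<le> x)" "x \<le> x" "x \<le> y \<Longrightarrow> y \<le> z \<Longrightarrow> x \<le> z" "x \<le> y \<or> y \<le> x"
    by (auto simp: less_eq_wo_def less_wo_def)
  show "x \<le> y \<Longrightarrow> y \<le> x \<Longrightarrow> x = y"
    using to_nat_on_inj[of "UNIV :: 'a set"] by (simp add: less_eq_wo_def Rep_wo_inject countable_finite)
  show "P x" if step: "\<And>x. (\<And>y. y < x \<Longrightarrow> P y) \<Longrightarrow> P x"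
    by (induction x rule: measure_induct[of "\<lambda>x. to_nat_on (UNIV :: 'a set) (Rep_wo x)"])
       (auto intro: step simp: less_wo_def)
qed

end

text \<open>Conjugation by \<open>f\<close> matches the permutations of the two index types and
  preserves the sign, so the two Leibniz expansions agree term by term.\<close>

lemma det_reindex:
  fixes A :: "'a::comm_ring_1^'n::finite^'n" and f :: "'m::finite \<Rightarrow> 'n"
  assumes f: "bij f"
  shows "det (\<chi> i j. A $ f i $ f j) = det A"
proof -
  have inv: "inv f (f i) = i" "f (inv f k) = k" for i k
    using f by (simp_all add: bij_is_inj bij_is_surj surj_f_inv_f)
  have sgn: "sign (f \<circ> p \<circ> inv f) = sign p" if "p permutes UNIV" for p
    using sign_map_permutation[OF bij_is_inj[OF f] that] bij_is_surj[OF f]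
    by (simp add: map_permutation_def restrict_id_def comp_def)
  have bij: "bij (f \<circ> p \<circ> inv f)" if "bij p" for p
    using that f by (intro bij_comp bij_imp_bij_inv)
  have bij': "bij (inv f \<circ> q \<circ> f)" if "bij q" for q
    using that f by (intro bij_comp bij_imp_bij_inv)
  show ?thesis
    unfolding det_def
  proof (rule sum.reindex_bij_witness[of _ "\<lambda>q. inv f \<circ> q \<circ> f" "\<lambda>p. f \<circ> p \<circ> inv f"])
    fix p :: "'m \<Rightarrow> 'm" assume p: "p \<in> {p. p permutes UNIV}"
    show "inv f \<circ> (f \<circ> p \<circ> inv f) \<circ> f = p" by (simp add: fun_eq_iff inv)
    show "f \<circ> p \<circ> inv f \<in> {p. p permutes UNIV}"
      using p bij[of p] by (simp add: permutes_altdef)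
    have "(\<Prod>i\<in>UNIV. A $ i $ (f \<circ> p \<circ> inv f) i) = (\<Prod>i\<in>UNIV. A $ f i $ f (p i))"
      by (rule prod.reindex_bij_witness[of _ f "inv f"]) (simp_all add: inv)
    then show "of_int (sign (f \<circ> p \<circ> inv f)) * (\<Prod>i\<in>UNIV. A $ i $ (f \<circ> p \<circ> inv f) i) =
      of_int (sign p) * (\<Prod>i\<in>UNIV. (\<chi> i j. A $ f i $ f j) $ i $ p i)"
      using sgn p by simp
  next
    fix q :: "'n \<Rightarrow> 'n" assume q: "q \<in> {p. p permutes UNIV}"
    show "f \<circ> (inv f \<circ> q \<circ> f) \<circ> inv f = q" by (simp add: fun_eq_iff inv)
    show "inv f \<circ> q \<circ> f \<in> {p. p permutes UNIV}"
      using q bij'[of q] by (simp add: permutes_altdef)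
  qed
qed

lemma prod_Basis_cart: "(\<Prod>b\<in>Basis. x \<bullet> b) = (\<Prod>i\<in>UNIV. x $ i)" for x :: "real^'n::finite"
proof -
  have B: "(Basis :: (real^'n) set) = range (\<lambda>i. axis i 1)"
    by (auto simp: Basis_vec_def)
  show ?thesis
    unfolding B by (subst prod.reindex) (auto simp: inner_axis inj_on_def axis_eq_axis)
qed

text \<open>Relabelling coordinates takes boxes to boxes with the same side lengths, and the volume
  of boxes determines Lebesgue measure.\<close>

lemma distr_lborel_reindex:
  fixes f :: "'m::finite \<Rightarrow> 'n::finite"
  assumes f: "bij f"
  shows "distr lborel borel (\<lambda>x :: real^'n. \<chi> i. x $ f i) = lborel"
proof (rule lborel_eqI[symmetric])
  have inv: "inv f (f i) = i" "f (inv f k) = k" for i k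
    using f by (simp_all add: bij_is_inj bij_is_surj surj_f_inv_f)
  have [measurable]: "(\<lambda>x :: real^'n. \<chi> i. x $ f i) \<in> borel \<rightarrow>\<^sub>M borel"
    by (intro borel_measurable_continuous_onI continuous_intros)
  fix l u :: "real^'m" assume le: "\<And>b. b \<in> Basis \<Longrightarrow> l \<bullet> b \<le> u \<bullet> b"
  have le': "l $ i \<le> u $ i" for i
    using le[of "axis i 1"] by (simp add: inner_axis axis_in_Basis_iff)
  have vim: "(\<lambda>x :: real^'n. \<chi> i. x $ f i) -` box l u = box (\<chi> k. l $ inv f k) (\<chi> k. u $ inv f k)"
    by (auto simp: mem_box_cart inv) (metis inv)+
  have "emeasure (distr lborel borel (\<lambda>x :: real^'n. \<chi> i. x $ f i)) (box l u) =
      emeasure lborel (box (\<chi> k. l $ inv f k) (\<chi> k. u $ inv f k) :: (real^'n) set)"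
    by (subst emeasure_distr) (simp_all add: vim)
  also have "\<dots> = ennreal (\<Prod>b\<in>Basis. ((\<chi> k. u $ inv f k) - (\<chi> k. l $ inv f k) :: real^'n) \<bullet> b)"
    by (subst emeasure_lborel_box) (auto simp: Basis_vec_def inner_axis le')
  also have "\<dots> = ennreal (\<Prod>b\<in>Basis. (u - l) \<bullet> b)"
    unfolding prod_Basis_cart
    by (intro arg_cong[where f=ennreal] prod.reindex_bij_witness[of _ f "inv f"]) (simp_all add: inv)
  finally show "emeasure (distr lborel borel (\<lambda>x :: real^'n. \<chi> i. x $ f i)) (box l u) =
      ennreal (\<Prod>b\<in>Basis. (u - l) \<bullet> b)" .
qed simp

lemma
  fixes M :: "real^'d::finite^'d"
  assumes "invertible M"
  shows matrix_inv_right: "M ** matrix_inv M = mat 1"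
    and matrix_inv_left: "matrix_inv M ** M = mat 1"
  using someI_ex[of "\<lambda>M'. M ** M' = mat 1 \<and> M' ** M = mat 1"] assms
  unfolding invertible_def matrix_inv_def by auto

lemma matrix_inv_mult_vec:
  fixes M :: "real^'d::finite^'d"
  assumes "invertible M"
  shows "matrix_inv M *v (M *v x) = x" "M *v (matrix_inv M *v x) = x"
  using assms by (simp_all add: matrix_vector_mul_assoc matrix_inv_left matrix_inv_right)

lemma det_matrix_inv:
  fixes M :: "real^'d::finite^'d"
  assumes "invertible M"
  shows "det (matrix_inv M) = 1 / det M"
proof -
  have "det M * det (matrix_inv M) = 1"
    using assms by (simp add: matrix_inv_right flip: det_mul)
  then show ?thesis by (cases "det M = 0") (auto simp: field_simps)
qed

lemma invertible_matrix_inv: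
  fixes M :: "real^'d::finite^'d"
  shows "invertible M \<Longrightarrow> invertible (matrix_inv M)"
  using matrix_inv_left[of M] matrix_inv_right[of M] unfolding invertible_def by blast

lemma vimage_mult_vec:
  fixes M :: "real^'d::finite^'d"
  assumes "invertible M"
  shows "(*v) M -` S = (*v) (matrix_inv M) ` S"
proof safe
  fix x assume "M *v x \<in> S"
  then show "x \<in> (*v) (matrix_inv M) ` S"
    using assms by (intro image_eqI[of _ _ "M *v x"]) (simp_all add: matrix_inv_mult_vec)
qed (simp add: assms matrix_inv_mult_vec)

lemma borel_measurable_mult_vec [measurable]:
  fixes M :: "real^'d::finite^'d"
  shows "(*v) M \<in> borel \<rightarrow>\<^sub>M borel"
  by (intro borel_measurable_continuous_onI linear_continuous_on matrix_vector_mul_bounded_linear)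

lemma distr_lborel_mult_vec_wellorder:
  fixes M :: "real^'d::{finite,wellorder}^'d::_"
  assumes M: "invertible M"
  shows "distr lborel borel ((*v) M) = density lborel (\<lambda>_. ennreal (1 / \<bar>det M\<bar>))"
proof (rule measure_eqI)
  fix S :: "(real^'d::_) set" assume "S \<in> sets (distr lborel borel ((*v) M))"
  then have S: "S \<in> sets borel" by simp
  then have Sl: "S \<in> sets lebesgue" by simp
  have d: "det M \<noteq> 0" using M by (simp add: invertible_det_nz)
  have vim: "(*v) (matrix_inv M) ` S \<in> sets borel"
    using measurable_sets[OF borel_measurable_mult_vec[of M] S] M by (simp add: vimage_mult_vec)
  have "emeasure (distr lborel borel ((*v) M)) S = emeasure lborel ((*v) (matrix_inv M) ` S)"
    using S M by (subst emeasure_distr) (simp_all add: vimage_mult_vec)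
  also have "\<dots> = emeasure lebesgue ((*v) (matrix_inv M) ` S)"
    using vim by simp
  also have "\<dots> = ennreal (1 / \<bar>det M\<bar>) * emeasure lebesgue S"
  proof (cases "S \<in> lmeasurable")
    case True
    have "(*v) (matrix_inv M) ` S \<in> lmeasurable"
      by (rule measurable_linear_image[OF matrix_vector_mul_linear True])
    moreover have "measure lebesgue ((*v) (matrix_inv M) ` S) = \<bar>det (matrix ((*v) (matrix_inv M)))\<bar> * measure lebesgue S"
      by (rule measure_linear_image[OF matrix_vector_mul_linear True])
    ultimately show ?thesis
      using True M by (simp add: emeasure_eq_measure2 fmeasurableD2 det_matrix_inv
          matrix_of_matrix_vector_mul abs_divide ennreal_mult[symmetric] del: emeasure_completion)
  next
    \<comment> \<open>Here \<open>S\<close> has infinite measure. Its preimage must too, since a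
      preimage of finite measure would be mapped by \<open>M\<close> back onto \<open>S\<close> with
      finite measure.\<close>
    case False
    have "emeasure lebesgue S = \<infinity>"
    proof (rule ccontr)
      assume "emeasure lebesgue S \<noteq> \<infinity>"
      then have "S \<in> lmeasurable"
        using Sl by (auto simp: fmeasurable_def less_top)
      then show False using False by simp
    qed
    moreover have "emeasure lebesgue ((*v) (matrix_inv M) ` S) = \<infinity>"
    proof (rule ccontr)
      assume "emeasure lebesgue ((*v) (matrix_inv M) ` S) \<noteq> \<infinity>"
      then have "(*v) (matrix_inv M) ` S \<in> lmeasurable"
        using vim by (auto simp: fmeasurable_def less_top)
      then have "(*v) M ` ((*v) (matrix_inv M) ` S) \<in> lmeasurable"
        by (rule measurable_linear_image[OF matrix_vector_mul_linear])
      then show False using False M by (simp add: image_image matrix_inv_mult_vec)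
    qed
    ultimately show ?thesis using d by (simp add: ennreal_mult_top)
  qed
  also have "\<dots> = emeasure (density lborel (\<lambda>_. ennreal (1 / \<bar>det M\<bar>))) S"
    using S by (subst emeasure_density) (simp_all add: nn_integral_cmult)
  finally show "emeasure (distr lborel borel ((*v) M)) S = \<dots>" .
qed simp

text \<open>\<open>M\<close> is factored as relabelling, the relabelled matrix \<open>M'\<close>,
  and relabelling back. Both relabellings preserve the measure and \<open>det M' = det M\<close>, so
  the whole density comes from the middle factor.\<close>

lemma distr_lborel_mult_vec:
  fixes M :: "real^'d::finite^'d"
  assumes M: "invertible M"
  shows "distr lborel borel ((*v) M) = density lborel (\<lambda>_. ennreal (1 / \<bar>det M\<bar>))"
proof -
  define \<phi> :: "real^'d \<Rightarrow> real^'d wo" where "\<phi> x = (\<chi> i. x $ Rep_wo i)" for x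
  define \<phi>' :: "real^'d wo \<Rightarrow> real^'d" where "\<phi>' x = (\<chi> i. x $ inv Rep_wo i)" for x
  define M' :: "real^'d wo^'d wo" where "M' = (\<chi> i j. M $ Rep_wo i $ Rep_wo j)"
  have inv: "inv Rep_wo (Rep_wo i) = i" "Rep_wo (inv Rep_wo k) = k" for i :: "'d wo" and k
    by (rule inv_f_f[OF bij_is_inj[OF bij_Rep_wo]], rule surj_f_inv_f[OF bij_is_surj[OF bij_Rep_wo]])
  have det: "det M' = det M"
    unfolding M'_def by (rule det_reindex[OF bij_Rep_wo])
  have meas [measurable]: "\<phi> \<in> borel \<rightarrow>\<^sub>M borel" "\<phi>' \<in> borel \<rightarrow>\<^sub>M borel"
    unfolding \<phi>_def[abs_def] \<phi>'_def[abs_def]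
    by (intro borel_measurable_continuous_onI continuous_intros)+
  have comp: "(*v) M = \<phi>' \<circ> ((*v) M' \<circ> \<phi>)"
  proof
    fix x
    have "(\<Sum>j\<in>UNIV. M $ i $ j * x $ j) = (\<Sum>j\<in>UNIV. M $ i $ Rep_wo j * x $ Rep_wo j)" for i
      by (rule sum.reindex_bij_witness[of _ Rep_wo "inv Rep_wo"]) (simp_all add: inv)
    then show "M *v x = (\<phi>' \<circ> ((*v) M' \<circ> \<phi>)) x"
      by (simp add: vec_eq_iff matrix_vector_mult_def \<phi>_def \<phi>'_def M'_def inv)
  qed
  have \<phi>: "distr lborel borel \<phi> = lborel"
    unfolding \<phi>_def[abs_def] by (rule distr_lborel_reindex[OF bij_Rep_wo])
  have \<phi>': "distr lborel borel \<phi>' = lborel"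
    unfolding \<phi>'_def[abs_def] by (rule distr_lborel_reindex[OF bij_imp_bij_inv[OF bij_Rep_wo]])
  have "distr lborel borel ((*v) M) = distr (distr (distr lborel borel \<phi>) borel ((*v) M')) borel \<phi>'"
    unfolding comp by (simp add: distr_distr)
  also have "\<dots> = distr (density lborel (\<lambda>_. ennreal (1 / \<bar>det M\<bar>))) borel \<phi>'"
    using M det unfolding \<phi>
    by (subst distr_lborel_mult_vec_wellorder) (simp_all add: invertible_det_nz)
  also have "\<dots> = density (distr lborel borel \<phi>') (\<lambda>_. ennreal (1 / \<bar>det M\<bar>))"
  proof (rule measure_eqI)
    fix A assume "A \<in> sets (distr (density lborel (\<lambda>_. ennreal (1 / \<bar>det M\<bar>))) borel \<phi>')"
    then have A: "A \<in> sets borel" by simp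
    moreover have "\<phi>' -` A \<in> sets borel"
      using measurable_sets[OF meas(2) A] by simp
    ultimately show "emeasure (distr (density lborel (\<lambda>_. ennreal (1 / \<bar>det M\<bar>))) borel \<phi>') A =
        emeasure (density (distr lborel borel \<phi>') (\<lambda>_. ennreal (1 / \<bar>det M\<bar>))) A"
      by (simp add: emeasure_distr emeasure_density nn_integral_cmult)
  qed simp
  finally show ?thesis unfolding \<phi>' .
qed

lemma
  fixes M :: "real^'d::finite^'d"
  assumes M: "invertible M"
  shows lebesgue_measurable_mult_vec: "(*v) M \<in> lebesgue \<rightarrow>\<^sub>M lebesgue"
    and distr_lebesgue_mult_vec:
      "distr lebesgue lebesgue ((*v) M) = density lebesgue (\<lambda>_. ennreal (1 / \<bar>det M\<bar>))"
proof -
  have d: "det M \<noteq> 0" using M by (simp add: invertible_det_nz)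
  have dl: "distr lebesgue lborel ((*v) M) = density lborel (\<lambda>_. ennreal (1 / \<bar>det M\<bar>))"
    using distr_lborel_mult_vec[OF M] by (simp add: distr_completion cong: distr_cong)
  \<comment> \<open>A nonzero constant density has the same null sets as Lebesgue measure. This is
    what lets the Borel statement pass to the completion.\<close>
  have "emeasure lborel A = 0 \<longleftrightarrow> emeasure (distr lebesgue lborel ((*v) M)) A = 0"
    if "A \<in> sets borel" for A
    using that d unfolding dl by (simp add: emeasure_density nn_integral_cmult)
  then have eq: "null_sets (distr lebesgue lborel ((*v) M)) = null_sets lborel"
    by (auto simp: null_sets_def)
  show "(*v) M \<in> lebesgue \<rightarrow>\<^sub>M lebesgue"
    by (simp add: completion.measurable_completion2 eq measurable_completion)
  have "distr lebesgue lebesgue ((*v) M) = completion (distr lebesgue lborel ((*v) M))"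
    by (subst completion.completion_distr_eq) (auto simp: eq measurable_completion)
  also have "\<dots> = density lebesgue (\<lambda>_. ennreal (1 / \<bar>det M\<bar>))"
    unfolding dl using d by (intro completion_density_eq) auto
  finally show "distr lebesgue lebesgue ((*v) M) = \<dots>" .
qed

lemma
  fixes M :: "real^'d::finite^'d"
  assumes M: "invertible M"
  shows nn_integral_mult_vec: "f \<in> borel_measurable lebesgue \<Longrightarrow>
      (\<integral>\<^sup>+x. f (M *v x) \<partial>lebesgue) = ennreal (1 / \<bar>det M\<bar>) * (\<integral>\<^sup>+x. f x \<partial>lebesgue)"
    and integral_mult_vec: "g \<in> borel_measurable lebesgue \<Longrightarrow>
      (LINT x|lebesgue. g (M *v x)) = (1 / \<bar>det M\<bar>) *\<^sub>R (LINT x|lebesgue. g x :: 'b::{banach, second_countable_topology})"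
    and integrable_mult_vec: "g \<in> borel_measurable lebesgue \<Longrightarrow> integrable lebesgue g \<Longrightarrow>
      integrable lebesgue (\<lambda>x. g (M *v x))"
proof -
  note [measurable] = lebesgue_measurable_mult_vec[OF M]
  show "(\<integral>\<^sup>+x. f (M *v x) \<partial>lebesgue) = ennreal (1 / \<bar>det M\<bar>) * (\<integral>\<^sup>+x. f x \<partial>lebesgue)"
    if [measurable]: "f \<in> borel_measurable lebesgue"
    using nn_integral_distr[of "(*v) M" lebesgue lebesgue f]
    by (simp add: distr_lebesgue_mult_vec M nn_integral_density nn_integral_cmult)
  show "(LINT x|lebesgue. g (M *v x)) = (1 / \<bar>det M\<bar>) *\<^sub>R (LINT x|lebesgue. g x)"
    if [measurable]: "g \<in> borel_measurable lebesgue"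
    using integral_distr[of "(*v) M" lebesgue lebesgue g]
    by (simp add: distr_lebesgue_mult_vec M integral_density)
  show "integrable lebesgue (\<lambda>x. g (M *v x))"
    if [measurable]: "g \<in> borel_measurable lebesgue" and "integrable lebesgue g"
    using integrable_distr_eq[of "(*v) M" lebesgue lebesgue g] that
    by (simp add: distr_lebesgue_mult_vec M integrable_density)
qed

lemma lebesgue_measurable_shift [measurable]:
  "(\<lambda>x. x - u) \<in> lebesgue \<rightarrow>\<^sub>M (lebesgue :: 'a::euclidean_space measure)"
  using lebesgue_affine_measurable[of "\<lambda>_. 1" "-u"]
  by (simp add: euclidean_representation)

lemma distr_lebesgue_shift:
  "distr lebesgue lebesgue (\<lambda>x. x - u) = (lebesgue :: 'a::euclidean_space measure)"
  using lebesgue_affine_euclidean[of "\<lambda>_. 1" "-u", symmetric]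
  by (simp add: euclidean_representation density_1)

lemma
  fixes u :: "'a::euclidean_space"
  shows nn_integral_shift: "f \<in> borel_measurable lebesgue \<Longrightarrow>
      (\<integral>\<^sup>+x. f (x - u) \<partial>lebesgue) = (\<integral>\<^sup>+x. f x \<partial>lebesgue)"
    and integral_shift: "g \<in> borel_measurable lebesgue \<Longrightarrow>
      (LINT x|lebesgue. g (x - u)) = (LINT x|lebesgue. g x :: 'b::{banach, second_countable_topology})"
    and integrable_shift: "g \<in> borel_measurable lebesgue \<Longrightarrow> integrable lebesgue g \<Longrightarrow>
      integrable lebesgue (\<lambda>x. g (x - u))"
  using nn_integral_distr[of "\<lambda>x. x - u" lebesgue lebesgue f]
    integral_distr[of "\<lambda>x. x - u" lebesgue lebesgue g]
    integrable_distr_eq[of "\<lambda>x. x - u" lebesgue lebesgue g]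
  by (simp_all add: distr_lebesgue_shift lebesgue_measurable_shift)

section \<open>Translations and dilations as isometries of the function space\<close>

lemma L2_mult_measurable:
  assumes "f \<in> L2" "g \<in> L2" shows "(\<lambda>x. f x * cnj (g x)) \<in> borel_measurable lebesgue"
  using L2_integrable_mult[OF assms] by simp

lemma L2_Tr:
  assumes "f \<in> L2" shows "Tr u f \<in> L2"
proof -
  note [measurable] = L2_measurable[OF assms]
  show ?thesis
    unfolding Tr_def using integrable_shift[OF _ L2_integrable[OF assms]]
    by (intro L2I measurable_compose[OF lebesgue_measurable_shift]) simp_all
qed

lemma l2_inner_Tr: "f \<in> L2 \<Longrightarrow> g \<in> L2 \<Longrightarrow> l2_inner (Tr u f) (Tr u g) = l2_inner f g"
  unfolding l2_inner_def Tr_def using integral_shift[OF L2_mult_measurable] by blast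

lemma L2_Dil:
  assumes "invertible M" "f \<in> L2" shows "Dil M f \<in> L2"
proof -
  note [measurable] = L2_measurable[OF assms(2)]
  have "(\<lambda>x. f (M *v x)) \<in> L2"
    using integrable_mult_vec[OF assms(1) _ L2_integrable[OF assms(2)]]
    by (intro L2I measurable_compose[OF lebesgue_measurable_mult_vec[OF assms(1)]]) simp_all
  then show ?thesis unfolding Dil_def by (rule L2_scale)
qed

lemma l2_inner_Dil:
  assumes "invertible M" "f \<in> L2" "g \<in> L2"
  shows "l2_inner (Dil M f) (Dil M g) = l2_inner f g"
proof -
  have d: "det M \<noteq> 0" using assms by (simp add: invertible_det_nz)
  have "l2_inner (Dil M f) (Dil M g) =
      complex_of_real \<bar>det M\<bar> * (LINT x|lebesgue. f (M *v x) * cnj (g (M *v x)))"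
    unfolding Dil_def l2_inner_scale_left l2_inner_scale_right
    by (simp add: l2_inner_def flip: of_real_mult mult.assoc)
  also have "\<dots> = l2_inner f g"
    using d integral_mult_vec[OF assms(1) L2_mult_measurable[OF assms(2,3)]]
    by (simp add: l2_inner_def scaleR_conv_of_real)
  finally show ?thesis .
qed

lemma DilInv_eq: "invertible M \<Longrightarrow> DilInv M f = Dil (matrix_inv M) f"
  by (simp add: DilInv_def Dil_def fun_eq_iff det_matrix_inv real_sqrt_divide)

lemma L2_DilInv: "invertible M \<Longrightarrow> f \<in> L2 \<Longrightarrow> DilInv M f \<in> L2"
  by (simp add: DilInv_eq L2_Dil invertible_matrix_inv)

lemma Dil_DilInv:
  assumes "invertible M" shows "Dil M (DilInv M f) = f" "DilInv M (Dil M f) = f"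
proof -
  have "det M \<noteq> 0" using assms by (simp add: invertible_det_nz)
  then show "Dil M (DilInv M f) = f" "DilInv M (Dil M f) = f"
    using assms by (simp_all add: Dil_def DilInv_def matrix_inv_mult_vec fun_eq_iff)
qed

section \<open>Expansive matrices\<close>

text \<open>Once the error is below \<open>m * (1 - q)\<close> with \<open>m = r / 2\<close>, the
  excess of \<open>a\<close> over \<open>m\<close> shrinks by the factor \<open>q\<close> in each
  step, so \<open>a\<close> eventually stays below \<open>2 * m = r\<close>.\<close>

lemma contraction_with_error_tendsto_zero:
  fixes a e :: "nat \<Rightarrow> real"
  assumes a0: "\<And>n. a n \<ge> 0" and q: "0 \<le> q" "q < 1"
    and step: "\<And>n. a (Suc n) \<le> q * (a n + e n)" and e: "e \<longlonglongrightarrow> 0"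
  shows "a \<longlonglongrightarrow> 0"
proof (rule LIMSEQ_I)
  fix r :: real assume r: "r > 0"
  define m where "m = r / 2"
  have m: "m > 0" using r by (simp add: m_def)
  have "m * (1 - q) > 0" using m q by simp
  with e obtain N where N: "\<And>n. n \<ge> N \<Longrightarrow> \<bar>e n\<bar> < m * (1 - q)"
    using LIMSEQ_D[of e 0 "m * (1 - q)"] by auto
  have "a (N + k) - m \<le> q ^ k * \<bar>a N - m\<bar>" for k
  proof (induction k)
    case (Suc k)
    have "e (N + k) \<le> m * (1 - q)" using N[of "N + k"] by auto
    then have "a (Suc (N + k)) \<le> q * (a (N + k) + m * (1 - q))"
      using step[of "N + k"] q by (meson add_left_mono mult_left_mono order_trans)
    also have "q * (a (N + k) + m * (1 - q)) = q * (a (N + k) - m) + m - m * (1 - q)\<^sup>2"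
      by (simp add: algebra_simps power2_eq_square)
    also have "\<dots> \<le> q * (a (N + k) - m) + m" using m by simp
    also have "\<dots> \<le> q * (q ^ k * \<bar>a N - m\<bar>) + m"
      using Suc q by (intro add_mono mult_left_mono) auto
    finally show ?case by (simp add: mult.assoc)
  qed simp
  moreover have "(\<lambda>k. q ^ k * \<bar>a N - m\<bar>) \<longlonglongrightarrow> 0"
    using q by (intro tendsto_mult_left_zero LIMSEQ_realpow_zero)
  then obtain K where K: "\<And>k. k \<ge> K \<Longrightarrow> \<bar>q ^ k * \<bar>a N - m\<bar>\<bar> < m"
    using LIMSEQ_D[of _ 0 m] m by fastforce
  ultimately have "a (N + k) < r" if "k \<ge> K" for k
    using that by (smt (verit) m_def field_sum_of_halves)
  then have "norm (a n - 0) < r" if "n \<ge> N + K" for n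
    using that a0[of n] by (metis add_leD1 diff_zero le_Suc_ex nat_add_left_cancel_le real_norm_def abs_of_nonneg)
  then show "\<exists>no. \<forall>n\<ge>no. norm (a n - 0) < r" by blast
qed

lemma funpow_mult_vec_diff_scale:
  fixes A :: "'a::field^'n::finite^'n"
  shows "((*v) A ^^ k) (x - b *s y) = ((*v) A ^^ k) x - b *s ((*v) A ^^ k) y"
  by (induction k) (simp_all add: vector_scalar_commute matrix_vector_mult_diff_distrib)

lemma funpow_mult_vec_inverse:
  fixes A N :: "'a::field^'n::finite^'n"
  assumes "N ** A = mat 1"
  shows "((*v) N ^^ Suc n) (A *v v) = ((*v) N ^^ n) v"
  using assms by (simp add: funpow_Suc_right matrix_vector_mul_assoc del: funpow.simps)

text \<open>This is \<open>p(A) v\<close>. Annihilating one vector at a time suffices for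
  convergence and avoids any normal form of \<open>A\<close>.\<close>

definition krylov :: "complex^'n^'n \<Rightarrow> complex poly \<Rightarrow> complex^'n::finite \<Rightarrow> complex^'n" where
  "krylov A p v = (\<Sum>k\<le>degree p. coeff p k *s ((*v) A ^^ k) v)"

lemma krylov_eq:
  assumes "degree p \<le> n"
  shows "krylov A p v = (\<Sum>k\<le>n. coeff p k *s ((*v) A ^^ k) v)"
  unfolding krylov_def
  by (rule sum.mono_neutral_left) (use assms in \<open>auto simp: coeff_eq_0\<close>)

text \<open>\<open>p(A) v = q(A) (A - b) v\<close> if \<open>p = (X - b) q\<close>. Splitting off a
  root thus trades \<open>v\<close> for another vector with an annihilator of smaller degree, which
  drives the induction below.\<close>

lemma krylov_linear_factor: "krylov A ([:-b, 1:] * q) v = krylov A q (A *v v - b *s v)"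
proof -
  define n where "n = Suc (degree q)"
  have deg: "degree ([:-b, 1:] * q) \<le> n"
    unfolding n_def using degree_mult_le[of "[:-b, 1:]" q] by (simp del: mult_pCons_left)
  have "krylov A ([:-b, 1:] * q) v =
      (\<Sum>k\<le>n. (coeff (pCons 0 q) k - b * coeff q k) *s ((*v) A ^^ k) v)"
    unfolding krylov_eq[OF deg] by (simp add: mult_pCons_left)
  also have "\<dots> = (\<Sum>k\<le>n. coeff (pCons 0 q) k *s ((*v) A ^^ k) v)
      - (\<Sum>k\<le>n. coeff q k *s (b *s ((*v) A ^^ k) v))"
    by (simp add: vector_sub_rdistrib sum_subtractf vector_smult_assoc mult.commute)
  also have "(\<Sum>k\<le>n. coeff (pCons 0 q) k *s ((*v) A ^^ k) v) =
      (\<Sum>k\<le>degree q. coeff q k *s ((*v) A ^^ k) (A *v v))"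
    unfolding n_def by (subst sum.atMost_Suc_shift) (simp add: funpow_swap1)
  also have "\<dots> = (\<Sum>k\<le>n. coeff q k *s ((*v) A ^^ k) (A *v v))"
    unfolding n_def by (simp add: coeff_eq_0)
  also have "\<dots> - (\<Sum>k\<le>n. coeff q k *s (b *s ((*v) A ^^ k) v)) = krylov A q (A *v v - b *s v)"
    by (subst krylov_eq[of q n])
      (simp_all add: n_def funpow_mult_vec_diff_scale vector_ssub_ldistrib sum_subtractf)
  finally show ?thesis .
qed

text \<open>The iterates \<open>v, A v, ..., A^n v\<close> outnumber the real dimension of the
  space, so they satisfy a nontrivial relation, even with real coefficients.\<close>

lemma krylov_annihilator:
  fixes A :: "complex^'n::finite^'n"
  obtains p where "p \<noteq> 0" "krylov A p v = 0"
proof -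
  define h where "h k = ((*v) A ^^ k) v" for k
  define n where "n = DIM(complex^'n)"
  have "\<exists>c :: nat \<Rightarrow> real. (\<exists>k\<le>n. c k \<noteq> 0) \<and> (\<Sum>k\<le>n. c k *\<^sub>R h k) = 0"
  \<comment> \<open>Linear dependence is a property of sets and does not see repetitions. Two equal
    iterates give the relation directly, as their difference.\<close>
  proof (cases "inj_on h {..n}")
    case False
    then obtain i j where ij: "i \<le> n" "j \<le> n" "i \<noteq> j" "h i = h j" by (auto simp: inj_on_def)
    define c :: "nat \<Rightarrow> real" where "c k = (if k = i then 1 else 0) - (if k = j then 1 else 0)" for k
    have "(\<Sum>k\<le>n. c k *\<^sub>R h k) = (\<Sum>k\<le>n. if k = i then h k else 0) - (\<Sum>k\<le>n. if k = j then h k else 0)"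
      unfolding c_def sum_subtractf[symmetric] by (intro sum.cong) (auto simp: scaleR_diff_left)
    also have "\<dots> = 0" using ij by simp
    finally show ?thesis using ij by (intro exI[of _ c]) (auto simp: c_def)
  next
    case True
    have "card (h ` {..n}) > n" using True by (simp add: card_image)
    then have "dependent (h ` {..n})"
      using independent_bound[of "h ` {..n}"] unfolding n_def by linarith
    then obtain t u x where t: "finite t" "t \<subseteq> h ` {..n}" "(\<Sum>y\<in>t. u y *\<^sub>R y) = 0" "x \<in> t" "u x \<noteq> 0"
      unfolding dependent_explicit by blast
    define c where "c k = (if h k \<in> t then u (h k) else 0)" for k
    have "(\<Sum>k\<le>n. c k *\<^sub>R h k) = (\<Sum>y\<in>h ` {..n}. (if y \<in> t then u y else 0) *\<^sub>R y)"
      unfolding c_def by (subst sum.reindex[OF True]) simp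
    also have "\<dots> = (\<Sum>y\<in>t. u y *\<^sub>R y)"
      by (rule sum.mono_neutral_cong_right) (use t in auto)
    finally have "(\<Sum>k\<le>n. c k *\<^sub>R h k) = 0" using t by simp
    moreover from t obtain k where "k \<le> n" "x = h k" by auto
    ultimately show ?thesis using t by (intro exI[of _ c]) (auto simp: c_def)
  qed
  then obtain c k0 where c: "k0 \<le> n" "c k0 \<noteq> 0" "(\<Sum>k\<le>n. c k *\<^sub>R h k) = 0" by blast
  define p where "p = (\<Sum>k\<le>n. monom (complex_of_real (c k)) k)"
  have coeff: "coeff p k = (if k \<le> n then complex_of_real (c k) else 0)" for k
    by (simp add: p_def coeff_sum)
  have "degree p \<le> n" by (rule degree_le) (simp add: coeff)
  then have "krylov A p v = (\<Sum>k\<le>n. complex_of_real (c k) *s h k)"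
    by (simp add: krylov_eq coeff h_def)
  also have "\<dots> = (\<Sum>k\<le>n. c k *\<^sub>R h k)"
    by (intro sum.cong) (simp_all add: vec_eq_iff scaleR_conv_of_real[where 'a=complex])
  finally have "krylov A p v = 0" using c by simp
  moreover have "p \<noteq> 0" using c coeff[of k0] by auto
  ultimately show thesis using that by blast
qed

lemma norm_vector_scalar_mult: "norm (c *s v) = cmod c * norm v" for v :: "complex^'n::finite"
  by (simp add: norm_vec_def norm_mult L2_set_right_distrib)

text \<open>Induction on the degree of an annihilator of \<open>v\<close>. For a root
  \<open>b\<close> put \<open>w = (A - b) v\<close>, so that \<open>N^n w\<close> tends to zero by
  induction. If \<open>b\<close> is an eigenvalue, \<open>b N^(n+1) v = N^n v - N^(n+1) w\<close> is
  a contraction of rate \<open>1 / |b|\<close> with vanishing error. Otherwise \<open>A - b\<close>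
  is invertible and \<open>v\<close> is recovered from \<open>w\<close>.\<close>

lemma inverse_powers_tendsto_zero:
  fixes A N :: "complex^'n::finite^'n"
  assumes inv: "N ** A = mat 1" "A ** N = mat 1"
    and exp: "\<And>z. det (mat z - A) = 0 \<Longrightarrow> cmod z > 1"
  shows "(\<lambda>n. ((*v) N ^^ n) v) \<longlonglongrightarrow> 0"
proof -
  have "(\<lambda>n. ((*v) N ^^ n) v) \<longlonglongrightarrow> 0" if "krylov A p v = 0" "p \<noteq> 0" for p v
    using that
  proof (induction "degree p" arbitrary: p v)
    case 0
    then obtain a where p: "p = [:a:]" by (metis degree_eq_zeroE)
    with 0 have "v = 0" by (simp add: krylov_def)
    moreover have "((*v) N ^^ n) 0 = 0" for n by (induction n) simp_all
    ultimately show ?case by simp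
  next
    case (Suc d)
    have "\<not> constant (poly p)" using Suc(2) by (metis constant_degree nat.distinct(1))
    then obtain b where "poly p b = 0" using fundamental_theorem_of_algebra by blast
    then obtain q where p: "p = [:-b, 1:] * q" by (metis dvdE poly_eq_0_iff_dvd)
    with Suc.prems have "q \<noteq> 0" by auto
    then have "degree q = d"
      using Suc(2) p by (subst (asm) p, subst (asm) degree_mult_eq) auto
    define w where "w = A *v v - b *s v"
    have "krylov A q w = 0" using Suc.prems krylov_linear_factor[of A b q v] p w_def by simp
    then have w: "(\<lambda>n. ((*v) N ^^ n) w) \<longlonglongrightarrow> 0"
      using Suc(1)[of q w] \<open>q \<noteq> 0\<close> \<open>degree q = d\<close> by simp
    show ?case
    proof (cases "det (mat b - A) = 0")
      case True
      then have b: "cmod b > 1" by (rule exp)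
      have step: "((*v) N ^^ Suc n) w = ((*v) N ^^ n) v - b *s ((*v) N ^^ Suc n) v" for n
        unfolding w_def funpow_mult_vec_diff_scale funpow_mult_vec_inverse[OF inv(1)] ..
      have "(\<lambda>n. norm (((*v) N ^^ n) v)) \<longlonglongrightarrow> 0"
      proof (rule contraction_with_error_tendsto_zero[of _ "1 / cmod b" "\<lambda>n. norm (((*v) N ^^ Suc n) w)"])
        fix n
        have "cmod b * norm (((*v) N ^^ Suc n) v) = norm (((*v) N ^^ n) v - ((*v) N ^^ Suc n) w)"
          unfolding step norm_vector_scalar_mult[symmetric] by simp
        also have "\<dots> \<le> norm (((*v) N ^^ n) v) + norm (((*v) N ^^ Suc n) w)"
          by (rule norm_triangle_ineq4)
        finally show "norm (((*v) N ^^ Suc n) v) \<le>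
            1 / cmod b * (norm (((*v) N ^^ n) v) + norm (((*v) N ^^ Suc n) w))"
          using b by (simp add: pos_le_divide_eq[OF less_trans[OF zero_less_one b]] mult.commute)
        show "(\<lambda>n. norm (((*v) N ^^ Suc n) w)) \<longlonglongrightarrow> 0"
          using LIMSEQ_Suc[OF w] by (rule tendsto_norm_zero)
        show "1 / cmod b < 1" using b by (subst divide_less_eq_1_pos) linarith+
      qed simp_all
      then show ?thesis by (rule tendsto_norm_zero_cancel)
    next
      case False
      then obtain B where B: "B ** (mat b - A) = mat 1"
        unfolding invertible_det_nz[symmetric] invertible_def by blast
      have NA: "A *v ((*v) N ^^ n) v = ((*v) N ^^ n) (A *v v)" for n
      proof (induction n)
        case (Suc n)
        have "A *v ((*v) N ^^ Suc n) v = ((*v) N ^^ n) v"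
          using inv(2) by (simp add: matrix_vector_mul_assoc)
        then show ?case using funpow_mult_vec_inverse[OF inv(1), of n v] by simp
      qed simp
      have "((*v) N ^^ n) v = - (B *v ((*v) N ^^ n) w)" for n
      proof -
        have "(mat b - A) *v ((*v) N ^^ n) v = b *s ((*v) N ^^ n) v - A *v ((*v) N ^^ n) v"
          by (simp add: matrix_vector_mult_diff_rdistrib)
            (simp add: vec_eq_iff matrix_vector_mult_def mat_def if_distrib if_distribR sum.delta cong: if_cong)
        also have "\<dots> = - ((*v) N ^^ n) w"
          unfolding w_def funpow_mult_vec_diff_scale NA by simp
        finally have "B *v ((mat b - A) *v ((*v) N ^^ n) v) = B *v (- ((*v) N ^^ n) w)" by simp
        then show ?thesis using B by (simp add: matrix_vector_mul_assoc vec.neg)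
      qed
      moreover have "(\<lambda>n. - (B *v ((*v) N ^^ n) w)) \<longlonglongrightarrow> - (B *v 0)"
        by (intro tendsto_minus isCont_tendsto_compose[OF _ w] linear_continuous_at)
          (simp add: matrix_vector_mul_bounded_linear)
      ultimately show ?thesis by simp
    qed
  qed
  moreover obtain p where "p \<noteq> 0" "krylov A p v = 0" by (rule krylov_annihilator)
  ultimately show ?thesis by simp
qed

lemma expansive_invertible:
  fixes M :: "real^'d::finite^'d"
  assumes "\<forall>z. is_eigenvalue M z \<longrightarrow> cmod z > 1"
  shows "invertible M"
proof (rule ccontr)
  assume "\<not> invertible M"
  then obtain x where x: "x \<noteq> 0" "M *v x = 0"
    by (metis invertible_left_inverse matrix_left_invertible_ker)
  define y where "y = (\<chi> i. complex_of_real (x $ i))"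
  have "(mat 0 - cmat M) *v y = 0"
    using x(2) by (simp add: vec_eq_iff matrix_vector_mult_def cmat_def y_def mat_def sum_negf
        flip: of_real_mult of_real_sum)
  moreover have "y \<noteq> 0" using x(1) by (auto simp: y_def vec_eq_iff)
  ultimately have "\<not> invertible (mat 0 - cmat M)"
    by (metis invertible_left_inverse matrix_left_invertible_ker)
  then have "is_eigenvalue M 0" by (simp add: is_eigenvalue_def invertible_det_nz)
  then show False using assms by fastforce
qed

lemma cmat_mult: "cmat (A ** B) = cmat A ** cmat B"
  by (simp add: cmat_def matrix_matrix_mult_def vec_eq_iff)

lemma cmat_mat_1: "cmat (mat 1) = mat 1"
  by (simp add: cmat_def mat_def vec_eq_iff)

text \<open>The inverse powers tend to zero on each basis vector, hence uniformly on the unit ball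
  because the dimension is finite. Applying the bound for \<open>N^l\<close> to \<open>M^l x\<close>
  turns decay of the inverse into growth that is uniform in \<open>x\<close>.\<close>

lemma expansive_norm_ge:
  fixes M :: "real^'d::finite^'d"
  assumes exp: "\<forall>z. is_eigenvalue M z \<longrightarrow> cmod z > 1" and c: "c > 0"
  obtains L where "\<And>l x. l \<ge> L \<Longrightarrow> c * norm x \<le> norm (((*v) M ^^ l) x)"
proof -
  define N where "N = matrix_inv M"
  have M: "invertible M" using exp by (rule expansive_invertible)
  have inv: "N ** M = mat 1" "M ** N = mat 1"
    unfolding N_def using M by (simp_all add: matrix_inv_left matrix_inv_right)
  define cv where "cv x = (\<chi> i. complex_of_real (x $ i))" for x :: "real^'d"
  have cv: "cmat N *v cv x = cv (N *v x)" for x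
    by (simp add: cv_def cmat_def matrix_vector_mult_def vec_eq_iff)
  have cvn: "((*v) (cmat N) ^^ n) (cv x) = cv (((*v) N ^^ n) x)" for n x
    by (induction n) (simp_all add: cv)
  have norm_cv: "norm (cv x) = norm x" for x
    by (simp add: cv_def norm_vec_def)
  have "(\<lambda>n. norm (((*v) N ^^ n) x)) \<longlonglongrightarrow> 0" for x
  proof -
    have "(\<lambda>n. ((*v) (cmat N) ^^ n) (cv x)) \<longlonglongrightarrow> 0"
      by (rule inverse_powers_tendsto_zero[where A = "cmat M"])
        (use inv exp in \<open>auto simp: cmat_mat_1 is_eigenvalue_def simp flip: cmat_mult\<close>)
    then show ?thesis unfolding cvn by (drule_tac tendsto_norm) (simp add: norm_cv)
  qed
  then have "(\<lambda>n. \<Sum>b\<in>Basis. norm (((*v) N ^^ n) b)) \<longlonglongrightarrow> (\<Sum>b\<in>(Basis :: (real^'d) set). 0)"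
    by (intro tendsto_sum)
  then have "(\<lambda>n. \<Sum>b\<in>Basis. norm (((*v) N ^^ n) b)) \<longlonglongrightarrow> 0" by simp
  then obtain L where L: "\<And>n. n \<ge> L \<Longrightarrow> \<bar>\<Sum>b\<in>Basis. norm (((*v) N ^^ n) b)\<bar> < 1 / c"
    using LIMSEQ_D[of _ 0 "1 / c"] c by fastforce
  have lin: "linear ((*v) N ^^ n)" for n
  proof (induction n)
    case (Suc n)
    then show ?case using linear_compose[OF _ matrix_vector_mul_linear[of N], of "(*v) N ^^ n"] by (simp add: comp_def)
  qed (auto intro!: linearI)
  have NM: "((*v) N ^^ n) (((*v) M ^^ n) x) = x" for n x
  proof (induction n)
    case (Suc n)
    then show ?case using funpow_mult_vec_inverse[OF inv(1), of n "((*v) M ^^ n) x"] by simp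
  qed simp
  have bound: "norm (((*v) N ^^ n) x) \<le> norm x / c" if n: "n \<ge> L" for n x
  proof -
    have "((*v) N ^^ n) x = ((*v) N ^^ n) (\<Sum>b\<in>Basis. (x \<bullet> b) *\<^sub>R b)"
      by (simp add: euclidean_representation)
    also have "\<dots> = (\<Sum>b\<in>Basis. (x \<bullet> b) *\<^sub>R ((*v) N ^^ n) b)"
      using lin[of n] by (simp add: linear_sum linear_scale)
    also have "norm \<dots> \<le> (\<Sum>b\<in>Basis. norm x * norm (((*v) N ^^ n) b))"
      by (intro sum_norm_le) (simp add: Basis_le_norm mult_right_mono)
    also have "\<dots> = norm x * (\<Sum>b\<in>Basis. norm (((*v) N ^^ n) b))" by (simp add: sum_distrib_left)
    also have "\<dots> \<le> norm x * (1 / c)" using L[OF n] by (intro mult_left_mono) auto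
    finally show ?thesis by simp
  qed
  show thesis
  proof (rule that)
    fix l x assume "l \<ge> L"
    from bound[OF this, of "((*v) M ^^ l) x"] show "c * norm x \<le> norm (((*v) M ^^ l) x)"
      unfolding NM using c by (simp add: field_simps)
  qed
qed

section \<open>Completeness of the space and Parseval's identity\<close>

text \<open>The Riesz-Fischer argument for a fast series. With the weights \<open>4^n\<close> the
  sum \<open>H\<close> of \<open>4^n |s n|^2\<close> is still integrable, as the terms have integral
  at most \<open>2^(-n)\<close>. Pointwise \<open>|s n| \<le> 2^(-n) sqrt H\<close>, so the series
  converges almost everywhere and its squared tails are at most
  \<open>4 * 4^(-N) * H\<close>.\<close>

lemma L2_series_converges:
  fixes s :: "nat \<Rightarrow> ('d::finite) fn"
  assumes s: "\<And>n. s n \<in> L2" and small: "\<And>n. l2_sq (s n) \<le> (1/8) ^ n"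
  obtains g where "g \<in> L2" "(\<lambda>N. l2_sq (\<lambda>x. g x - (\<Sum>n<N. s n x))) \<longlonglongrightarrow> 0"
proof -
  note [measurable] = L2_measurable[OF s]
  define h where "h n x = 4 ^ n * (cmod (s n x))\<^sup>2" for n x
  define H where "H x = (\<Sum>n. h n x)" for x
  define g where "g x = (\<Sum>n. s n x)" for x
  have h0: "h n x \<ge> 0" for n x by (simp add: h_def)
  have h_int: "integrable lebesgue (h n)" for n
    unfolding h_def by (intro integrable_mult_right L2_integrable s)
  have int_h: "(LINT x|lebesgue. h n x) \<le> (1/2) ^ n" for n
  proof -
    have "(LINT x|lebesgue. h n x) = 4 ^ n * l2_sq (s n)" by (simp add: h_def l2_sq_def)
    also have "\<dots> \<le> 4 ^ n * (1/8) ^ n" using small by (intro mult_left_mono) auto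
    also have "\<dots> = (1/2) ^ n" by (simp flip: power_mult_distrib)
    finally show ?thesis .
  qed
  have sum_int: "summable (\<lambda>n. LINT x|lebesgue. h n x)"
    by (rule summable_comparison_test_ev[OF _ summable_geometric[of "1/2::real"]])
       (use int_h h0 in \<open>auto simp: abs_of_nonneg\<close>)
  have meas_h [measurable]: "h n \<in> borel_measurable lebesgue" for n
    using h_int by (rule borel_measurable_integrable)
  have "(\<integral>\<^sup>+x. (\<Sum>n. ennreal (h n x)) \<partial>lebesgue) = (\<Sum>n. \<integral>\<^sup>+x. ennreal (h n x) \<partial>lebesgue)"
    by (rule nn_integral_suminf) measurable
  also have "\<dots> = (\<Sum>n. ennreal (LINT x|lebesgue. h n x))"
    by (intro suminf_cong nn_integral_eq_integral h_int) (simp add: h0)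
  also have "\<dots> < \<infinity>"
    using sum_int by (simp add: suminf_ennreal2 h0 integral_nonneg)
  finally have "AE x in lebesgue. (\<Sum>n. ennreal (h n x)) \<noteq> \<infinity>"
    by (intro nn_integral_PInf_AE) auto
  then have AE_sum: "AE x in lebesgue. summable (\<lambda>n. h n x)"
    by eventually_elim (use h0 in \<open>auto intro: summable_suminf_not_top\<close>)
  have H_int: "integrable lebesgue H"
    unfolding H_def using AE_sum sum_int h0
    by (intro integrable_suminf h_int) (auto simp: abs_of_nonneg)
  have tail: "(cmod (g x - (\<Sum>n<N. s n x)))\<^sup>2 \<le> 4 * (1/4) ^ N * H x" if sm: "summable (\<lambda>n. h n x)" for x N
  proof -
    have half: "((1/2) ^ n)\<^sup>2 = (1/4::real) ^ n" for n
      by (simp add: power2_eq_square flip: power_mult_distrib)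
    have H0: "H x \<ge> 0" unfolding H_def using sm h0 by (intro suminf_nonneg) auto
    have le: "cmod (s n x) \<le> (1/2) ^ n * sqrt (H x)" for n
    proof (rule power2_le_imp_le)
      have "h n x \<le> H x" unfolding H_def using sum_le_suminf[OF sm, of "{n}"] h0 by auto
      then have "(cmod (s n x))\<^sup>2 \<le> H x / 4 ^ n" by (simp add: h_def field_simps)
      also have "\<dots> = ((1/2) ^ n * sqrt (H x))\<^sup>2"
        unfolding power_mult_distrib half using H0 by (simp add: power_one_over)
      finally show "(cmod (s n x))\<^sup>2 \<le> ((1/2) ^ n * sqrt (H x))\<^sup>2" .
    qed (use H0 in auto)
    have smG: "summable (\<lambda>n. (1/2) ^ n * sqrt (H x))"
      by (intro summable_mult2 summable_geometric) auto
    have smn: "summable (\<lambda>n. cmod (s n x))"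
      by (rule summable_comparison_test[OF _ smG]) (use le in auto)
    then have sms: "summable (\<lambda>n. s n x)" by (rule summable_norm_cancel)
    have "g x - (\<Sum>n<N. s n x) = (\<Sum>n. s (n + N) x)"
      unfolding g_def using suminf_minus_initial_segment[OF sms, of N] by simp
    also have "cmod \<dots> \<le> (\<Sum>n. cmod (s (n + N) x))"
      using smn by (intro summable_norm) (subst summable_iff_shift)
    also have "\<dots> \<le> (\<Sum>n. (1/2) ^ n * ((1/2) ^ N * sqrt (H x)))"
    proof (rule suminf_le)
      show "summable (\<lambda>n. cmod (s (n + N) x))" using smn by (subst summable_iff_shift)
      show "summable (\<lambda>n. (1/2) ^ n * ((1/2) ^ N * sqrt (H x)))"
        by (intro summable_mult2 summable_geometric) auto
      show "cmod (s (n + N) x) \<le> (1/2) ^ n * ((1/2) ^ N * sqrt (H x))" for n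
        using le[of "n + N"] by (simp add: power_add mult.assoc)
    qed
    also have "\<dots> = 2 * ((1/2) ^ N * sqrt (H x))"
      by (subst suminf_mult2[symmetric]) (auto simp: suminf_geometric summable_geometric)
    finally have "(cmod (g x - (\<Sum>n<N. s n x)))\<^sup>2 \<le> (2 * ((1/2) ^ N * sqrt (H x)))\<^sup>2"
      by (intro power_mono) auto
    also have "\<dots> = 4 * (1/4) ^ N * H x"
      unfolding power_mult_distrib half using H0 by simp
    finally show ?thesis .
  qed
  have g_meas [measurable]: "g \<in> borel_measurable lebesgue" unfolding g_def by measurable
  have gL2: "g \<in> L2"
  proof (rule L2I)
    show "integrable lebesgue (\<lambda>x. (cmod (g x))\<^sup>2)"
    proof (rule Bochner_Integration.integrable_bound)
      show "integrable lebesgue (\<lambda>x. 4 * H x)" using H_int by simp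
      show "AE x in lebesgue. norm ((cmod (g x))\<^sup>2) \<le> norm (4 * H x)"
        using AE_sum by eventually_elim (use tail[of _ 0] in force)
    qed measurable
  qed fact
  moreover have "(\<lambda>N. l2_sq (\<lambda>x. g x - (\<Sum>n<N. s n x))) \<longlonglongrightarrow> 0"
  proof (rule tendsto_sandwich[OF always_eventually always_eventually tendsto_const])
    show "\<forall>N. l2_sq (\<lambda>x. g x - (\<Sum>n<N. s n x)) \<le> (4 * integral\<^sup>L lebesgue H) * (1/4) ^ N"
    proof
      fix N
      have "l2_sq (\<lambda>x. g x - (\<Sum>n<N. s n x)) \<le> (LINT x|lebesgue. 4 * (1/4) ^ N * H x)"
        unfolding l2_sq_def
      proof (rule integral_mono_AE)
        show "integrable lebesgue (\<lambda>x. (cmod (g x - (\<Sum>n<N. s n x)))\<^sup>2)"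
          by (intro L2_integrable L2_diff gL2 L2_sum s)
        show "AE x in lebesgue. (cmod (g x - (\<Sum>n<N. s n x)))\<^sup>2 \<le> 4 * (1/4) ^ N * H x"
          using AE_sum by eventually_elim (rule tail)
      qed (use H_int in simp)
      then show "l2_sq (\<lambda>x. g x - (\<Sum>n<N. s n x)) \<le> (4 * integral\<^sup>L lebesgue H) * (1/4) ^ N"
        by (simp add: mult_ac)
    qed
    show "(\<lambda>N. (4 * integral\<^sup>L lebesgue H) * (1/4) ^ N) \<longlonglongrightarrow> 0"
      by (intro tendsto_mult_right_zero LIMSEQ_realpow_zero) auto
  qed simp
  ultimately show thesis using that by blast
qed

lemma
  fixes e :: "'i \<Rightarrow> ('d::finite) fn"
  assumes e: "\<And>i. i \<in> F \<Longrightarrow> e i \<in> L2"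
    and ortho: "\<And>i i'. i \<in> F \<Longrightarrow> i' \<in> F \<Longrightarrow> l2_inner (e i) (e i') = (if i = i' then 1 else 0)"
    and F: "finite F"
  shows l2_sq_orthonormal_sum: "l2_sq (\<lambda>x. \<Sum>i\<in>F. c i * e i x) = (\<Sum>i\<in>F. (cmod (c i))\<^sup>2)"
    and l2_sq_minus_projection: "f \<in> L2 \<Longrightarrow>
      l2_sq (\<lambda>x. f x - (\<Sum>i\<in>F. l2_inner f (e i) * e i x)) = l2_sq f - (\<Sum>i\<in>F. (cmod (l2_inner f (e i)))\<^sup>2)"
proof -
  have inner_e: "l2_inner h (\<lambda>x. \<Sum>i\<in>F. c i * e i x) = (\<Sum>i\<in>F. cnj (c i) * l2_inner h (e i))"
    if "h \<in> L2" for h c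
    using that e by (simp add: l2_inner_sum_right L2_scale l2_inner_scale_right)
  show sum_eq: "l2_sq (\<lambda>x. \<Sum>i\<in>F. c i * e i x) = (\<Sum>i\<in>F. (cmod (c i))\<^sup>2)" for c
  proof -
    have inn: "l2_inner (\<lambda>x. \<Sum>i\<in>F. c i * e i x) (e j) = c j" if "j \<in> F" for j
    proof -
      have "l2_inner (\<lambda>x. \<Sum>i\<in>F. c i * e i x) (e j) = (\<Sum>i\<in>F. c i * l2_inner (e i) (e j))"
        using that e by (simp add: l2_inner_sum_left L2_scale l2_inner_scale_left)
      also have "\<dots> = (\<Sum>i\<in>F. if i = j then c i else 0)"
        using ortho that by (intro sum.cong) auto
      finally show ?thesis using that F by simp
    qed
    have "l2_inner (\<lambda>x. \<Sum>i\<in>F. c i * e i x) (\<lambda>x. \<Sum>i\<in>F. c i * e i x) = (\<Sum>i\<in>F. cnj (c i) * c i)"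
      using inn by (subst inner_e) (auto intro!: L2_sum L2_scale e)
    also have "\<dots> = complex_of_real (\<Sum>i\<in>F. (cmod (c i))\<^sup>2)"
      by (simp add: complex_norm_square mult.commute del: of_real_power)
    finally show ?thesis unfolding l2_inner_self by (rule of_real_eq_iff[THEN iffD1])
  qed
  show "l2_sq (\<lambda>x. f x - (\<Sum>i\<in>F. l2_inner f (e i) * e i x)) = l2_sq f - (\<Sum>i\<in>F. (cmod (l2_inner f (e i)))\<^sup>2)"
    if f: "f \<in> L2"
  proof -
    have "l2_inner f (\<lambda>x. \<Sum>i\<in>F. l2_inner f (e i) * e i x) = complex_of_real (\<Sum>i\<in>F. (cmod (l2_inner f (e i)))\<^sup>2)"
      unfolding inner_e[OF f] by (simp add: complex_norm_square mult.commute del: of_real_power)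
    then show ?thesis
      by (subst l2_sq_diff) (auto simp: f sum_eq intro!: L2_sum L2_scale e)
  qed
qed

text \<open>The remainders of partial expansions converge in norm to some \<open>r\<close>. Every
  coefficient of \<open>r\<close> vanishes, so completeness of the system makes \<open>r\<close>
  null, and the squared norms of the remainders, \<open>l2_sq f\<close> minus partial sums, tend to
  zero.\<close>

lemma parseval:
  fixes e :: "'i \<Rightarrow> ('d::finite) fn"
  assumes onb: "is_onb L2 l2_inner I e" and f: "f \<in> L2"
  shows "((\<lambda>i. (cmod (l2_inner f (e i)))\<^sup>2) has_sum l2_sq f) I"
proof -
  have e: "\<And>i. i \<in> I \<Longrightarrow> e i \<in> L2"
    and ortho: "\<And>i i'. i \<in> I \<Longrightarrow> i' \<in> I \<Longrightarrow> l2_inner (e i) (e i') = (if i = i' then 1 else 0)"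
    and compl: "\<And>g. g \<in> L2 \<Longrightarrow> (\<And>i. i \<in> I \<Longrightarrow> l2_inner g (e i) = 0) \<Longrightarrow> l2_inner g g = 0"
    using onb unfolding is_onb_def by blast+
  define c where "c i = l2_inner f (e i)" for i
  define h where "h F x = f x - (\<Sum>i\<in>F. c i * e i x)" for F x
  have hL2: "h F \<in> L2" if "F \<subseteq> I" for F
    unfolding h_def using that e f by (intro L2_diff L2_sum L2_scale) auto
  have h_sq: "l2_sq (h F) = l2_sq f - (\<Sum>i\<in>F. (cmod (c i))\<^sup>2)" if "finite F" "F \<subseteq> I" for F
    unfolding h_def c_def by (rule l2_sq_minus_projection) (use that e ortho f in \<open>blast+\<close>)
  have bessel: "(\<Sum>i\<in>F. (cmod (c i))\<^sup>2) \<le> l2_sq f" if "finite F" "F \<subseteq> I" for F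
    using h_sq[OF that] l2_sq_nonneg[of "h F"] by linarith
  have summ: "(\<lambda>i. (cmod (c i))\<^sup>2) summable_on I"
    by (rule nonneg_bdd_above_summable_on) (use bessel in \<open>auto intro!: bdd_aboveI[of _ "l2_sq f"]\<close>)
  define T where "T = (\<Sum>\<^sub>\<infinity>i\<in>I. (cmod (c i))\<^sup>2)"
  have has: "((\<lambda>i. (cmod (c i))\<^sup>2) has_sum T) I" unfolding T_def by (rule has_sum_infsum[OF summ])
  have leT: "(\<Sum>i\<in>F. (cmod (c i))\<^sup>2) \<le> T" if "finite F" "F \<subseteq> I" for F
    unfolding T_def using that by (intro finite_sum_le_infsum summ) auto
  have "\<exists>F. finite F \<and> F \<subseteq> I \<and> T - (\<Sum>i\<in>F. (cmod (c i))\<^sup>2) < (1/8) ^ n" for n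
  proof -
    have "eventually (\<lambda>F. dist (\<Sum>i\<in>F. (cmod (c i))\<^sup>2) T < (1/8) ^ n) (finite_subsets_at_top I)"
      using has unfolding has_sum_def by (intro tendstoD) auto
    then obtain F where "finite F" "F \<subseteq> I" "dist (\<Sum>i\<in>F. (cmod (c i))\<^sup>2) T < (1/8) ^ n"
      unfolding eventually_finite_subsets_at_top by blast
    then show ?thesis unfolding dist_real_def by (intro exI[of _ F]) auto
  qed
  then obtain F where F: "\<And>n. finite (F n)" "\<And>n. F n \<subseteq> I" "\<And>n. T - (\<Sum>i\<in>F n. (cmod (c i))\<^sup>2) < (1/8) ^ n"
    by metis
  \<comment> \<open>The sets \<open>F n\<close> need not be nested. Their unions are, and the
    differences of successive unions give orthogonal blocks whose squared norms are below
    \<open>(1/8)^n\<close>, the rate that the series lemma asks for.\<close>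
  define G where "G n = (\<Union>k\<le>n. F k)" for n
  have G: "finite (G n)" "G n \<subseteq> I" "G n \<subseteq> G (Suc n)" for n
  proof -
    show "finite (G n)" "G n \<subseteq> I" using F by (auto simp: G_def)
    show "G n \<subseteq> G (Suc n)" unfolding G_def by (intro UN_mono) auto
  qed
  have GT: "T - (\<Sum>i\<in>G n. (cmod (c i))\<^sup>2) < (1/8) ^ n" for n
  proof -
    have "(\<Sum>i\<in>F n. (cmod (c i))\<^sup>2) \<le> (\<Sum>i\<in>G n. (cmod (c i))\<^sup>2)"
      using G by (intro sum_mono2) (auto simp: G_def)
    then show ?thesis using F(3)[of n] by linarith
  qed
  define s where "s n x = (\<Sum>i\<in>G (Suc n) - G n. c i * e i x)" for n x
  have h_step: "h (G (Suc n)) x = h (G n) x - s n x" for n x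
    unfolding h_def s_def using sum.subset_diff[OF G(3)[of n] G(1), of "\<lambda>i. c i * e i x"] by simp
  have h_G: "h (G N) x = h (G 0) x - (\<Sum>n<N. s n x)" for N x
    by (induction N) (simp_all add: h_step)
  have sL2: "s n \<in> L2" for n unfolding s_def using G(2) e by (intro L2_sum L2_scale) auto
  have "l2_sq (s n) \<le> (1/8) ^ n" for n
  proof -
    have "l2_sq (s n) = (\<Sum>i\<in>G (Suc n) - G n. (cmod (c i))\<^sup>2)"
      unfolding s_def
      by (rule l2_sq_orthonormal_sum) (use G(1)[of "Suc n"] G(2)[of "Suc n"] e ortho in \<open>blast+\<close>)
    also have "\<dots> = (\<Sum>i\<in>G (Suc n). (cmod (c i))\<^sup>2) - (\<Sum>i\<in>G n. (cmod (c i))\<^sup>2)"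
      using sum.subset_diff[OF G(3)[of n] G(1), of "\<lambda>i. (cmod (c i))\<^sup>2"] by simp
    finally show ?thesis using leT[OF G(1,2), of "Suc n"] GT[of n] by linarith
  qed
  then obtain g where g: "g \<in> L2" "(\<lambda>N. l2_sq (\<lambda>x. g x - (\<Sum>n<N. s n x))) \<longlonglongrightarrow> 0"
    using L2_series_converges[of s] sL2 by blast
  define r where "r x = h (G 0) x - g x" for x
  have r: "r \<in> L2" unfolding r_def by (intro L2_diff hL2 G g)
  have lim: "(\<lambda>N. l2_sq (\<lambda>x. h (G N) x - r x)) \<longlonglongrightarrow> 0"
  proof -
    have "(\<lambda>x. h (G N) x - r x) = (\<lambda>x. g x - (\<Sum>n<N. s n x))" for N
      unfolding r_def h_G[of N] by simp
    then show ?thesis using g(2) by simp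
  qed
  have "l2_inner r (e i) = 0" if i: "i \<in> I" for i
  proof -
    have e1: "l2_sq (e i) = 1" using ortho[OF i i] by (simp add: l2_inner_self)
    \<comment> \<open>If \<open>i\<close> already lies in \<open>G N\<close>, the coefficient has
      been subtracted exactly; if not, its square is part of the tail of the coefficient sum, which
      is below \<open>(1/8)^N\<close>.\<close>
    have c_h: "(cmod (l2_inner (h (G N)) (e i)))\<^sup>2 \<le> (1/8) ^ N" for N
    proof -
      have "l2_inner (h (G N)) (e i) = c i - (\<Sum>k\<in>G N. c k * l2_inner (e k) (e i))"
        unfolding h_def using f e G(2)[of N] i
        by (subst l2_inner_diff_left) (auto intro!: L2_sum L2_scale
            simp: c_def l2_inner_sum_left l2_inner_scale_left L2_scale subset_iff)
      also have "(\<Sum>k\<in>G N. c k * l2_inner (e k) (e i)) = (\<Sum>k\<in>G N. if k = i then c k else 0)"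
        using ortho i G(2)[of N] by (intro sum.cong) auto
      also have "\<dots> = (if i \<in> G N then c i else 0)" using G(1) by simp
      finally have eq: "l2_inner (h (G N)) (e i) = (if i \<in> G N then 0 else c i)" by simp
      show ?thesis
      proof (cases "i \<in> G N")
        case False
        have "(\<Sum>k\<in>insert i (G N). (cmod (c k))\<^sup>2) \<le> T" using G i by (intro leT) auto
        then show ?thesis using False G(1) GT[of N] eq by simp
      qed (simp add: eq)
    qed
    have bound: "(cmod (l2_inner r (e i)))\<^sup>2 \<le> 2 * (1/8) ^ N + 2 * l2_sq (\<lambda>x. h (G N) x - r x)" for N
    proof -
      have "l2_inner r (e i) = l2_inner (h (G N)) (e i) + (- l2_inner (\<lambda>x. h (G N) x - r x) (e i))"
        using e[OF i] hL2[OF G(2)] r by (simp add: l2_inner_diff_left)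
      then have "(cmod (l2_inner r (e i)))\<^sup>2 \<le> 2 * (cmod (l2_inner (h (G N)) (e i)))\<^sup>2
          + 2 * (cmod (l2_inner (\<lambda>x. h (G N) x - r x) (e i)))\<^sup>2"
        using cmod_add_sq_le[of "l2_inner (h (G N)) (e i)" "- l2_inner (\<lambda>x. h (G N) x - r x) (e i)"]
        by (simp only: norm_minus_cancel)
      also have "(cmod (l2_inner (\<lambda>x. h (G N) x - r x) (e i)))\<^sup>2 \<le> l2_sq (\<lambda>x. h (G N) x - r x) * 1"
        using l2_cauchy_schwarz[OF L2_diff[OF hL2[OF G(2)] r] e[OF i], of N] by (simp add: e1)
      finally show ?thesis using c_h[of N] by simp
    qed
    have "(\<lambda>N. 2 * (1/8) ^ N + 2 * l2_sq (\<lambda>x. h (G N) x - r x)) \<longlonglongrightarrow> 2 * 0 + 2 * 0"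
      by (intro tendsto_intros lim LIMSEQ_realpow_zero) auto
    then have "(cmod (l2_inner r (e i)))\<^sup>2 \<le> 2 * 0 + 2 * 0"
      by (rule LIMSEQ_le_const) (use bound in blast)
    then show ?thesis by simp
  qed
  then have r0: "l2_sq r = 0" using compl[OF r] by (simp add: l2_inner_self)
  have le_rest: "l2_sq f - T \<le> 2 * l2_sq (\<lambda>x. h (G N) x - r x)" for N
  proof -
    have "l2_sq (\<lambda>x. (h (G N) x - r x) + r x) \<le> 2 * l2_sq (\<lambda>x. h (G N) x - r x) + 2 * l2_sq r"
      by (intro l2_sq_add_le L2_diff hL2 G r)
    then have "l2_sq (h (G N)) \<le> 2 * l2_sq (\<lambda>x. h (G N) x - r x)" using r0 by simp
    then show ?thesis using h_sq[OF G(1,2), of N] leT[OF G(1,2), of N] by linarith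
  qed
  have "(\<lambda>N. 2 * l2_sq (\<lambda>x. h (G N) x - r x)) \<longlonglongrightarrow> 2 * 0"
    by (intro tendsto_intros lim)
  then have "l2_sq f - T \<le> 2 * 0"
    by (rule LIMSEQ_le_const) (use le_rest in blast)
  then have "l2_sq f - T \<le> 0" by simp
  moreover have "T \<le> l2_sq f"
    unfolding T_def using bessel by (intro infsum_le_finite_sums summ) auto
  ultimately have "T = l2_sq f" by simp
  then show ?thesis using has unfolding c_def by simp
qed

section \<open>Frame sums in the extended non-negative reals\<close>

text \<open>With values in \<open>ennreal\<close> the frame sum always exists, so disjoint unions,
  reindexing and suprema over index sets carry no summability conditions.\<close>

definition energy :: "('a \<Rightarrow> 'a \<Rightarrow> complex) \<Rightarrow> ('i \<Rightarrow> 'a) \<Rightarrow> 'i set \<Rightarrow> 'a \<Rightarrow> ennreal" where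
  "energy ip e I f = (\<integral>\<^sup>+i. ennreal ((cmod (ip f (e i)))\<^sup>2) \<partial>count_space I)"

text \<open>Summability is finiteness of the extended sum, which the upper bound \<open>b\<close>
  forces. A negative \<open>a\<close> is harmless: it is truncated to zero on the right, and the sum
  on the left is non-negative.\<close>

lemma summable_on_bounds_iff_nn_integral:
  fixes f :: "'i \<Rightarrow> real"
  assumes f: "\<And>i. f i \<ge> 0" and b: "b \<ge> 0"
  shows "f summable_on I \<and> a \<le> infsum f I \<and> infsum f I \<le> b \<longleftrightarrow>
    ennreal a \<le> (\<integral>\<^sup>+i. ennreal (f i) \<partial>count_space I) \<and> (\<integral>\<^sup>+i. ennreal (f i) \<partial>count_space I) \<le> ennreal b"
    (is "?L \<longleftrightarrow> ?R")
proof -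
  have summ: "f summable_on I \<longleftrightarrow> integrable (count_space I) f"
    using summable_on_iff_abs_summable_on_real[of f I] abs_summable_equivalent[of f I]
    by (simp add: abs_summable_on_def)
  have eq: "(\<integral>\<^sup>+i. ennreal (f i) \<partial>count_space I) = ennreal (infsum f I) \<and> infsum f I \<ge> 0" if "f summable_on I"
  proof -
    have "Infinite_Set_Sum.abs_summable_on f I" using that summ by (simp add: abs_summable_on_def)
    then show ?thesis
      using f infsetsum_infsum[of f I] nn_integral_conv_infsetsum[of f I] by (simp add: infsum_nonneg)
  qed
  show ?thesis
  proof
    assume ?L then show ?R using eq by (auto intro: ennreal_leI)
  next
    assume R: ?R
    then have "(\<integral>\<^sup>+i. ennreal (f i) \<partial>count_space I) < \<infinity>" by (metis ennreal_less_top infinity_ennreal_def le_less_trans)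
    then have s: "f summable_on I"
      unfolding summ using f by (intro integrableI_nonneg) auto
    show ?L using R eq[OF s] s b by (auto simp: ennreal_le_iff ennreal_le_iff2)
  qed
qed

lemma is_frame_iff_energy:
  assumes "\<And>f. f \<in> K \<Longrightarrow> Re (ip f f) \<ge> 0"
  shows "is_frame K ip I e A B \<longleftrightarrow> A > 0 \<and> B > 0 \<and> (\<forall>i\<in>I. e i \<in> K) \<and>
    (\<forall>f\<in>K. ennreal (A * Re (ip f f)) \<le> energy ip e I f \<and> energy ip e I f \<le> ennreal (B * Re (ip f f)))"
proof (cases "B > 0")
  case True
  have "(\<forall>f\<in>K. (\<lambda>i. (cmod (ip f (e i)))\<^sup>2) summable_on I \<and>
        A * Re (ip f f) \<le> (\<Sum>\<^sub>\<infinity>i\<in>I. (cmod (ip f (e i)))\<^sup>2) \<and>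
        (\<Sum>\<^sub>\<infinity>i\<in>I. (cmod (ip f (e i)))\<^sup>2) \<le> B * Re (ip f f)) \<longleftrightarrow>
    (\<forall>f\<in>K. ennreal (A * Re (ip f f)) \<le> energy ip e I f \<and> energy ip e I f \<le> ennreal (B * Re (ip f f)))"
    unfolding energy_def using True assms
    by (intro ball_cong refl summable_on_bounds_iff_nn_integral) auto
  then show ?thesis unfolding is_frame_def by (simp only:)
qed (simp add: is_frame_def)

lemma energy_mono: "I \<subseteq> J \<Longrightarrow> energy ip e I f \<le> energy ip e J f"
  unfolding energy_def
  by (subst nn_integral_count_space_indicator, simp, subst (2) nn_integral_count_space_indicator)
     (auto intro!: nn_integral_mono split: split_indicator)

lemma energy_Un_disjoint: "I \<inter> J = {} \<Longrightarrow> energy ip e (I \<union> J) f = energy ip e I f + energy ip e J f"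
  unfolding energy_def
  by (subst (1 2 3) nn_integral_count_space_indicator)
     (auto simp flip: nn_integral_add intro!: nn_integral_cong split: split_indicator)

lemma energy_L2_add_le:
  assumes "\<And>i. i \<in> I \<Longrightarrow> e i \<in> L2" "f \<in> L2" "g \<in> L2"
  shows "energy l2_inner e I (\<lambda>x. f x + g x) \<le> 2 * energy l2_inner e I f + 2 * energy l2_inner e I g"
proof -
  have "energy l2_inner e I (\<lambda>x. f x + g x) \<le> (\<integral>\<^sup>+i. 2 * ennreal ((cmod (l2_inner f (e i)))\<^sup>2)
      + 2 * ennreal ((cmod (l2_inner g (e i)))\<^sup>2) \<partial>count_space I)"
    unfolding energy_def
  proof (rule nn_integral_mono)
    fix i assume "i \<in> space (count_space I)"
    then have "l2_inner (\<lambda>x. f x + g x) (e i) = l2_inner f (e i) + l2_inner g (e i)"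
      using assms by (simp add: l2_inner_add_left)
    then have "(cmod (l2_inner (\<lambda>x. f x + g x) (e i)))\<^sup>2 \<le>
        2 * (cmod (l2_inner f (e i)))\<^sup>2 + 2 * (cmod (l2_inner g (e i)))\<^sup>2"
      using cmod_add_sq_le by metis
    then have "ennreal ((cmod (l2_inner (\<lambda>x. f x + g x) (e i)))\<^sup>2) \<le>
        ennreal (2 * (cmod (l2_inner f (e i)))\<^sup>2 + 2 * (cmod (l2_inner g (e i)))\<^sup>2)"
      by (rule ennreal_leI)
    then show "ennreal ((cmod (l2_inner (\<lambda>x. f x + g x) (e i)))\<^sup>2) \<le>
        2 * ennreal ((cmod (l2_inner f (e i)))\<^sup>2) + 2 * ennreal ((cmod (l2_inner g (e i)))\<^sup>2)"
      by (simp add: ennreal_mult')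
  qed
  also have "\<dots> = 2 * energy l2_inner e I f + 2 * energy l2_inner e I g"
    unfolding energy_def by (simp add: nn_integral_add nn_integral_cmult)
  finally show ?thesis .
qed

lemma energy_L2_scale: "energy l2_inner e I (\<lambda>x. c * f x) = ennreal ((cmod c)\<^sup>2) * energy l2_inner e I f"
  unfolding energy_def l2_inner_scale_left norm_mult power_mult_distrib
  by (simp add: ennreal_mult nn_integral_cmult)

text \<open>Iterates \<open>|a + b|^2 \<le> 2 |a|^2 + 2 |b|^2\<close>. The resulting constant is
  crude, but the bound is applied only to sums made arbitrarily small.\<close>

lemma energy_L2_sum_le:
  assumes e: "\<And>i. i \<in> I \<Longrightarrow> e i \<in> L2" and f: "\<And>q. q \<in> Q \<Longrightarrow> f q \<in> L2" and "finite Q"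
  shows "energy l2_inner e I (\<lambda>x. \<Sum>q\<in>Q. f q x) \<le> 2 ^ card Q * (\<Sum>q\<in>Q. energy l2_inner e I (f q))"
  using \<open>finite Q\<close> f
proof (induction Q)
  case empty
  then show ?case by (simp add: energy_def)
next
  case (insert q Q)
  have "energy l2_inner e I (\<lambda>x. \<Sum>q\<in>insert q Q. f q x) = energy l2_inner e I (\<lambda>x. f q x + (\<Sum>q\<in>Q. f q x))"
    using insert by simp
  also have "\<dots> \<le> 2 * energy l2_inner e I (f q) + 2 * energy l2_inner e I (\<lambda>x. \<Sum>q\<in>Q. f q x)"
    using insert e by (intro energy_L2_add_le L2_sum) auto
  also have "\<dots> \<le> 2 * energy l2_inner e I (f q) + 2 * (2 ^ card Q * (\<Sum>q\<in>Q. energy l2_inner e I (f q)))"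
    using insert by (intro add_left_mono mult_left_mono) auto
  also have "\<dots> \<le> 2 * 2 ^ card Q * energy l2_inner e I (f q) + 2 * 2 ^ card Q * (\<Sum>q\<in>Q. energy l2_inner e I (f q))"
  proof (intro add_mono)
    have "(1::ennreal) \<le> 2 ^ card Q" by (rule one_le_power) simp
    then have "2 * (1::ennreal) \<le> 2 * 2 ^ card Q" by (intro mult_left_mono) auto
    then show "2 * energy l2_inner e I (f q) \<le> 2 * 2 ^ card Q * energy l2_inner e I (f q)"
      by (intro mult_right_mono) auto
  qed (simp add: mult.assoc)
  also have "\<dots> = 2 ^ card (insert q Q) * (\<Sum>q\<in>insert q Q. energy l2_inner e I (f q))"
    using insert by (simp add: distrib_left mult.assoc)
  finally show ?case .
qed

lemma borel_measurable_nn_integral_count_space: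
  fixes f :: "'i \<Rightarrow> 'a \<Rightarrow> ennreal"
  assumes I: "countable I" and [measurable]: "\<And>i. i \<in> I \<Longrightarrow> f i \<in> borel_measurable M"
  shows "(\<lambda>x. \<integral>\<^sup>+i. f i x \<partial>count_space I) \<in> borel_measurable M"
proof (cases "finite I")
  case True
  then show ?thesis by (simp add: nn_integral_count_space_finite)
next
  case False
  note bij = bij_betw_from_nat_into[OF I False]
  have "(\<integral>\<^sup>+i. f i x \<partial>count_space I) = (\<Sum>n. f (from_nat_into I n) x)" for x
    by (simp add: nn_integral_bij_count_space[symmetric, OF bij] nn_integral_count_space_nat)
  moreover have "from_nat_into I n \<in> I" for n using False by (metis finite.emptyI from_nat_into)
  ultimately show ?thesis by simp
qed

section \<open>Integer vectors\<close>

lemma vec_of_int_in_Zd [simp]: "vec_of_int k \<in> Zd"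
  by (simp add: vec_of_int_def Zd_def)

lemma ZdE: assumes "x \<in> Zd" obtains k where "x = vec_of_int k"
proof -
  have "x = vec_of_int (\<chi> i. \<lfloor>x $ i\<rfloor>)"
    using assms by (auto simp: Zd_def vec_of_int_def vec_eq_iff elim!: Ints_cases)
  then show thesis using that by blast
qed

lemma vec_of_int_inject [simp]: "vec_of_int k = vec_of_int l \<longleftrightarrow> k = l"
  by (auto simp: vec_of_int_def vec_eq_iff)

lemma vec_of_int_simps [simp]:
  "vec_of_int 0 = 0" "vec_of_int (k + l) = vec_of_int k + vec_of_int l"
  "vec_of_int (k - l) = vec_of_int k - vec_of_int l" "vec_of_int (- k) = - vec_of_int k"
  by (simp_all add: vec_of_int_def vec_eq_iff)

lemma vec_of_int_eq_0 [simp]: "vec_of_int k = 0 \<longleftrightarrow> k = 0"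
  using vec_of_int_inject[of k 0] by (simp del: vec_of_int_inject)

lemma Zd_simps:
  "0 \<in> Zd" "x \<in> Zd \<Longrightarrow> y \<in> Zd \<Longrightarrow> x + y \<in> Zd" "x \<in> Zd \<Longrightarrow> y \<in> Zd \<Longrightarrow> x - y \<in> Zd" "x \<in> Zd \<Longrightarrow> - x \<in> Zd"
  by (simp_all add: Zd_def)

lemma Zd_norm_ge_1:
  assumes "x \<in> Zd" "x \<noteq> 0" shows "norm x \<ge> 1"
proof -
  obtain i where i: "x $ i \<noteq> 0" using assms(2) by (auto simp: vec_eq_iff)
  have "x $ i \<in> \<int>" using assms(1) by (simp add: Zd_def)
  then have "\<bar>x $ i\<bar> \<ge> 1" using i by (rule Ints_nonzero_abs_ge1)
  then show ?thesis using component_le_norm_cart[of x i] by linarith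
qed

lemma int_matrix_Zd: "is_int_matrix A \<Longrightarrow> x \<in> Zd \<Longrightarrow> A *v x \<in> Zd"
  by (auto simp: is_int_matrix_def Zd_def matrix_vector_mult_def intro!: Ints_sum Ints_mult)

lemma int_matrix_funpow_Zd: "is_int_matrix A \<Longrightarrow> x \<in> Zd \<Longrightarrow> ((*v) A ^^ l) x \<in> Zd"
  by (induction l) (simp_all add: int_matrix_Zd)

lemma funpow_mult_vec_diff: "((*v) A ^^ l) (x - y) = ((*v) A ^^ l) x - ((*v) A ^^ l) y"
  for A :: "real^'d::finite^'d"
  by (induction l) (simp_all add: matrix_vector_mult_diff_distrib)

lemma funpow_mult_vec_inj:
  fixes A :: "real^'d::finite^'d"
  assumes "invertible A" "((*v) A ^^ l) x = ((*v) A ^^ l) y" shows "x = y"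
  using assms(2) by (induction l) (auto, metis assms(1) matrix_inv_mult_vec(1))

section \<open>Energy of functions concentrated near a nonzero point\<close>

text \<open>Two facts bound the visits. For fixed \<open>l\<close> at most one \<open>k\<close>
  occurs, since two would differ after \<open>M^l\<close> by a nonzero integer vector. For late
  \<open>l\<close> the point \<open>y + vec_of_int k\<close> is so short that \<open>k\<close> does
  not depend on \<open>l\<close>; all late visits then lie on one orbit, which leaves the ball for
  good within \<open>Lb\<close> steps because its points there are bounded away from
  \<open>0\<close>. Hence \<open>C = L1 + Lb\<close>.\<close>

lemma orbit_visits_bounded:
  fixes M :: "real^'d::finite^'d"
  assumes exp: "\<forall>z. is_eigenvalue M z \<longrightarrow> cmod z > 1" and int: "is_int_matrix M" and u: "u \<noteq> 0"
  obtains \<epsilon> C where "\<epsilon> > 0"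
    "\<And>y. finite {(l, k). ((*v) M ^^ l) (y + vec_of_int k) \<in> ball u \<epsilon>}"
    "\<And>y. card {(l, k). ((*v) M ^^ l) (y + vec_of_int k) \<in> ball u \<epsilon>} \<le> C"
proof -
  \<comment> \<open>The bound \<open>1/4\<close> keeps points of the ball closer than
    \<open>1\<close>, the least norm of a nonzero integer vector; the bound
    \<open>norm u / 2\<close> keeps the ball away from the origin.\<close>
  define \<epsilon> where "\<epsilon> = min (1/4) (norm u / 2)"
  have eps: "\<epsilon> > 0" "\<epsilon> \<le> 1/4" "\<epsilon> \<le> norm u / 2" using u by (auto simp: \<epsilon>_def)
  have M: "invertible M" using exp by (rule expansive_invertible)
  \<comment> \<open>Points of the ball have norm below \<open>norm u + 1\<close>, so from
    \<open>L1\<close> on a visiting \<open>y + vec_of_int k\<close> has norm below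
    \<open>1/4\<close>.\<close>
  have "4 * (norm u + 1) > 0" by (simp add: add_nonneg_pos)
  then obtain L1 where L1: "\<And>l x. l \<ge> L1 \<Longrightarrow> (4 * (norm u + 1)) * norm x \<le> norm (((*v) M ^^ l) x)"
    using expansive_norm_ge[OF exp] by metis
  \<comment> \<open>This factor carries any vector longer than \<open>norm u / 2\<close> beyond
    \<open>norm u + 1\<close>, hence out of the ball.\<close>
  have "(2 * (norm u + 1)) / norm u > 0" using u by (simp add: add_nonneg_pos)
  then obtain Lb where Lb: "\<And>l x. l \<ge> Lb \<Longrightarrow> ((2 * (norm u + 1)) / norm u) * norm x \<le> norm (((*v) M ^^ l) x)"
    using expansive_norm_ge[OF exp] by metis
  have near: "norm x < norm u + 1" "norm x > norm u / 2" if "x \<in> ball u \<epsilon>" for x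
    using that eps norm_triangle_ineq2[of x u] norm_triangle_ineq2[of u x]
    by (auto simp: dist_norm norm_minus_commute)
  define V where "V y = {(l, k). ((*v) M ^^ l) (y + vec_of_int k) \<in> ball u \<epsilon>}" for y
  have unique: "k = k'" if "(l, k) \<in> V y" "(l, k') \<in> V y" for l k k' y
  proof (rule ccontr)
    assume "k \<noteq> k'"
    have eq: "((*v) M ^^ l) (y + vec_of_int k) - ((*v) M ^^ l) (y + vec_of_int k') =
        ((*v) M ^^ l) (vec_of_int (k - k'))"
      unfolding funpow_mult_vec_diff[symmetric] by simp
    have "((*v) M ^^ l) (vec_of_int (k - k')) \<noteq> 0"
      using \<open>k \<noteq> k'\<close> funpow_mult_vec_inj[OF M, of l "vec_of_int k" "vec_of_int k'"]
      by (auto simp: funpow_mult_vec_diff)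
    then have "1 \<le> norm (((*v) M ^^ l) (vec_of_int (k - k')))"
      by (intro Zd_norm_ge_1 int_matrix_funpow_Zd int vec_of_int_in_Zd)
    moreover have "dist (((*v) M ^^ l) (y + vec_of_int k)) (((*v) M ^^ l) (y + vec_of_int k')) < \<epsilon> + \<epsilon>"
      using that unfolding V_def by (intro dist_triangle_less_add[of _ u]) (auto simp: dist_commute)
    ultimately show False using eps(2) unfolding dist_norm eq by linarith
  qed
  have far: "l' < l + Lb" if V: "(l, k) \<in> V y" "(l', k') \<in> V y" and l: "L1 \<le> l" "l \<le> l'" for l l' k k' y
  proof (rule ccontr)
    assume "\<not> l' < l + Lb"
    have small: "norm (y + vec_of_int k) < 1/2" if "(l, k) \<in> V y" "L1 \<le> l" for l k
    proof -
      have "(4 * (norm u + 1)) * norm (y + vec_of_int k) < norm u + 1"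
        using L1[OF that(2), of "y + vec_of_int k"] near[of "((*v) M ^^ l) (y + vec_of_int k)"] that(1)
        unfolding V_def by auto
      then have "norm (y + vec_of_int k) < (norm u + 1) / (4 * (norm u + 1))"
        by (simp add: pos_less_divide_eq add_nonneg_pos mult.commute)
      also have "\<dots> = 1/4" using add_nonneg_pos[OF norm_ge_zero[of u] zero_less_one] by simp
      finally show ?thesis by simp
    qed
    have "norm (vec_of_int (k - k')) < 1"
      using small[OF V(1)] small[OF V(2)] l norm_triangle_ineq4[of "y + vec_of_int k" "y + vec_of_int k'"] by simp
    then have "k = k'" using Zd_norm_ge_1[of "vec_of_int (k - k')"] by (metis eq_iff_diff_eq_0 not_less vec_of_int_eq_0 vec_of_int_in_Zd)
    define z where "z = ((*v) M ^^ l) (y + vec_of_int k)"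
    have "((*v) M ^^ l') (y + vec_of_int k') = ((*v) M ^^ (l' - l)) z"
      unfolding z_def \<open>k = k'\<close> using l funpow_add[of "l' - l" l "(*v) M"] by simp
    then have "norm (((*v) M ^^ (l' - l)) z) < norm u + 1" using near V(2) unfolding V_def by auto
    moreover have "((2 * (norm u + 1)) / norm u) * norm z \<le> norm (((*v) M ^^ (l' - l)) z)"
      using \<open>\<not> l' < l + Lb\<close> by (intro Lb) auto
    moreover have "norm z > norm u / 2" using near V(1) unfolding V_def z_def by auto
    then have "((2 * (norm u + 1)) / norm u) * norm z > ((2 * (norm u + 1)) / norm u) * (norm u / 2)"
      using u by (intro mult_strict_left_mono) (auto intro!: divide_pos_pos simp: add_nonneg_pos)
    moreover have "((2 * (norm u + 1)) / norm u) * (norm u / 2) = norm u + 1" using u by (simp add: field_simps)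
    ultimately show False by linarith
  qed
  \<comment> \<open>Late visits lie in a window of length \<open>Lb\<close> that starts at the
    earliest of them. If there is none, the value of \<open>LEAST\<close> is arbitrary and the
    inclusion still holds.\<close>
  have fstV: "fst ` V y \<subseteq> {..<L1} \<union> {(LEAST l. l \<in> fst ` V y \<and> L1 \<le> l)..<(LEAST l. l \<in> fst ` V y \<and> L1 \<le> l) + Lb}"
    (is "_ \<subseteq> {..<L1} \<union> {?m..<?m + Lb}") for y
  proof
    fix l assume l: "l \<in> fst ` V y"
    show "l \<in> {..<L1} \<union> {?m..<?m + Lb}"
    proof (cases "l < L1")
      case False
      then have "l \<in> fst ` V y \<and> L1 \<le> l" using l by simp
      then have "?m \<in> fst ` V y \<and> L1 \<le> ?m" "?m \<le> l" by (rule LeastI, rule Least_le)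
      then show ?thesis using far[of ?m _ y l] l by fastforce
    qed simp
  qed
  have inj: "inj_on fst (V y)" for y using unique by (fastforce intro: inj_onI)
  have card_fst: "finite (fst ` V y) \<and> card (fst ` V y) \<le> L1 + Lb" for y
  proof -
    let ?m = "LEAST l. l \<in> fst ` V y \<and> L1 \<le> l"
    have "card (fst ` V y) \<le> card ({..<L1} \<union> {?m..<?m + Lb})" by (intro card_mono fstV) simp
    also have "\<dots> \<le> L1 + Lb" using card_Un_le[of "{..<L1}" "{?m..<?m + Lb}"] by simp
    finally show ?thesis using finite_subset[OF fstV] by simp
  qed
  have "finite (V y)" "card (V y) \<le> L1 + Lb" for y
    using card_fst[of y] card_image[OF inj[of y]] finite_imageD[OF _ inj[of y]] by simp_all
  then show thesis using that[of \<epsilon> "L1 + Lb"] eps(1) unfolding V_def by blast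
qed

definition affine_system :: "real^'d^'d \<Rightarrow> (nat \<Rightarrow> ('d::finite) fn) \<Rightarrow> int \<times> (int^'d) \<times> nat \<Rightarrow> 'd fn" where
  "affine_system M psi = (\<lambda>(j, k, i). Dpow M j (Tr (vec_of_int k) (psi i)))"

lemma L2_Dil_pow: "invertible M \<Longrightarrow> f \<in> L2 \<Longrightarrow> (Dil M ^^ n) f \<in> L2"
  by (induction n) (simp_all add: L2_Dil)

lemma L2_DilInv_pow: "invertible M \<Longrightarrow> f \<in> L2 \<Longrightarrow> (DilInv M ^^ n) f \<in> L2"
  by (induction n) (simp_all add: L2_DilInv)

lemma L2_Dpow: "invertible M \<Longrightarrow> f \<in> L2 \<Longrightarrow> Dpow M j f \<in> L2"
  by (simp add: Dpow_def L2_Dil_pow L2_DilInv_pow)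

text \<open>Each inverse dilation pushes the measure with density \<open>|f|^2\<close> forward along
  \<open>M\<close>. The weight is kept general because the induction replaces it by its composition
  with \<open>M\<close>.\<close>

lemma nn_integral_DilInv_pow:
  fixes M :: "real^'d::finite^'d"
  assumes M: "invertible M" and f: "f \<in> L2" and \<phi>: "\<phi> \<in> borel_measurable lebesgue"
  shows "(\<integral>\<^sup>+x. ennreal ((cmod ((DilInv M ^^ l) f x))\<^sup>2) * \<phi> x \<partial>lebesgue) =
    (\<integral>\<^sup>+x. ennreal ((cmod (f x))\<^sup>2) * \<phi> (((*v) M ^^ l) x) \<partial>lebesgue)"
  using \<phi>
proof (induction l arbitrary: \<phi>)
  case (Suc l)
  define h where "h = (DilInv M ^^ l) f"
  have h: "h \<in> L2" unfolding h_def by (rule L2_DilInv_pow[OF M f])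
  have Dh: "DilInv M h \<in> L2" using M h by (rule L2_DilInv)
  note [measurable] = Suc.prems L2_measurable[OF h] L2_measurable[OF Dh] lebesgue_measurable_mult_vec[OF M]
  have d: "\<bar>det M\<bar> > 0" using M by (simp add: invertible_det_nz)
  define G where "G x = ennreal ((cmod (DilInv M h x))\<^sup>2) * \<phi> x" for x
  have [measurable]: "G \<in> borel_measurable lebesgue" unfolding G_def by measurable
  have G: "G (M *v x) = ennreal (1 / \<bar>det M\<bar>) * (ennreal ((cmod (h x))\<^sup>2) * \<phi> (M *v x))" for x
  proof -
    have sq: "(cmod (DilInv M h (M *v x)))\<^sup>2 = 1 / \<bar>det M\<bar> * (cmod (h x))\<^sup>2"
      using M d by (simp add: DilInv_def matrix_inv_mult_vec norm_divide power_divide)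
    show ?thesis unfolding G_def sq by (subst ennreal_mult) (simp_all add: mult.assoc)
  qed
  have "ennreal (1 / \<bar>det M\<bar>) * (\<integral>\<^sup>+x. G x \<partial>lebesgue) = (\<integral>\<^sup>+x. G (M *v x) \<partial>lebesgue)"
    by (rule nn_integral_mult_vec[OF M, symmetric]) measurable
  also have "\<dots> = ennreal (1 / \<bar>det M\<bar>) * (\<integral>\<^sup>+x. ennreal ((cmod (h x))\<^sup>2) * \<phi> (M *v x) \<partial>lebesgue)"
    unfolding G by (rule nn_integral_cmult) measurable
  finally have "(\<integral>\<^sup>+x. G x \<partial>lebesgue) = (\<integral>\<^sup>+x. ennreal ((cmod (h x))\<^sup>2) * \<phi> (M *v x) \<partial>lebesgue)"
    using d by (subst (asm) ennreal_mult_cancel_left) auto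
  also have "\<dots> = (\<integral>\<^sup>+x. ennreal ((cmod (f x))\<^sup>2) * \<phi> (M *v (((*v) M ^^ l) x)) \<partial>lebesgue)"
    unfolding h_def by (rule Suc.IH) measurable
  finally show ?case by (simp add: G_def h_def)
qed simp

text \<open>Turns analysis into orbit counting: the mass of a coarse element on \<open>S\<close> is
  the mass of \<open>psi i\<close> at those \<open>y\<close> for which
  \<open>y + vec_of_int k\<close> is in \<open>S\<close> after \<open>nat (- j)\<close>
  steps.\<close>

lemma nn_integral_affine_system_neg:
  fixes M :: "real^'d::finite^'d"
  assumes M: "invertible M" and psi: "psi i \<in> L2" and S: "S \<in> sets lebesgue" and j: "j < 0"
  shows "ennreal (l2_sq (\<lambda>x. affine_system M psi (j, k, i) x * indicator S x)) =
    (\<integral>\<^sup>+y. ennreal ((cmod (psi i y))\<^sup>2) * indicator S (((*v) M ^^ nat (- j)) (y + vec_of_int k)) \<partial>lebesgue)"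
proof -
  define l where "l = nat (- j)"
  note [measurable] = lebesgue_measurable_mult_vec[OF M] S L2_measurable[OF psi]
  have pow [measurable]: "((*v) M ^^ n) \<in> lebesgue \<rightarrow>\<^sub>M lebesgue" for n
    by (induction n) (simp_all add: comp_def id_def)
  have L2: "Tr (vec_of_int k) (psi i) \<in> L2" by (rule L2_Tr[OF psi])
  have e: "affine_system M psi (j, k, i) = (DilInv M ^^ l) (Tr (vec_of_int k) (psi i))"
    using j by (simp add: affine_system_def Dpow_def l_def)
  have eL2: "affine_system M psi (j, k, i) \<in> L2"
    by (simp add: affine_system_def L2_Dpow M L2)
  have "ennreal (l2_sq (\<lambda>x. affine_system M psi (j, k, i) x * indicator S x)) =
      (\<integral>\<^sup>+x. ennreal ((cmod (affine_system M psi (j, k, i) x))\<^sup>2) * indicator S x \<partial>lebesgue)"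
    by (subst ennreal_l2_sq[OF L2_indicator[OF eL2 S]])
      (auto intro!: nn_integral_cong split: split_indicator)
  also have "\<dots> = (\<integral>\<^sup>+x. ennreal ((cmod (Tr (vec_of_int k) (psi i) x))\<^sup>2) * indicator S (((*v) M ^^ l) x) \<partial>lebesgue)"
    unfolding e by (rule nn_integral_DilInv_pow[OF M L2]) measurable
  also have "\<dots> = (\<integral>\<^sup>+y. ennreal ((cmod (psi i y))\<^sup>2) * indicator S (((*v) M ^^ l) (y + vec_of_int k)) \<partial>lebesgue)"
  proof -
    have [measurable]: "(\<lambda>y. y + vec_of_int k) \<in> lebesgue \<rightarrow>\<^sub>M (lebesgue :: (real^'d) measure)"
      using lebesgue_measurable_shift[of "- vec_of_int k"] by simp
    have "(\<lambda>y. ennreal ((cmod (psi i y))\<^sup>2) * indicator S (((*v) M ^^ l) (y + vec_of_int k)))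
        \<in> borel_measurable lebesgue" by measurable
    from nn_integral_shift[OF this, of "vec_of_int k"] show ?thesis by (simp add: Tr_def)
  qed
  finally show ?thesis unfolding l_def .
qed

text \<open>By the localized Cauchy-Schwarz inequality the energy is at most \<open>l2_sq g\<close>
  times the integral of \<open>Q r\<close>, where \<open>Q r y\<close> counts the orbit visits of
  \<open>y\<close> to \<open>ball u r\<close>, weighted by the generators. The visit bound dominates
  \<open>Q\<close> by an integrable function, and as \<open>r\<close> decreases to zero
  \<open>Q r\<close> decreases to zero almost everywhere, so the integral falls below
  \<open>\<delta>\<close>.\<close>

lemma energy_concentrated_small:
  fixes M :: "real^'d::finite^'d"
  assumes exp: "\<forall>z. is_eigenvalue M z \<longrightarrow> cmod z > 1" and int: "is_int_matrix M" and u: "u \<noteq> 0"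
    and psi: "\<And>i. i \<in> {1..n} \<Longrightarrow> psi i \<in> L2" and \<delta>: "\<delta> > 0"
  obtains \<epsilon> where "\<epsilon> > 0" "\<And>g. g \<in> L2 \<Longrightarrow> (\<And>x. x \<notin> ball u \<epsilon> \<Longrightarrow> g x = 0) \<Longrightarrow>
    energy l2_inner (affine_system M psi) ({..<0} \<times> UNIV \<times> {1..n}) g \<le> ennreal (\<delta> * l2_sq g)"
proof -
  have M: "invertible M" using exp by (rule expansive_invertible)
  define I where "I = {..<0::int} \<times> (UNIV :: (int^'d) set) \<times> {1..n}"
  have I: "countable I" by (rule countableI_type)
  note [measurable] = lebesgue_measurable_mult_vec[OF M]
  have pow [measurable]: "((*v) M ^^ n) \<in> lebesgue \<rightarrow>\<^sub>M lebesgue" for n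
    by (induction n) (simp_all add: comp_def id_def)
  have [measurable]: "(\<lambda>y. y + vec_of_int k) \<in> lebesgue \<rightarrow>\<^sub>M (lebesgue :: (real^'d) measure)" for k
    using lebesgue_measurable_shift[of "- vec_of_int k"] by simp
  obtain \<epsilon> C where eps: "\<epsilon> > 0"
    "\<And>y. finite {(l, k). ((*v) M ^^ l) (y + vec_of_int k) \<in> ball u \<epsilon>}"
    "\<And>y. card {(l, k). ((*v) M ^^ l) (y + vec_of_int k) \<in> ball u \<epsilon>} \<le> C"
    using orbit_visits_bounded[OF exp int u] by metis
  define V where "V y = {(l, k). ((*v) M ^^ l) (y + vec_of_int k) \<in> ball u \<epsilon>}" for y
  have V: "finite (V y)" "card (V y) \<le> C" for y using eps(2,3) unfolding V_def by auto
  define w where "w r y = (\<lambda>(j, k, i). ennreal ((cmod (psi i y))\<^sup>2) *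
      indicator (ball u r) (((*v) M ^^ nat (- j)) (y + vec_of_int k)))" for r :: real and y
  define Q where "Q r y = (\<integral>\<^sup>+t. w r y t \<partial>count_space I)" for r y
  have w_meas [measurable]: "(\<lambda>y. w r y t) \<in> borel_measurable lebesgue" if t: "t \<in> I" for r t
  proof -
    obtain j k i where t': "t = (j, k, i)" by (cases t) auto
    then have "psi i \<in> L2" using t psi by (auto simp: I_def)
    note [measurable] = L2_measurable[OF this]
    have [measurable]: "ball u r \<in> sets (lebesgue :: (real^'d) measure)" by simp
    show ?thesis unfolding w_def t' prod.case by measurable
  qed
  have Q_meas [measurable]: "Q r \<in> borel_measurable lebesgue" for r
    unfolding Q_def by (rule borel_measurable_nn_integral_count_space[OF I w_meas])
  define r where "r m = \<epsilon> / real (Suc m)" for m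
  have r_pos: "r m > 0" "r m \<le> \<epsilon>" for m using eps(1) by (auto simp: r_def field_simps)
  have r_dec: "r (Suc m) \<le> r m" for m using eps(1) by (auto simp: r_def field_simps)
  have w_mono: "w a y t \<le> w b y t" if "a \<le> b" for a b y t
    using that by (auto simp: w_def split: prod.splits split_indicator)
  \<comment> \<open>All contributions to \<open>Q r y\<close> with \<open>r \<le> \<epsilon>\<close>
    come from this finite set of at most \<open>C\<close> visits for each of \<open>n\<close>
    generators. It does not depend on \<open>r\<close>.\<close>
  define S where "S y = {t \<in> I. (nat (- fst t), fst (snd t)) \<in> V y}" for y
  have S: "finite (S y)" "card (S y) \<le> C * n" for y
  proof -
    have inj: "inj_on (\<lambda>t. ((nat (- fst t), fst (snd t)), snd (snd t))) (S y)"
      by (auto simp: inj_on_def S_def I_def)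
    have sub: "(\<lambda>t. ((nat (- fst t), fst (snd t)), snd (snd t))) ` S y \<subseteq> V y \<times> {1..n}"
      by (auto simp: S_def I_def)
    show "finite (S y)" using finite_imageD[OF finite_subset[OF sub] inj] V by simp
    have "card (S y) \<le> card (V y \<times> {1..n})" using inj sub V by (intro card_inj_on_le) auto
    also have "\<dots> \<le> C * n" using V(2) by (simp add: card_cartesian_product)
    finally show "card (S y) \<le> C * n" .
  qed
  have Q_sum: "Q a y = (\<Sum>t\<in>S y. w a y t)" if "a \<le> \<epsilon>" for a y
    unfolding Q_def
  proof (rule nn_integral_count_space')
    show "w a y t = 0" if "t \<in> I" "t \<notin> S y" for t
      using that \<open>a \<le> \<epsilon>\<close> by (auto simp: w_def S_def V_def split: prod.splits split_indicator)
    show "S y \<subseteq> I" by (auto simp: S_def)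
  qed (rule S)
  define \<Psi> where "\<Psi> y = (\<Sum>i\<in>{1..n}. ennreal ((cmod (psi i y))\<^sup>2))" for y
  have Q_le: "Q \<epsilon> y \<le> of_nat (C * n) * \<Psi> y" for y
  proof -
    have "w \<epsilon> y t \<le> \<Psi> y" if "t \<in> S y" for t
    proof -
      obtain j k i where t: "t = (j, k, i)" by (cases t) auto
      then have i: "i \<in> {1..n}" using that by (auto simp: S_def I_def)
      have "w \<epsilon> y t \<le> ennreal ((cmod (psi i y))\<^sup>2)" unfolding w_def t by (auto split: split_indicator)
      also have "\<dots> \<le> \<Psi> y" unfolding \<Psi>_def using i by (intro member_le_sum) auto
      finally show ?thesis .
    qed
    then have "Q \<epsilon> y \<le> of_nat (card (S y)) * \<Psi> y"
      unfolding Q_sum[OF order_refl] by (rule sum_bounded_above)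
    also have "\<dots> \<le> of_nat (C * n) * \<Psi> y" using S(2)[of y] by (intro mult_right_mono) (simp_all only: of_nat_le_iff zero_le)
    finally show ?thesis .
  qed
  have fin: "(\<integral>\<^sup>+y. Q (r 0) y \<partial>lebesgue) < \<infinity>"
  proof -
    have pm [measurable]: "i \<in> {1..n} \<Longrightarrow> psi i \<in> borel_measurable lebesgue" for i
      using psi by (rule L2_measurable)
    have "(\<integral>\<^sup>+y. Q (r 0) y \<partial>lebesgue) \<le> (\<integral>\<^sup>+y. of_nat (C * n) * \<Psi> y \<partial>lebesgue)"
      using Q_le by (intro nn_integral_mono) (simp add: r_def)
    also have "\<dots> = of_nat (C * n) * (\<Sum>i\<in>{1..n}. \<integral>\<^sup>+y. ennreal ((cmod (psi i y))\<^sup>2) \<partial>lebesgue)"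
      unfolding \<Psi>_def by (subst nn_integral_cmult, measurable, subst nn_integral_sum) measurable
    also have "\<dots> = of_nat (C * n) * (\<Sum>i\<in>{1..n}. ennreal (l2_sq (psi i)))"
      using psi by (simp add: ennreal_l2_sq)
    also have "\<dots> = ennreal (real (C * n) * (\<Sum>i\<in>{1..n}. l2_sq (psi i)))"
      by (subst ennreal_mult) (simp_all only: ennreal_of_nat_eq_real_of_nat sum_ennreal l2_sq_nonneg sum_nonneg of_nat_0_le_iff)
    also have "\<dots> < \<infinity>" by simp
    finally show ?thesis .
  qed
  \<comment> \<open>Every \<open>M^l\<close> is injective, so each of the countably many pairs
    \<open>(l, k)\<close> excludes at most one point \<open>y\<close>.\<close>
  have null: "AE y in lebesgue. \<forall>l k. ((*v) M ^^ l) (y + vec_of_int k) \<noteq> u"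
  proof -
    have "AE y in lebesgue. ((*v) M ^^ l) (y + vec_of_int k) \<noteq> u" for l k
    proof -
      define Z where "Z = {y. ((*v) M ^^ l) (y + vec_of_int k) = u}"
      have "y = y'" if "y \<in> Z" "y' \<in> Z" for y y'
        using funpow_mult_vec_inj[OF M, of l "y + vec_of_int k" "y' + vec_of_int k"] that by (simp add: Z_def)
      then have "\<exists>z. Z \<subseteq> {z}" by blast
      then obtain z where "Z \<subseteq> {z}" by blast
      then have "negligible Z" using negligible_sing negligible_subset by blast
      then have "Z \<in> null_sets lebesgue" by (simp add: negligible_iff_null_sets)
      from AE_not_in[OF this] show ?thesis by (simp add: Z_def)
    qed
    then show ?thesis by (simp add: AE_all_countable)
  qed
  have INF0: "AE y in lebesgue. (INF m. Q (r m) y) = 0"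
    using null
  proof eventually_elim
    case (elim y)
    have "\<exists>b>0. \<forall>a. a \<le> b \<longrightarrow> w a y t = 0" for t
    proof -
      obtain j k i where t: "t = (j, k, i)" by (cases t) auto
      have "dist u (((*v) M ^^ nat (- j)) (y + vec_of_int k)) > 0" using elim by auto
      then show ?thesis
        by (intro exI[of _ "dist u (((*v) M ^^ nat (- j)) (y + vec_of_int k))"]) (auto simp: w_def t)
    qed
    then obtain b where b: "\<And>t. b t > 0" "\<And>t a. a \<le> b t \<Longrightarrow> w a y t = 0" by metis
    \<comment> \<open>Finitely many visits remain, each at positive distance from \<open>u\<close>,
      so one radius avoids them all. The inserted \<open>1\<close> covers the case of no
      visit.\<close>
    define b0 where "b0 = Min (insert 1 (b ` S y))"
    have b0: "b0 > 0" unfolding b0_def using S(1)[of y] b(1) by (subst Min_gr_iff) auto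
    obtain m where m: "\<epsilon> / b0 < real m" using reals_Archimedean2 by blast
    then have "r m \<le> b0" using b0 eps(1) unfolding r_def by (simp add: field_simps)
    then have "w (r m) y t = 0" if "t \<in> S y" for t
      using that S(1)[of y] by (intro b(2)) (auto simp: b0_def intro: order_trans[OF _ Min_le])
    then have "Q (r m) y = 0" by (simp add: Q_sum[OF r_pos(2)])
    then have "(INF m. Q (r m) y) \<le> 0" by (metis INF_lower UNIV_I)
    then show ?case by simp
  qed
  have "(INF m. \<integral>\<^sup>+y. Q (r m) y \<partial>lebesgue) = (\<integral>\<^sup>+y. (INF m. Q (r m) y) \<partial>lebesgue)"
  proof (rule nn_integral_monotone_convergence_INF_AE[symmetric])
    show "AE y in lebesgue. Q (r (Suc m)) y \<le> Q (r m) y" for m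
      unfolding Q_def by (intro AE_I2 nn_integral_mono w_mono r_dec)
  qed (use fin in auto)
  also have "\<dots> = 0" using INF0 by (subst nn_integral_0_iff_AE) auto
  finally have "(INF m. \<integral>\<^sup>+y. Q (r m) y \<partial>lebesgue) < ennreal \<delta>" using \<delta> by simp
  then obtain m where m: "(\<integral>\<^sup>+y. Q (r m) y \<partial>lebesgue) < ennreal \<delta>" by (auto simp: INF_less_iff)
  show thesis
  proof (rule that)
    show "r m > 0" by (rule r_pos)
    fix g :: "'d fn" assume g: "g \<in> L2" and supp: "\<And>x. x \<notin> ball u (r m) \<Longrightarrow> g x = 0"
    have "energy l2_inner (affine_system M psi) I g \<le>
        (\<integral>\<^sup>+t. ennreal (l2_sq g) * (\<integral>\<^sup>+y. w (r m) y t \<partial>lebesgue) \<partial>count_space I)"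
      unfolding energy_def
    proof (rule nn_integral_mono)
      fix t assume "t \<in> space (count_space I)"
      then obtain j k i where t: "t = (j, k, i)" "j < 0" "i \<in> {1..n}" by (auto simp: I_def)
      have e: "affine_system M psi t \<in> L2"
        unfolding t affine_system_def using psi t by (simp add: L2_Dpow[OF M] L2_Tr)
      have "(cmod (l2_inner g (affine_system M psi t)))\<^sup>2 \<le>
          l2_sq g * l2_sq (\<lambda>x. affine_system M psi t x * indicator (ball u (r m)) x)"
        using supp by (intro l2_cauchy_schwarz_support g e) auto
      then have "ennreal ((cmod (l2_inner g (affine_system M psi t)))\<^sup>2) \<le>
          ennreal (l2_sq g) * ennreal (l2_sq (\<lambda>x. affine_system M psi t x * indicator (ball u (r m)) x))"
        by (simp add: ennreal_leI flip: ennreal_mult)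
      then show "ennreal ((cmod (l2_inner g (affine_system M psi t)))\<^sup>2) \<le>
          ennreal (l2_sq g) * (\<integral>\<^sup>+y. w (r m) y t \<partial>lebesgue)"
        unfolding t(1) using psi t by (subst (asm) nn_integral_affine_system_neg[OF M]) (auto simp: w_def)
    qed
    also have "\<dots> = ennreal (l2_sq g) * (\<integral>\<^sup>+t. (\<integral>\<^sup>+y. w (r m) y t \<partial>lebesgue) \<partial>count_space I)"
      by (simp add: nn_integral_cmult)
    also have "(\<integral>\<^sup>+t. (\<integral>\<^sup>+y. w (r m) y t \<partial>lebesgue) \<partial>count_space I) = (\<integral>\<^sup>+y. Q (r m) y \<partial>lebesgue)"
      unfolding Q_def by (rule nn_integral_count_space_nn_integral[OF I w_meas, symmetric])
    also have "ennreal (l2_sq g) * \<dots> \<le> ennreal (l2_sq g) * ennreal \<delta>"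
      using m by (intro mult_left_mono) auto
    also have "\<dots> = ennreal (\<delta> * l2_sq g)"
      using \<delta> by (simp add: mult.commute flip: ennreal_mult)
    finally show "energy l2_inner (affine_system M psi) ({..<0} \<times> UNIV \<times> {1..n}) g \<le> ennreal (\<delta> * l2_sq g)"
      unfolding I_def .
  qed
qed

lemma l2_sq_Dil_pow:
  assumes "invertible M" "f \<in> L2"
  shows "l2_sq ((Dil M ^^ J) f) = l2_sq f"
proof (induction J)
  case (Suc J)
  note L2 = L2_Dil_pow[OF assms, of J]
  show ?case using Suc l2_inner_Dil[OF assms(1) L2 L2] by (simp flip: Re_l2_inner_self)
qed simp

lemma l2_sq_Tr: "f \<in> L2 \<Longrightarrow> l2_sq (Tr u f) = l2_sq f"
  using l2_inner_Tr[of f f u] by (simp flip: Re_l2_inner_self)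

text \<open>Dilates concentrate at the origin, so a dilate shifted by a nonzero vector meets only
  boundedly many dilated lattice cells of the coarse scales.\<close>

lemma coarse_energy_shifted_dilate_tendsto_zero:
  fixes M :: "real^'d::finite^'d"
  assumes exp: "\<forall>z. is_eigenvalue M z \<longrightarrow> cmod z > 1" and int: "is_int_matrix M" and u: "u \<noteq> 0"
    and psi: "\<And>i. i \<in> {1..n} \<Longrightarrow> psi i \<in> L2" and f: "f \<in> L2" and \<delta>: "\<delta> > 0" and B: "B > 0"
    and bound: "\<And>g. g \<in> L2 \<Longrightarrow> energy l2_inner (affine_system M psi) (UNIV \<times> UNIV \<times> {1..n}) g \<le> ennreal (B * l2_sq g)"
  obtains J0 where "\<And>J. J \<ge> J0 \<Longrightarrow> energy l2_inner (affine_system M psi) ({..<0} \<times> UNIV \<times> {1..n})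
    (Tr u ((Dil M ^^ J) f)) \<le> ennreal \<delta>"
proof -
  have M: "invertible M" using exp by (rule expansive_invertible)
  let ?E = "energy l2_inner (affine_system M psi) ({..<0} \<times> UNIV \<times> {1..n})"
  have e: "t \<in> {..<0} \<times> UNIV \<times> {1..n} \<Longrightarrow> affine_system M psi t \<in> L2" for t
    using psi by (auto simp: affine_system_def intro!: L2_Dpow[OF M] L2_Tr)
  have bound': "?E g \<le> ennreal (B * l2_sq g)" if "g \<in> L2" for g
    by (rule order_trans[OF energy_mono bound[OF that]]) auto
  have "\<delta> / (4 * B) > 0" using \<delta> B by simp
  then obtain R :: nat where R: "l2_sq (\<lambda>x. f x - f x * indicator (ball 0 (real R)) x) < \<delta> / (4 * B)"
    using LIMSEQ_D[OF l2_sq_truncate_tendsto[OF f], of "\<delta> / (4 * B)"] by fastforce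
  \<comment> \<open>The part \<open>f1\<close> has bounded support and will be squeezed into a small
    ball around \<open>u\<close>. The rest \<open>f2\<close> is controlled for every
    \<open>J\<close> at once by the upper frame bound, since dilation and translation preserve its
    norm.\<close>
  define f1 where "f1 x = f x * indicator (ball 0 (real R)) x" for x
  define f2 where "f2 x = f x - f1 x" for x
  have f1: "f1 \<in> L2" unfolding f1_def by (intro L2_indicator f) simp
  have f2: "f2 \<in> L2" unfolding f2_def by (intro L2_diff f f1)
  have R': "l2_sq f2 < \<delta> / (4 * B)" using R by (simp add: f2_def[abs_def] f1_def)
  \<comment> \<open>The added \<open>1\<close> keeps the quotient meaningful when \<open>f1\<close>
    has norm zero.\<close>
  have d4: "\<delta> / (4 * (l2_sq f1 + 1)) > 0" using \<delta> by (simp add: add_nonneg_pos)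
  obtain \<epsilon> where eps: "\<epsilon> > 0" "\<And>g. g \<in> L2 \<Longrightarrow> (\<And>x. x \<notin> ball u \<epsilon> \<Longrightarrow> g x = 0) \<Longrightarrow>
      ?E g \<le> ennreal (\<delta> / (4 * (l2_sq f1 + 1)) * l2_sq g)"
    using energy_concentrated_small[OF exp int u _ d4, of n psi] psi by blast
  \<comment> \<open>This growth factor sends every point at distance at least
    \<open>\<epsilon>\<close> from \<open>u\<close> beyond radius \<open>R\<close> after
    translation, outside the support of \<open>f1\<close>.\<close>
  have "(real R + 1) / \<epsilon> > 0" using eps(1) by simp
  then obtain J0 where J0: "\<And>J x. J \<ge> J0 \<Longrightarrow> (real R + 1) / \<epsilon> * norm x \<le> norm (((*v) M ^^ J) x)"
    using expansive_norm_ge[OF exp] by metis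
  have Dil_pow: "(Dil M ^^ J) h x = complex_of_real (sqrt \<bar>det M\<bar> ^ J) * h (((*v) M ^^ J) x)" for J h x
    by (induction J arbitrary: x) (simp_all add: Dil_def funpow_swap1[of "(*v) M"])
  show thesis
  proof (rule that)
    fix J assume J: "J \<ge> J0"
    let ?T = "\<lambda>h. Tr u ((Dil M ^^ J) h)"
    have TL2: "?T h \<in> L2" "l2_sq (?T h) = l2_sq h" if "h \<in> L2" for h
      using that by (simp_all add: L2_Tr l2_sq_Tr L2_Dil_pow l2_sq_Dil_pow M)
    have "?T f1 x = 0" if "x \<notin> ball u \<epsilon>" for x
    proof -
      have "norm (x - u) \<ge> \<epsilon>" using that by (simp add: dist_norm norm_minus_commute)
      then have "(real R + 1) / \<epsilon> * norm (x - u) \<ge> (real R + 1) / \<epsilon> * \<epsilon>"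
        using eps(1) by (intro mult_left_mono) auto
      then have "norm (((*v) M ^^ J) (x - u)) \<ge> real R + 1" using J0[OF J, of "x - u"] eps(1) by simp
      then have "f1 (((*v) M ^^ J) (x - u)) = 0" by (simp add: f1_def)
      then show ?thesis by (simp add: Tr_def Dil_pow)
    qed
    then have E1: "?E (?T f1) \<le> ennreal (\<delta> / 4)"
    proof -
      have "?E (?T f1) \<le> ennreal (\<delta> / (4 * (l2_sq f1 + 1)) * l2_sq (?T f1))"
        by (rule eps(2)) (use TL2 f1 \<open>\<And>x. x \<notin> ball u \<epsilon> \<Longrightarrow> ?T f1 x = 0\<close> in auto)
      also have "\<delta> / (4 * (l2_sq f1 + 1)) * l2_sq (?T f1) \<le> \<delta> / 4"
        using \<delta> l2_sq_nonneg[of f1] by (simp add: TL2 f1 divide_simps add_nonneg_pos)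
      finally show ?thesis by (meson ennreal_leI order_trans)
    qed
    have E2: "?E (?T f2) \<le> ennreal (\<delta> / 4)"
    proof -
      have "?E (?T f2) \<le> ennreal (B * l2_sq (?T f2))" by (intro bound' TL2 f2)
      also have "B * l2_sq (?T f2) \<le> \<delta> / 4"
        using R' B by (simp add: TL2 f2 field_simps)
      finally show ?thesis by (meson ennreal_leI order_trans)
    qed
    have split: "?T f = (\<lambda>x. ?T f1 x + ?T f2 x)"
      by (simp add: fun_eq_iff Tr_def Dil_pow f2_def algebra_simps)
    have "?E (?T f) \<le> 2 * ?E (?T f1) + 2 * ?E (?T f2)"
      unfolding split by (rule energy_L2_add_le) (use e TL2 f1 f2 in auto)
    also have "\<dots> \<le> 2 * ennreal (\<delta> / 4) + 2 * ennreal (\<delta> / 4)"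
      using E1 E2 by (intro add_mono mult_left_mono) auto
    also have "\<dots> = 4 * ennreal (\<delta> / 4)" by (simp flip: distrib_right)
    also have "\<dots> = ennreal (4 * (\<delta> / 4))" by (subst ennreal_mult') simp_all
    also have "4 * (\<delta> / 4) = \<delta>" by simp
    finally show "?E (?T f) \<le> ennreal \<delta>" .
  qed
qed

section \<open>Characters of the oversampling lattice\<close>

definition imat :: "real^'d^'d \<Rightarrow> int^'d \<Rightarrow> int^'d::finite" where
  "imat A k = (\<chi> i. \<lfloor>(A *v vec_of_int k) $ i\<rfloor>)"

lemma vec_of_int_imat:
  assumes "is_int_matrix A" shows "vec_of_int (imat A k) = A *v vec_of_int k"
proof -
  obtain l where "A *v vec_of_int k = vec_of_int l"
    using int_matrix_Zd[OF assms vec_of_int_in_Zd] by (rule ZdE)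
  then show ?thesis by (simp add: imat_def vec_of_int_def vec_eq_iff)
qed

lemma imat_add: "is_int_matrix A \<Longrightarrow> imat A (k + l) = imat A k + imat A l"
  by (simp add: vec_of_int_imat matrix_vector_right_distrib flip: vec_of_int_inject)

lemma imat_diff: "is_int_matrix A \<Longrightarrow> imat A (k - l) = imat A k - imat A l"
  by (simp add: vec_of_int_imat matrix_vector_mult_diff_distrib flip: vec_of_int_inject)

lemma imat_uminus: "is_int_matrix A \<Longrightarrow> imat A (- k) = - imat A k"
  using imat_diff[of A 0 k] imat_diff[of A 0 0] by simp

lemma imat_zero: "is_int_matrix A \<Longrightarrow> imat A 0 = 0"
  using imat_diff[of A 0 0] by simp

lemma imat_pow_diff: "is_int_matrix A \<Longrightarrow> (imat A ^^ a) (k - l) = (imat A ^^ a) k - (imat A ^^ a) l"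
  by (induction a) (simp_all add: imat_diff)

lemma Zd_inner_Ints: "x \<in> Zd \<Longrightarrow> y \<in> Zd \<Longrightarrow> x \<bullet> y \<in> \<int>"
  by (auto simp: Zd_def inner_vec_def intro!: Ints_sum Ints_mult)

lemma inner_mult_vec: "(A *v x) \<bullet> y = x \<bullet> (transpose A *v y)" for A :: "real^'d::finite^'d"
  by (metis dot_lmul_matrix inner_commute transpose_matrix_vector)

lemma Zd_if_inner_Ints:
  assumes "\<And>k. vec_of_int k \<bullet> x \<in> \<int>" shows "x \<in> Zd"
proof -
  have "x $ i \<in> \<int>" for i
  proof -
    have "vec_of_int (axis i 1) = axis i 1" by (simp add: vec_of_int_def axis_def vec_eq_iff)
    then show ?thesis using assms[of "axis i 1"] by (simp add: inner_axis')
  qed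
  then show ?thesis by (simp add: Zd_def)
qed

definition character :: "int^'d \<Rightarrow> real^'d \<Rightarrow> complex" where
  "character k x = exp (2 * complex_of_real pi * \<i> * complex_of_real (vec_of_int k \<bullet> x))"

lemma character_cis: "character k x = cis (2 * pi * (vec_of_int k \<bullet> x))"
  unfolding character_def cis_conv_exp by (simp add: mult_ac)

lemma character_add: "character (k + l) x = character k x * character l x"
  by (simp add: character_cis inner_add_left distrib_left cis_mult)

lemma character_add_right: "character k (x + y) = character k x * character k y"
  by (simp add: character_cis inner_add_right distrib_left cis_mult)

lemma character_eq_1_iff: "character k x = 1 \<longleftrightarrow> vec_of_int k \<bullet> x \<in> \<int>"
proof
  assume "character k x = 1"
  then have "cos (2 * pi * (vec_of_int k \<bullet> x)) = 1"
    by (simp add: character_cis complex_eq_iff)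
  then obtain m :: int where "2 * pi * (vec_of_int k \<bullet> x) = of_int m * 2 * pi"
    using cos_one_2pi_int by blast
  then have "vec_of_int k \<bullet> x = of_int m" by simp
  then show "vec_of_int k \<bullet> x \<in> \<int>" by simp
next
  assume "vec_of_int k \<bullet> x \<in> \<int>"
  then show "character k x = 1" by (simp add: character_cis cis_multiple_2pi)
qed

lemma character_minus: "character (- k) x = cnj (character k x)"
  by (simp add: character_cis cis_cnj)

lemma character_minus_right: "character k (- x) = cnj (character k x)"
  by (simp add: character_cis cis_cnj)

lemma norm_character [simp]: "cmod (character k x) = 1"
  by (simp add: character_cis)

lemma character_nonzero [simp]: "character k x \<noteq> 0"
  using norm_character[of k x] by (metis norm_zero zero_neq_one)

lemma character_cnj_mult: "character k x * cnj (character l y) = character (k - l) x * character l (x - y)"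
  by (simp add: character_cis cis_cnj cis_mult inner_diff_left inner_diff_right algebra_simps)

lemma character_mod_Zd:
  assumes "x - y \<in> Zd" shows "character k x = character k y"
proof -
  have "character k (x - y) = 1"
    unfolding character_eq_1_iff by (rule Zd_inner_Ints[OF vec_of_int_in_Zd assms])
  then show ?thesis using character_add_right[of k "x - y" y] by simp
qed

text \<open>The translation argument for character sums, with \<open>t\<close> in place of a group
  translation, since the sums here run over chosen representatives and not over a quotient
  group.\<close>

lemma sum_eq_0_by_shift:
  fixes f :: "'a \<Rightarrow> complex"
  assumes "finite S" "inj_on t S" "t ` S \<subseteq> S" "\<And>s. s \<in> S \<Longrightarrow> f (t s) = c * f s" "c \<noteq> 1"
  shows "(\<Sum>s\<in>S. f s) = 0"
proof -
  have "t ` S = S" using assms(1-3) by (simp add: endo_inj_surj)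
  then have "(\<Sum>s\<in>S. f s) = (\<Sum>s\<in>S. f (t s))"
    using sum.reindex[OF assms(2), of f] by simp
  also have "\<dots> = c * (\<Sum>s\<in>S. f s)" using assms(4) by (simp add: sum_distrib_left)
  finally have "(1 - c) * (\<Sum>s\<in>S. f s) = 0" by (simp add: algebra_simps)
  then show ?thesis using assms(5) by simp
qed

section \<open>Characters of \<open>Z^d / P Z^d\<close> indexed by the dual representatives\<close>

locale oversampling =
  fixes M P :: "real^'d::finite^'d" and p :: nat and thetas :: "nat \<Rightarrow> real^'d" and sigma :: "nat \<Rightarrow> nat"
  assumes M_int: "is_int_matrix M"
    and M_exp: "\<forall>z. is_eigenvalue M z \<longrightarrow> cmod z > 1"
    and P_int: "is_int_matrix P"
    and p_def: "real p = \<bar>det P\<bar>" and p_nz: "p \<noteq> 0"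
    and adm: "admissible M P"
    and th0: "thetas 0 = 0"
    and th_in: "\<forall>q<p. thetas q \<in> (\<lambda>k. matrix_inv (transpose P) *v k) ` Zd"
    and th_distinct: "\<forall>q<p. \<forall>q'<p. thetas q - thetas q' \<in> Zd \<longrightarrow> q = q'"
    and th_complete: "\<forall>x\<in>(\<lambda>k. matrix_inv (transpose P) *v k) ` Zd. \<exists>q<p. x - thetas q \<in> Zd"
    and sigma_def: "\<forall>q<p. sigma q < p \<and>
          transpose (P ** M ** matrix_inv P) *v thetas q - thetas (sigma q) \<in> Zd"
begin

definition M' :: "real^'d^'d" where "M' = P ** M ** matrix_inv P"

abbreviation chi :: "int^'d \<Rightarrow> nat \<Rightarrow> complex" where "chi k q \<equiv> character k (thetas q)"

abbreviation PZ :: "(int^'d) set" where "PZ \<equiv> range (imat P)"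

lemma M_inv: "invertible M" using M_exp by (rule expansive_invertible)

lemma P_inv: "invertible P" using p_def p_nz by (auto simp: invertible_det_nz)

lemma PT_inv: "invertible (transpose P)" using P_inv by (simp add: invertible_det_nz)

lemma M'_int: "is_int_matrix M'" using adm by (simp add: admissible_def M'_def)

lemma M'_P: "M' *v (P *v x) = P *v (M *v x)"
  unfolding M'_def using P_inv by (simp flip: matrix_vector_mul_assoc add: matrix_inv_mult_vec)

lemma inv_P_M': "matrix_inv P *v (M' *v x) = M *v (matrix_inv P *v x)"
  unfolding M'_def using P_inv by (simp flip: matrix_vector_mul_assoc add: matrix_inv_mult_vec)

lemma imat_P_inj: "imat P k = imat P l \<Longrightarrow> k = l"
  using P_inv vec_of_int_imat[OF P_int] matrix_inv_mult_vec(1) by (metis vec_of_int_inject)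

lemma PZ_iff: "k \<in> PZ \<longleftrightarrow> matrix_inv P *v vec_of_int k \<in> Zd"
proof
  assume "k \<in> PZ"
  then show "matrix_inv P *v vec_of_int k \<in> Zd"
    using P_inv by (auto simp: vec_of_int_imat[OF P_int] matrix_inv_mult_vec)
next
  assume "matrix_inv P *v vec_of_int k \<in> Zd"
  then obtain l where "matrix_inv P *v vec_of_int k = vec_of_int l" by (rule ZdE)
  then have "vec_of_int k = P *v vec_of_int l" using P_inv by (metis matrix_inv_mult_vec(2))
  then have "k = imat P l" by (simp add: vec_of_int_imat[OF P_int] flip: vec_of_int_inject)
  then show "k \<in> PZ" by blast
qed

lemma PZ_add: "k \<in> PZ \<Longrightarrow> l \<in> PZ \<Longrightarrow> k + l \<in> PZ"
  by (auto simp: imat_add[OF P_int, symmetric])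

lemma PZ_diff: "k \<in> PZ \<Longrightarrow> l \<in> PZ \<Longrightarrow> k - l \<in> PZ"
  by (auto simp: imat_diff[OF P_int, symmetric])

lemma PZ_0: "0 \<in> PZ" using imat_zero[OF P_int] by (metis rangeI)

lemma dual_lattice_iff: "x \<in> (\<lambda>k. matrix_inv (transpose P) *v k) ` Zd \<longleftrightarrow> transpose P *v x \<in> Zd"
proof
  assume "x \<in> (\<lambda>k. matrix_inv (transpose P) *v k) ` Zd"
  then obtain k where "x = matrix_inv (transpose P) *v k" "k \<in> Zd" by blast
  then show "transpose P *v x \<in> Zd" by (simp only: matrix_inv_mult_vec(2)[OF PT_inv])
next
  assume "transpose P *v x \<in> Zd"
  then have "matrix_inv (transpose P) *v (transpose P *v x) \<in> (\<lambda>k. matrix_inv (transpose P) *v k) ` Zd"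
    by (rule imageI)
  then show "x \<in> (\<lambda>k. matrix_inv (transpose P) *v k) ` Zd"
    by (simp only: matrix_inv_mult_vec(1)[OF PT_inv])
qed

lemma thetas_dual: "q < p \<Longrightarrow> transpose P *v thetas q \<in> Zd"
  using th_in dual_lattice_iff by blast

lemma chi_PZ: assumes "k \<in> PZ" "q < p" shows "chi k q = 1"
proof -
  obtain m where "k = imat P m" using assms(1) by blast
  then have "vec_of_int k \<bullet> thetas q = vec_of_int m \<bullet> (transpose P *v thetas q)"
    by (simp add: vec_of_int_imat[OF P_int] inner_mult_vec)
  also have "\<dots> \<in> \<int>" by (rule Zd_inner_Ints[OF vec_of_int_in_Zd thetas_dual[OF assms(2)]])
  finally show ?thesis by (simp add: character_eq_1_iff)
qed

text \<open>The dual lattice is closed under addition, so completeness of the representatives yields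
  \<open>t\<close> and their distinctness makes it injective. This is the shift needed for character
  sums over \<open>q\<close>.\<close>

lemma thetas_shift:
  assumes q0: "q0 < p"
  obtains t where "inj_on t {..<p}" "t ` {..<p} \<subseteq> {..<p}"
    "\<And>q. q < p \<Longrightarrow> thetas q + thetas q0 - thetas (t q) \<in> Zd"
proof -
  have "\<exists>q'<p. thetas q + thetas q0 - thetas q' \<in> Zd" if "q < p" for q
  proof -
    have "thetas q + thetas q0 \<in> (\<lambda>k. matrix_inv (transpose P) *v k) ` Zd"
      unfolding dual_lattice_iff matrix_vector_right_distrib by (intro Zd_simps thetas_dual that q0)
    then show ?thesis using th_complete by blast
  qed
  then obtain t where t: "\<And>q. q < p \<Longrightarrow> t q < p \<and> thetas q + thetas q0 - thetas (t q) \<in> Zd" by metis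
  have "inj_on t {..<p}"
  proof (rule inj_onI)
    fix q q' assume q: "q \<in> {..<p}" "q' \<in> {..<p}" "t q = t q'"
    have "(thetas q + thetas q0 - thetas (t q)) - (thetas q' + thetas q0 - thetas (t q')) \<in> Zd"
      by (rule Zd_simps(3)) (use q(1,2) t in auto)
    also have "(thetas q + thetas q0 - thetas (t q)) - (thetas q' + thetas q0 - thetas (t q')) = thetas q - thetas q'"
      using q(3) by simp
    finally show "q = q'" using q(1,2) th_distinct by blast
  qed
  then show thesis using t that[of t] by auto
qed

text \<open>Lattice duality: \<open>P^(-1) k\<close> paired with an integer vector \<open>l\<close>
  equals \<open>k\<close> paired with \<open>(P^T)^(-1) l\<close>, a point congruent to some
  \<open>thetas q\<close>. Trivial characters make all these pairings integers.\<close>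

lemma PZ_if_chi_eq_1:
  assumes "\<And>q. q < p \<Longrightarrow> chi k q = 1" shows "k \<in> PZ"
  unfolding PZ_iff
proof (rule Zd_if_inner_Ints)
  fix l
  define x where "x = matrix_inv (transpose P) *v vec_of_int l"
  have Px: "transpose P *v x = vec_of_int l" unfolding x_def by (rule matrix_inv_mult_vec(2)[OF PT_inv])
  obtain q where q: "q < p" "x - thetas q \<in> Zd"
    using th_complete unfolding x_def by (meson imageI vec_of_int_in_Zd)
  have "character k x = 1" using character_mod_Zd[OF q(2)] assms[OF q(1)] by simp
  then have "vec_of_int k \<bullet> x \<in> \<int>" by (simp add: character_eq_1_iff)
  also have "vec_of_int k \<bullet> x = (P *v (matrix_inv P *v vec_of_int k)) \<bullet> x"
    using P_inv by (simp add: matrix_inv_mult_vec)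
  also have "\<dots> = vec_of_int l \<bullet> (matrix_inv P *v vec_of_int k)"
    unfolding inner_mult_vec[of P] Px by (rule inner_commute)
  finally show "vec_of_int l \<bullet> (matrix_inv P *v vec_of_int k) \<in> \<int>" .
qed

lemma chi_sum: "(\<Sum>q<p. chi k q) = (if k \<in> PZ then of_nat p else 0)"
proof (cases "k \<in> PZ")
  case True
  then show ?thesis by (simp add: chi_PZ)
next
  case False
  then obtain q0 where q0: "q0 < p" "chi k q0 \<noteq> 1" using PZ_if_chi_eq_1 by blast
  obtain t where t: "inj_on t {..<p}" "t ` {..<p} \<subseteq> {..<p}"
    "\<And>q. q < p \<Longrightarrow> thetas q + thetas q0 - thetas (t q) \<in> Zd" using thetas_shift[OF q0(1)] by blast
  have "(\<Sum>q<p. chi k q) = 0"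
  proof (rule sum_eq_0_by_shift[OF _ t(1,2) _ q0(2)])
    show "chi k (t q) = chi k q0 * chi k q" if "q \<in> {..<p}" for q
      using character_mod_Zd[OF t(3)[of q], of k] that by (simp add: character_add_right mult.commute)
  qed simp
  then show ?thesis using False by simp
qed

section \<open>Nonzero coset representatives and orthogonality relations\<close>

definition rep :: "int^'d \<Rightarrow> int^'d" where
  "rep k = (SOME k'. k' \<noteq> 0 \<and> k - k' \<in> PZ)"

text \<open>The choice in \<open>rep\<close> depends only on the coset, so its range contains
  exactly one element of each coset of \<open>PZ\<close>, never zero.\<close>

definition R0 :: "(int^'d) set" where "R0 = range rep"

lemma rep: "rep k \<noteq> 0" "k - rep k \<in> PZ"
proof -
  have "\<exists>k'. k' \<noteq> 0 \<and> k - k' \<in> PZ"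
  proof (cases "k = 0")
    case True
    \<comment> \<open>\<open>1\<close> is the vector of ones; its image under the injective
      \<open>P\<close> is a nonzero member of the trivial coset.\<close>
    have "(1 :: int^'d) \<noteq> 0" by (simp add: vec_eq_iff)
    then have "imat P 1 \<noteq> 0" using imat_P_inj[of 1 0] imat_zero[OF P_int] by metis
    then show ?thesis using True by (intro exI[of _ "imat P 1"]) (auto simp: imat_uminus[OF P_int, symmetric])
  next
    case False
    then show ?thesis using PZ_0 by (intro exI[of _ k]) simp
  qed
  from someI_ex[OF this] show "rep k \<noteq> 0" "k - rep k \<in> PZ" by (simp_all add: rep_def)
qed

lemma rep_cong: assumes "k - l \<in> PZ" shows "rep k = rep l"
proof -
  have "k - k' \<in> PZ \<longleftrightarrow> l - k' \<in> PZ" for k'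
    using PZ_add[OF assms, of "l - k'"] PZ_diff[of "k - k'" "k - l"] assms by auto
  then show ?thesis by (simp add: rep_def)
qed

lemma R0_nonzero: "r \<in> R0 \<Longrightarrow> r \<noteq> 0" using rep(1) by (auto simp: R0_def)

lemma rep_in_R0: "rep k \<in> R0" by (simp add: R0_def)

lemma rep_R0: "r \<in> R0 \<Longrightarrow> rep r = r"
  unfolding R0_def using rep(2) rep_cong by (metis imageE minus_diff_eq PZ_diff PZ_0 diff_0)

lemma R0_unique: "r \<in> R0 \<Longrightarrow> r' \<in> R0 \<Longrightarrow> r - r' \<in> PZ \<Longrightarrow> r = r'"
  using rep_cong[of r r'] rep_R0 by simp

lemma chi_row_orthogonal:
  assumes "r \<in> R0" "r' \<in> R0"
  shows "(\<Sum>q<p. chi r q * cnj (chi r' q)) = (if r = r' then of_nat p else 0)"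
proof -
  have "(\<Sum>q<p. chi r q * cnj (chi r' q)) = (\<Sum>q<p. chi (r - r') q)"
    by (simp add: character_cnj_mult character_eq_1_iff[THEN iffD2])
  also have "\<dots> = (if r = r' then of_nat p else 0)"
    unfolding chi_sum using R0_unique[OF assms] PZ_0 by auto
  finally show ?thesis .
qed

text \<open>A second-moment identity for an arbitrary finite set of representatives. It is used
  twice: to show that there are finitely many, and then to count them.\<close>

lemma sum_square_chi:
  assumes "finite F" "F \<subseteq> R0"
  shows "(\<Sum>q<p. (cmod (\<Sum>r\<in>F. chi r q))\<^sup>2) = real p * real (card F)"
proof -
  have "complex_of_real (\<Sum>q<p. (cmod (\<Sum>r\<in>F. chi r q))\<^sup>2) =
      (\<Sum>q<p. (\<Sum>r\<in>F. chi r q) * cnj (\<Sum>r\<in>F. chi r q))"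
    by (simp add: complex_norm_square del: of_real_power)
  also have "\<dots> = (\<Sum>q<p. \<Sum>r\<in>F. \<Sum>r'\<in>F. chi r q * cnj (chi r' q))"
    by (simp add: sum_product)
  also have "\<dots> = (\<Sum>r\<in>F. \<Sum>r'\<in>F. \<Sum>q<p. chi r q * cnj (chi r' q))"
    by (subst sum.swap, intro sum.cong refl, subst sum.swap, rule refl)
  also have "\<dots> = (\<Sum>r\<in>F. \<Sum>r'\<in>F. if r = r' then of_nat p else 0)"
    using assms by (intro sum.cong refl chi_row_orthogonal) auto
  also have "\<dots> = complex_of_real (real p * real (card F))"
    using assms(1) by (simp add: mult.commute)
  finally show ?thesis by (rule of_real_eq_iff[THEN iffD1])
qed

text \<open>Since \<open>thetas 0 = 0\<close>, the single term \<open>q = 0\<close> of the second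
  moment is \<open>(card F)^2\<close>. Comparing it with \<open>p * card F\<close> bounds every
  finite subset.\<close>

lemma finite_R0: "finite R0"
proof -
  have "card F \<le> p" if F: "finite F" "F \<subseteq> R0" for F
  proof -
    have "(cmod (\<Sum>r\<in>F. chi r 0))\<^sup>2 \<le> (\<Sum>q<p. (cmod (\<Sum>r\<in>F. chi r q))\<^sup>2)"
      using p_nz by (intro member_le_sum) auto
    then have "real (card F) * real (card F) \<le> real p * real (card F)"
      unfolding sum_square_chi[OF F] by (simp add: th0 character_def power2_eq_square)
    then show ?thesis by (cases "card F = 0") (auto simp flip: of_nat_mult)
  qed
  then show ?thesis using finite_if_finite_subsets_card_bdd by metis
qed

lemma R0_shift: "inj_on (\<lambda>r. rep (r + k)) R0"
proof (rule inj_onI)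
  fix r r' assume r: "r \<in> R0" "r' \<in> R0" "rep (r + k) = rep (r' + k)"
  have "(r + k) - rep (r + k) - ((r' + k) - rep (r' + k)) \<in> PZ" by (intro PZ_diff rep)
  then show "r = r'" using r R0_unique by simp
qed

lemma chi_column_orthogonal:
  assumes "q < p" "q' < p" "q \<noteq> q'"
  shows "(\<Sum>r\<in>R0. chi r q * cnj (chi r q')) = 0"
proof -
  define x where "x = thetas q - thetas q'"
  have eq: "chi r q * cnj (chi r q') = character r x" for r
    by (simp add: x_def flip: character_minus_right character_add_right)
  have "x \<notin> Zd" using th_distinct assms by (auto simp: x_def)
  then obtain k0 where k0: "character k0 x \<noteq> 1" using Zd_if_inner_Ints character_eq_1_iff by blast
  have per: "character k x = 1" if "k \<in> PZ" for k
    unfolding eq[symmetric] using that assms by (simp add: chi_PZ)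
  show ?thesis
    unfolding eq
  proof (rule sum_eq_0_by_shift[OF finite_R0 R0_shift[of k0] _ _ k0])
    show "(\<lambda>r. rep (r + k0)) ` R0 \<subseteq> R0" using rep_in_R0 by blast
    fix r
    have "character (r + k0) x = character (rep (r + k0)) x"
      using per[OF rep(2)[of "r + k0"]] character_add[of "r + k0 - rep (r + k0)" "rep (r + k0)" x] by simp
    then show "character (rep (r + k0)) x = character k0 x * character r x"
      by (simp add: character_add mult.commute)
  qed
qed

text \<open>Column orthogonality against \<open>q = 0\<close> kills all other terms of the second
  moment, leaving \<open>card^2 = p * card\<close>. The index of \<open>P Z^d\<close> is thus read
  off from the number of characters.\<close>

lemma card_R0: "card R0 = p"
proof -
  have "(\<Sum>q<p. (cmod (\<Sum>r\<in>R0. chi r q))\<^sup>2) = (\<Sum>q<p. if q = 0 then (real (card R0))\<^sup>2 else 0)"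
  proof (intro sum.cong refl)
    fix q assume q: "q \<in> {..<p}"
    have "(\<Sum>r\<in>R0. chi r q) = (\<Sum>r\<in>R0. chi r q * cnj (chi r 0))"
      by (simp add: th0 character_def)
    then show "(cmod (\<Sum>r\<in>R0. chi r q))\<^sup>2 = (if q = 0 then (real (card R0))\<^sup>2 else 0)"
      using chi_column_orthogonal[of q 0] q by (auto simp: th0 character_def)
  qed
  also have "\<dots> = (real (card R0))\<^sup>2" using p_nz by simp
  finally have "real p * real (card R0) = real (card R0) * real (card R0)"
    unfolding sum_square_chi[OF finite_R0 order_refl] by (simp add: power2_eq_square)
  moreover have "card R0 \<noteq> 0" using finite_R0 by (auto simp: R0_def)
  ultimately show ?thesis by simp
qed

lemma chi_columns:
  assumes "q < p" "q' < p"
  shows "(\<Sum>r\<in>R0. chi r q * cnj (chi r q')) = (if q = q' then of_nat p else 0)"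
  using chi_column_orthogonal[OF assms] by (auto simp: card_R0 simp flip: complex_norm_square)

section \<open>Action of \<open>M'\<close> on cosets and of its transpose on characters\<close>

abbreviation iM :: "int^'d \<Rightarrow> int^'d" where "iM \<equiv> imat M'"

text \<open>The intersection condition of admissibility enters here: \<open>P^(-1) k\<close> lies in
  \<open>P^(-1) Z^d\<close>, and in \<open>M^(-1) Z^d\<close> by the assumption on
  \<open>M' k\<close>, hence in \<open>Z^d\<close>.\<close>

lemma PZ_if_iM_PZ:
  assumes "iM k \<in> PZ" shows "k \<in> PZ"
proof -
  define x where "x = matrix_inv P *v vec_of_int k"
  have "M *v x \<in> Zd" using assms unfolding PZ_iff vec_of_int_imat[OF M'_int] inv_P_M' x_def .
  then have "matrix_inv M *v (M *v x) \<in> (\<lambda>k. matrix_inv M *v k) ` Zd" by blast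
  then have "x \<in> (\<lambda>k. matrix_inv M *v k) ` Zd" using M_inv by (simp add: matrix_inv_mult_vec)
  moreover have "x \<in> (\<lambda>k. matrix_inv P *v k) ` Zd" unfolding x_def by simp
  ultimately show ?thesis using adm unfolding admissible_def PZ_iff x_def by blast
qed

lemma PZ_if_iM_pow_PZ: "(iM ^^ a) k \<in> PZ \<Longrightarrow> k \<in> PZ"
proof (induction a)
  case (Suc a)
  then have "iM ((iM ^^ a) k) \<in> PZ" by simp
  from PZ_if_iM_PZ[OF this] show ?case by (rule Suc.IH)
qed simp

text \<open>By admissibility the map induced by \<open>M'^a\<close> on the finite set of cosets is
  injective, hence a permutation. The vectors \<open>M'^a r\<close> therefore represent every coset
  exactly once.\<close>

lemma bij_betw_coset:
  "bij_betw (\<lambda>(r, m). (iM ^^ a) r + imat P m) (R0 \<times> UNIV) UNIV"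
proof (rule bij_betwI')
  fix s s' assume "s \<in> R0 \<times> (UNIV :: (int^'d) set)" "s' \<in> R0 \<times> (UNIV :: (int^'d) set)"
  then obtain r m r' m' where s: "s = (r, m)" "s' = (r', m')" "r \<in> R0" "r' \<in> R0" by auto
  show "((case s of (r, m) \<Rightarrow> (iM ^^ a) r + imat P m) = (case s' of (r, m) \<Rightarrow> (iM ^^ a) r + imat P m)) = (s = s')"
  proof
    assume "(case s of (r, m) \<Rightarrow> (iM ^^ a) r + imat P m) = (case s' of (r, m) \<Rightarrow> (iM ^^ a) r + imat P m)"
    then have eq: "(iM ^^ a) r + imat P m = (iM ^^ a) r' + imat P m'" by (simp add: s)
    then have "(iM ^^ a) (r - r') = imat P (m' - m)"
      by (simp add: imat_pow_diff[OF M'_int] imat_diff[OF P_int] algebra_simps)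
    then have "r - r' \<in> PZ" using PZ_if_iM_pow_PZ[of a "r - r'"] by simp
    then have "r = r'" using R0_unique s by blast
    then show "s = s'" using eq imat_P_inj[of m m'] s by simp
  qed simp
next
  fix k :: "int^'d"
  have "inj_on (\<lambda>r. rep ((iM ^^ a) r)) R0"
  proof (rule inj_onI)
    fix r r' assume r: "r \<in> R0" "r' \<in> R0" "rep ((iM ^^ a) r) = rep ((iM ^^ a) r')"
    have "(iM ^^ a) r - rep ((iM ^^ a) r) - ((iM ^^ a) r' - rep ((iM ^^ a) r')) \<in> PZ" by (intro PZ_diff rep)
    then have "(iM ^^ a) (r - r') \<in> PZ" using r by (simp add: imat_pow_diff[OF M'_int])
    then show "r = r'" using r R0_unique PZ_if_iM_pow_PZ by blast
  qed
  then have "(\<lambda>r. rep ((iM ^^ a) r)) ` R0 = R0"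
    using finite_R0 rep_in_R0 by (intro endo_inj_surj) auto
  then have "rep k \<in> (\<lambda>r. rep ((iM ^^ a) r)) ` R0" using rep_in_R0[of k] by simp
  then obtain r where r: "r \<in> R0" "rep k = rep ((iM ^^ a) r)" by (rule imageE)
  have "(k - rep k) - ((iM ^^ a) r - rep ((iM ^^ a) r)) \<in> PZ" by (intro PZ_diff rep)
  then have "k - (iM ^^ a) r \<in> PZ" using r by simp
  then obtain m where "k - (iM ^^ a) r = imat P m" by blast
  then have "k = (iM ^^ a) r + imat P m" by (simp add: algebra_simps)
  then show "\<exists>s\<in>R0 \<times> UNIV. k = (case s of (r, m) \<Rightarrow> (iM ^^ a) r + imat P m)"
    using r by (intro bexI[of _ "(r, m)"]) auto
qed simp

lemma sigma_lt: "q < p \<Longrightarrow> sigma q < p" using sigma_def by blast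

lemma chi_iM: assumes "q < p" shows "chi (iM k) q = chi k (sigma q)"
proof -
  have "transpose M' *v thetas q - thetas (sigma q) \<in> Zd"
    using sigma_def assms by (simp add: M'_def)
  from character_mod_Zd[OF this] have "character k (transpose M' *v thetas q) = chi k (sigma q)" .
  then show ?thesis by (simp add: character_def vec_of_int_imat[OF M'_int] inner_mult_vec)
qed

text \<open>The assumptions only make \<open>sigma\<close> a self-map. As every \<open>k\<close> has
  the form \<open>M' r + P m\<close>, the character of \<open>thetas q\<close> at \<open>k\<close>
  depends on \<open>sigma q\<close> alone, and characters separate the representatives.\<close>

lemma sigma_inj: "inj_on sigma {..<p}"
proof (rule inj_onI)
  fix q q' assume q: "q \<in> {..<p}" "q' \<in> {..<p}" "sigma q = sigma q'"
  have "chi k q = chi k q'" for k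
  proof -
    have "k \<in> (\<lambda>(r, m). (iM ^^ 1) r + imat P m) ` (R0 \<times> UNIV)"
      unfolding bij_betw_imp_surj_on[OF bij_betw_coset] by simp
    then obtain r m where "k = iM r + imat P m" by auto
    then show ?thesis using q by (simp add: character_add chi_PZ chi_iM)
  qed
  then have "character k (thetas q - thetas q') = 1" for k
    using character_add_right[of k "thetas q - thetas q'" "thetas q'"] by simp
  then have "thetas q - thetas q' \<in> Zd" by (intro Zd_if_inner_Ints) (simp add: character_eq_1_iff)
  then show "q = q'" using q th_distinct by simp
qed

lemma sigma_bij: "bij_betw sigma {..<p} {..<p}"
  using sigma_inj sigma_lt by (intro bij_betw_imageI endo_inj_surj) auto

lemma sigma_0: "sigma 0 = 0"
proof -
  have "transpose (P ** M ** matrix_inv P) *v thetas 0 - thetas (sigma 0) \<in> Zd" using sigma_def p_nz by simp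
  then have "thetas 0 - thetas (sigma 0) \<in> Zd" by (simp add: th0)
  then show ?thesis using th_distinct p_nz sigma_lt[of 0] by (metis neq0_conv)
qed

abbreviation sinv :: "nat \<Rightarrow> nat" where "sinv \<equiv> inv_into {..<p} sigma"

lemma sinv:
  assumes "q < p" shows "sinv q < p" "sigma (sinv q) = q" "sinv (sigma q) = q"
  using sigma_bij assms bij_betw_inv_into_right[OF sigma_bij, of q] bij_betw_inv_into_left[OF sigma_bij, of q]
    bij_betwE[OF bij_betw_inv_into[OF sigma_bij]] by auto

end

section \<open>The vector-valued affine system\<close>

text \<open>Exponents are only raised, so one-sided cancellation suffices. It is required only on
  \<open>K\<close>, because for the vector-valued dilation it fails on sequences that do not vanish
  beyond \<open>p\<close>.\<close>

lemma zpow_add_nat: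
  fixes D D' :: "'a \<Rightarrow> 'a" and K :: "'a set"
  assumes "\<And>x. x \<in> K \<Longrightarrow> D (D' x) = x" "\<And>x. x \<in> K \<Longrightarrow> D' x \<in> K" "x \<in> K"
  defines "Z j \<equiv> (if j \<ge> 0 then D ^^ nat j else D' ^^ nat (- j))"
  shows "Z (j + int n) x = (D ^^ n) (Z j x)"
proof -
  have step: "Z (j + 1) x = D (Z j x)" for j :: int
  proof (cases "j \<ge> 0")
    case True
    then have "nat (j + 1) = Suc (nat j)" by simp
    then show ?thesis using True by (simp add: Z_def)
  next
    case False
    then obtain m where m: "nat (- j) = Suc m" by (metis not0_implies_Suc zero_less_nat_eq neg_0_less_iff_less not_le less_not_refl)
    have K: "(D' ^^ m) x \<in> K" for m by (induction m) (use assms in auto)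
    have "D (Z j x) = (D' ^^ m) x" using False assms(1)[OF K] by (simp add: Z_def m)
    also have "\<dots> = Z (j + 1) x"
    proof (cases "j = -1")
      case True
      then show ?thesis using m by (simp add: Z_def)
    next
      case ne: False
      then have "\<not> j + 1 \<ge> 0" "nat (- (j + 1)) = m" using False m by auto
      then show ?thesis by (simp only: Z_def if_False)
    qed
    finally show ?thesis by simp
  qed
  show ?thesis
  proof (induction n)
    case (Suc n)
    have "Z (j + int (Suc n)) x = Z ((j + int n) + 1) x" by (simp add: algebra_simps)
    then show ?case unfolding step by (simp add: Suc)
  qed simp
qed

lemma Dil_divide: "Dil M (\<lambda>x. f x / c) = (\<lambda>x. Dil M f x / c)"
  by (simp add: Dil_def fun_eq_iff)

lemma DilInv_divide: "DilInv M (\<lambda>x. f x / c) = (\<lambda>x. DilInv M f x / c)"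
  by (simp add: DilInv_def fun_eq_iff)

lemma Dpow_divide: "Dpow M j (\<lambda>x. f x / c) = (\<lambda>x. Dpow M j f x / c)"
proof -
  have "(Dil M ^^ n) (\<lambda>x. f x / c) = (\<lambda>x. (Dil M ^^ n) f x / c)"
    "(DilInv M ^^ n) (\<lambda>x. f x / c) = (\<lambda>x. (DilInv M ^^ n) f x / c)" for n
    by (induction n) (simp_all add: Dil_divide DilInv_divide)
  then show ?thesis by (simp add: Dpow_def)
qed

lemma HspD: "F \<in> Hsp p \<Longrightarrow> q < p \<Longrightarrow> F q \<in> L2" "F \<in> Hsp p \<Longrightarrow> q \<ge> p \<Longrightarrow> F q = (\<lambda>x. 0)"
  by (simp_all add: Hsp_def)

lemma H_inner_self: "H_inner p F F = complex_of_real (\<Sum>q<p. l2_sq (F q))"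
  by (simp add: H_inner_def l2_inner_self)

lemma Re_H_inner_self_nonneg: "Re (H_inner p F F) \<ge> 0"
  by (simp add: H_inner_self sum_nonneg)

lemma H_inner_commute: "H_inner p G F = cnj (H_inner p F G)"
  unfolding H_inner_def cnj_sum by (intro sum.cong refl l2_inner_commute)

lemma Sop_Hsp: "f \<in> L2 \<Longrightarrow> Sop p f \<in> Hsp p"
  by (simp add: Hsp_def Sop_def L2_divide)

text \<open>The adjoint of \<open>Sop\<close>, given by a pointwise formula so that its relations
  with the operators are equalities of functions and not merely almost everywhere.\<close>

definition Sadj :: "nat \<Rightarrow> (nat \<Rightarrow> ('d::finite) fn) \<Rightarrow> 'd fn" where
  "Sadj p F = (\<lambda>x. (\<Sum>q<p. F q x) / complex_of_real (sqrt (real p)))"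

lemma Sadj_L2: "F \<in> Hsp p \<Longrightarrow> Sadj p F \<in> L2"
  unfolding Sadj_def by (intro L2_divide L2_sum) (simp add: HspD)

lemma H_inner_Sop:
  assumes "F \<in> Hsp p" "f \<in> L2" shows "H_inner p F (Sop p f) = l2_inner (Sadj p F) f"
proof -
  have "H_inner p F (Sop p f) = (\<Sum>q<p. l2_inner (F q) f) / complex_of_real (sqrt (real p))"
    by (simp add: H_inner_def Sop_def l2_inner_divide_right sum_divide_distrib)
  also have "\<dots> = l2_inner (Sadj p F) f"
    unfolding Sadj_def l2_inner_divide_left using assms by (subst l2_inner_sum_left) (auto simp: HspD)
  finally show ?thesis .
qed

lemma Sop_H_inner:
  assumes "F \<in> Hsp p" "f \<in> L2" shows "H_inner p (Sop p f) F = l2_inner f (Sadj p F)"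
  using H_inner_Sop[OF assms] H_inner_commute l2_inner_commute by metis

lemma Sadj_Sop: "p \<noteq> 0 \<Longrightarrow> Sadj p (Sop p f) = f"
  by (simp add: Sadj_def Sop_def fun_eq_iff flip: of_real_mult)

context oversampling
begin

section \<open>Relations between the operators on \<open>H\<close> and the embedding\<close>

lemma p_pos: "0 < p" using p_nz by simp

lemma bT_eq: "bT P thetas k F = (\<lambda>q x. chi k q * F q (x - matrix_inv P *v vec_of_int k))"
  by (simp add: bT_def character_def Tr_def)

lemma bT_Tr: "bT P thetas k F q = (\<lambda>x. chi k q * Tr (matrix_inv P *v vec_of_int k) (F q) x)"
  by (simp add: bT_def character_def)

lemma bT_Hsp: "F \<in> Hsp p \<Longrightarrow> bT P thetas k F \<in> Hsp p"
  by (auto simp: Hsp_def bT_eq L2_scale intro!: L2_scale L2_Tr[unfolded Tr_def])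

lemma bT_bT: "bT P thetas k (bT P thetas l F) = bT P thetas (k + l) F"
  by (simp add: bT_eq fun_eq_iff character_add matrix_vector_right_distrib algebra_simps)

lemma bT_0: "bT P thetas 0 F = F"
  by (simp add: bT_eq character_def)

lemma bT_bD: "bT P thetas k (bD M p sigma F) = bD M p sigma (bT P thetas (iM k) F)"
proof (intro ext)
  fix q x
  show "bT P thetas k (bD M p sigma F) q x = bD M p sigma (bT P thetas (iM k) F) q x"
  proof (cases "q < p")
    case True
    then have "chi (iM k) (sinv q) = chi k q" using chi_iM[of "sinv q" k] sinv[of q] by simp
    then show ?thesis using True
      by (simp add: bT_eq bD_def Dil_def vec_of_int_imat[OF M'_int] inv_P_M' matrix_vector_mult_diff_distrib)
  qed (simp add: bT_eq bD_def)
qed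

lemma bT_bD_pow: "bT P thetas k ((bD M p sigma ^^ a) F) = (bD M p sigma ^^ a) (bT P thetas ((iM ^^ a) k) F)"
  by (induction a arbitrary: k) (simp_all add: bT_bD funpow_swap1[of iM])

lemma bT_Sop: "bT P thetas (imat P m) (Sop p f) = Sop p (Tr (vec_of_int m) f)"
  using P_inv by (auto simp: bT_eq Sop_def Tr_def fun_eq_iff chi_PZ vec_of_int_imat[OF P_int] matrix_inv_mult_vec)

lemma bD_Sop: "bD M p sigma (Sop p f) = Sop p (Dil M f)"
  by (auto simp: bD_def Sop_def fun_eq_iff sinv Dil_def)

lemma bDinv_Sop: "bDinv M p sigma (Sop p f) = Sop p (DilInv M f)"
  by (auto simp: bDinv_def Sop_def fun_eq_iff sigma_lt DilInv_def)

lemma bDpow_Sop: "bDpow M p sigma j (Sop p f) = Sop p (Dpow M j f)"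
proof -
  have "(bD M p sigma ^^ n) (Sop p f) = Sop p ((Dil M ^^ n) f)"
    "(bDinv M p sigma ^^ n) (Sop p f) = Sop p ((DilInv M ^^ n) f)" for n
    by (induction n) (simp_all add: bD_Sop bDinv_Sop)
  then show ?thesis by (simp add: bDpow_def Dpow_def)
qed

lemma bD_Hsp: "F \<in> Hsp p \<Longrightarrow> bD M p sigma F \<in> Hsp p"
  using M_inv by (auto simp: Hsp_def bD_def sinv L2_Dil)

lemma bDinv_Hsp: "F \<in> Hsp p \<Longrightarrow> bDinv M p sigma F \<in> Hsp p"
  using M_inv by (auto simp: Hsp_def bDinv_def sigma_lt L2_DilInv)

lemma bD_pow_Hsp: "F \<in> Hsp p \<Longrightarrow> (bD M p sigma ^^ n) F \<in> Hsp p"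
  by (induction n) (simp_all add: bD_Hsp)

lemma bDpow_Hsp: "F \<in> Hsp p \<Longrightarrow> bDpow M p sigma j F \<in> Hsp p"
proof -
  assume F: "F \<in> Hsp p"
  have "(bDinv M p sigma ^^ n) F \<in> Hsp p" for n by (induction n) (simp_all add: F bDinv_Hsp)
  then show ?thesis using F by (simp add: bDpow_def bD_pow_Hsp)
qed

lemma bD_bDinv: "F \<in> Hsp p \<Longrightarrow> bD M p sigma (bDinv M p sigma F) = F"
  by (auto simp: bD_def bDinv_def fun_eq_iff sinv Dil_DilInv[OF M_inv] HspD)

lemma bDpow_add_nat:
  "F \<in> Hsp p \<Longrightarrow> bDpow M p sigma (j + int n) F = (bD M p sigma ^^ n) (bDpow M p sigma j F)"
  unfolding bDpow_def by (rule zpow_add_nat[where K = "Hsp p"]) (simp_all add: bD_bDinv bDinv_Hsp)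

lemma bDpow_of_nat: "bDpow M p sigma (int n) = bD M p sigma ^^ n"
  by (simp add: bDpow_def)

lemma H_inner_bT:
  assumes "F \<in> Hsp p" "G \<in> Hsp p"
  shows "H_inner p (bT P thetas k F) (bT P thetas k G) = H_inner p F G"
  unfolding H_inner_def
proof (intro sum.cong refl)
  fix q assume "q \<in> {..<p}"
  then have "F q \<in> L2" "G q \<in> L2" using assms by (simp_all add: HspD)
  moreover have "chi k q * cnj (chi k q) = 1" by (simp flip: complex_norm_square)
  ultimately show "l2_inner (bT P thetas k F q) (bT P thetas k G q) = l2_inner (F q) (G q)"
    unfolding bT_Tr l2_inner_scale_left l2_inner_scale_right
    by (simp add: l2_inner_Tr mult.commute flip: mult.assoc)
qed

lemma H_inner_bD:
  assumes "F \<in> Hsp p" "G \<in> Hsp p"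
  shows "H_inner p (bD M p sigma F) (bD M p sigma G) = H_inner p F G"
proof -
  have "H_inner p (bD M p sigma F) (bD M p sigma G) = (\<Sum>q<p. l2_inner (F (sinv q)) (G (sinv q)))"
    unfolding H_inner_def using assms sinv
    by (intro sum.cong refl) (simp add: bD_def l2_inner_Dil[OF M_inv] HspD)
  also have "\<dots> = H_inner p F G"
    unfolding H_inner_def by (rule sum.reindex_bij_betw[OF bij_betw_inv_into[OF sigma_bij]])
  finally show ?thesis .
qed

lemma H_inner_bD_pow:
  assumes "F \<in> Hsp p" "G \<in> Hsp p"
  shows "H_inner p ((bD M p sigma ^^ n) F) ((bD M p sigma ^^ n) G) = H_inner p F G"
  by (induction n) (simp_all add: H_inner_bD bD_pow_Hsp assms)

lemma H_inner_bT_right: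
  assumes "F \<in> Hsp p" "G \<in> Hsp p"
  shows "H_inner p F (bT P thetas k G) = H_inner p (bT P thetas (- k) F) G"
  using H_inner_bT[OF assms(1) bT_Hsp[OF assms(2)], of "- k" k] by (simp add: bT_bT bT_0)

lemma Sadj_bD: "Sadj p (bD M p sigma F) = Dil M (Sadj p F)"
proof
  fix x
  have "(\<Sum>q<p. bD M p sigma F q x) = (\<Sum>q<p. Dil M (F (sinv q)) x)" by (simp add: bD_def)
  also have "\<dots> = (\<Sum>q<p. Dil M (F q) x)"
    by (rule sum.reindex_bij_betw[OF bij_betw_inv_into[OF sigma_bij]])
  finally show "Sadj p (bD M p sigma F) x = Dil M (Sadj p F) x"
    by (simp add: Sadj_def Dil_def sum_distrib_left)
qed

lemma Sadj_bDinv: "Sadj p (bDinv M p sigma F) = DilInv M (Sadj p F)"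
proof
  fix x
  have "(\<Sum>q<p. bDinv M p sigma F q x) = (\<Sum>q<p. DilInv M (F (sigma q)) x)" by (simp add: bDinv_def)
  also have "\<dots> = (\<Sum>q<p. DilInv M (F q) x)"
    by (rule sum.reindex_bij_betw[OF sigma_bij])
  finally show "Sadj p (bDinv M p sigma F) x = DilInv M (Sadj p F) x"
    by (simp add: Sadj_def DilInv_def mult.commute flip: sum_divide_distrib)
qed

lemma Sadj_bDpow: "Sadj p (bDpow M p sigma j F) = Dpow M j (Sadj p F)"
proof -
  have "Sadj p ((bD M p sigma ^^ n) F) = (Dil M ^^ n) (Sadj p F)"
    "Sadj p ((bDinv M p sigma ^^ n) F) = (DilInv M ^^ n) (Sadj p F)" for n
    by (induction n) (simp_all add: Sadj_bD Sadj_bDinv)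
  then show ?thesis by (simp add: bDpow_def Dpow_def)
qed

lemma Sadj_bT_Sop_not_PZ:
  assumes "k \<notin> PZ" shows "Sadj p (bT P thetas k (Sop p f)) = (\<lambda>x. 0)"
proof
  fix x
  have "(\<Sum>q<p. bT P thetas k (Sop p f) q x) =
      (\<Sum>q<p. chi k q) * (f (x - matrix_inv P *v vec_of_int k) / complex_of_real (sqrt (real p)))"
    by (simp add: bT_eq Sop_def sum_distrib_right sum_divide_distrib)
  then show "Sadj p (bT P thetas k (Sop p f)) x = 0" using assms by (simp add: Sadj_def chi_sum)
qed

lemma Sadj_bT_Sop_PZ: "Sadj p (bT P thetas (imat P m) (Sop p f)) = Tr (vec_of_int m) f"
  by (simp add: bT_Sop Sadj_Sop p_nz)

lemma Dpow_zero: "Dpow M j (\<lambda>x. 0) = (\<lambda>x. 0)"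
  \<comment> \<open>Homogeneity with divisor \<open>0\<close> is enough, as division by zero yields
    zero.\<close>
  using Dpow_divide[of M j "\<lambda>x. 0" 0] by simp

text \<open>Up to a translation, \<open>S* T_(-r) F\<close> is \<open>p^(-1/2)\<close> times the sum
  of the \<open>F q\<close> weighted by conjugate characters. As \<open>r\<close> varies this is a
  unitary Fourier transform across the components, by column orthogonality.\<close>

lemma sum_l2_sq_Sadj_bT:
  assumes F: "F \<in> Hsp p"
  shows "(\<Sum>r\<in>R0. l2_sq (Sadj p (bT P thetas (- r) F))) = Re (H_inner p F F)"
proof -
  have FL2: "q < p \<Longrightarrow> F q \<in> L2" for q using F by (simp add: HspD)
  define g where "g r x = (\<Sum>q<p. cnj (chi r q) * F q x)" for r x
  have gL2: "g r \<in> L2" for r unfolding g_def by (intro L2_sum L2_scale FL2) simp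
  have "complex_of_real (l2_sq (Sadj p (bT P thetas (- r) F))) =
      (\<Sum>q<p. \<Sum>q'<p. (chi r q' * cnj (chi r q)) * l2_inner (F q) (F q')) / of_nat p" for r
  proof -
    have eq: "Sadj p (bT P thetas (- r) F) = Tr (- (matrix_inv P *v vec_of_int r)) (\<lambda>x. g r x / complex_of_real (sqrt (real p)))"
      by (simp add: Sadj_def bT_eq g_def Tr_def fun_eq_iff character_minus vec.neg)
    have "complex_of_real (l2_sq (Sadj p (bT P thetas (- r) F))) =
        l2_inner (\<lambda>x. g r x / complex_of_real (sqrt (real p))) (\<lambda>x. g r x / complex_of_real (sqrt (real p)))"
      unfolding eq by (subst l2_sq_Tr) (simp_all add: L2_divide gL2 l2_inner_self)
    also have "\<dots> = l2_inner (g r) (g r) / of_nat p"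
      unfolding l2_inner_divide_left l2_inner_divide_right by (simp flip: of_real_mult)
    also have "l2_inner (g r) (g r) = (\<Sum>q<p. l2_inner (\<lambda>x. cnj (chi r q) * F q x) (g r))"
      using gL2[of r] unfolding g_def by (intro l2_inner_sum_left) (auto intro: L2_scale FL2)
    also have "\<dots> = (\<Sum>q<p. cnj (chi r q) * (\<Sum>q'<p. chi r q' * l2_inner (F q) (F q')))"
    proof (intro sum.cong refl)
      fix q assume "q \<in> {..<p}"
      then have "l2_inner (F q) (g r) = (\<Sum>q'<p. l2_inner (F q) (\<lambda>x. cnj (chi r q') * F q' x))"
        unfolding g_def by (intro l2_inner_sum_right) (auto intro: L2_scale FL2)
      then show "l2_inner (\<lambda>x. cnj (chi r q) * F q x) (g r) =
          cnj (chi r q) * (\<Sum>q'<p. chi r q' * l2_inner (F q) (F q'))"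
        unfolding l2_inner_scale_left l2_inner_scale_right by simp
    qed
    also have "\<dots> = (\<Sum>q<p. \<Sum>q'<p. (chi r q' * cnj (chi r q)) * l2_inner (F q) (F q'))"
      by (simp add: sum_distrib_left mult_ac)
    finally show ?thesis .
  qed
  then have "complex_of_real (\<Sum>r\<in>R0. l2_sq (Sadj p (bT P thetas (- r) F))) =
      (\<Sum>r\<in>R0. \<Sum>q<p. \<Sum>q'<p. (chi r q' * cnj (chi r q)) * l2_inner (F q) (F q')) / of_nat p"
    by (simp add: sum_divide_distrib)
  also have "(\<Sum>r\<in>R0. \<Sum>q<p. \<Sum>q'<p. (chi r q' * cnj (chi r q)) * l2_inner (F q) (F q')) =
      (\<Sum>q<p. \<Sum>q'<p. \<Sum>r\<in>R0. (chi r q' * cnj (chi r q)) * l2_inner (F q) (F q'))"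
    by (subst sum.swap, intro sum.cong refl, subst sum.swap, rule refl)
  also have "\<dots> = (\<Sum>q<p. \<Sum>q'<p. if q' = q then of_nat p * l2_inner (F q) (F q') else 0)"
  proof (intro sum.cong refl)
    fix q q' assume "q \<in> {..<p}" "q' \<in> {..<p}"
    then show "(\<Sum>r\<in>R0. (chi r q' * cnj (chi r q)) * l2_inner (F q) (F q')) =
        (if q' = q then of_nat p * l2_inner (F q) (F q') else 0)"
      using chi_columns[of q' q] by (simp flip: sum_distrib_right)
  qed
  also have "\<dots> = of_nat p * H_inner p F F" by (simp add: H_inner_def sum_distrib_left)
  also have "of_nat p * H_inner p F F / of_nat p = H_inner p F F" using p_nz by simp
  finally show ?thesis by (metis Re_complex_of_real)
qed

end

section \<open>Reindexing and exhausting frame sums\<close>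

lemma energy_cong_bij:
  assumes "bij_betw h I J" "\<And>i. i \<in> I \<Longrightarrow> cmod (ip f (e i)) = cmod (ip' g (e' (h i)))"
  shows "energy ip e I f = energy ip' e' J g"
proof -
  have "energy ip e I f = (\<integral>\<^sup>+i. ennreal ((cmod (ip' g (e' (h i))))\<^sup>2) \<partial>count_space I)"
    unfolding energy_def using assms(2) by (intro nn_integral_cong) simp
  also have "\<dots> = energy ip' e' J g"
    unfolding energy_def by (rule nn_integral_bij_count_space[OF assms(1)])
  finally show ?thesis .
qed

lemma energy_eq_subset:
  assumes "J \<subseteq> I" "\<And>i. i \<in> I - J \<Longrightarrow> ip f (e i) = 0"
  shows "energy ip e I f = energy ip e J f"
proof -
  have "energy ip e (J \<union> (I - J)) f = energy ip e J f + energy ip e (I - J) f"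
    by (rule energy_Un_disjoint) auto
  moreover have "energy ip e (I - J) f = (\<integral>\<^sup>+i. 0 \<partial>count_space (I - J))"
    unfolding energy_def using assms(2) by (intro nn_integral_cong) simp
  moreover have "J \<union> (I - J) = I" using assms(1) by blast
  ultimately show ?thesis by simp
qed

lemma energy_Times_finite:
  assumes "finite R"
  shows "energy ip e (R \<times> I) f = (\<Sum>r\<in>R. energy ip (\<lambda>i. e (r, i)) I f)"
  using assms
proof (induction R)
  case empty
  then show ?case by (simp add: energy_def nn_integral_count_space_finite)
next
  case (insert r R)
  have "insert r R \<times> I = {r} \<times> I \<union> R \<times> I" by auto
  moreover have "energy ip e ({r} \<times> I \<union> R \<times> I) f = energy ip e ({r} \<times> I) f + energy ip e (R \<times> I) f"
    using insert by (intro energy_Un_disjoint) auto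
  moreover have "energy ip (\<lambda>i. e (r, i)) I f = energy ip e ({r} \<times> I) f"
    by (rule energy_cong_bij[where h = "Pair r"]) (auto simp: bij_betw_def inj_on_def)
  ultimately show ?case using insert by simp
qed

lemma energy_SUP:
  assumes "incseq J" "(\<Union>n. J n) = I"
  shows "energy ip e I f = (SUP n. energy ip e (J n) f)"
proof -
  define w where "w i = ennreal ((cmod (ip f (e i)))\<^sup>2)" for i
  have E: "energy ip e J f = (\<integral>\<^sup>+i. w i * indicator J i \<partial>count_space UNIV)" for J
    unfolding energy_def w_def by (rule nn_integral_count_space_indicator) simp
  have "(SUP n. w i * indicator (J n) i) = w i * indicator I i" for i
  proof (cases "i \<in> I")
    case True
    then obtain n where n: "i \<in> J n" using assms(2) by blast
    have "(SUP n. w i * indicator (J n) i) = w i"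
      by (rule antisym[OF SUP_least SUP_upper2[of n]]) (auto simp: n split: split_indicator)
    then show ?thesis using True by simp
  next
    case False
    then have "i \<notin> J n" for n using assms(2) by blast
    then show ?thesis using False by simp
  qed
  then have "energy ip e I f = (\<integral>\<^sup>+i. (SUP n. w i * indicator (J n) i) \<partial>count_space UNIV)"
    unfolding E by simp
  also have "\<dots> = (SUP n. energy ip e (J n) f)"
    unfolding E
  proof (rule nn_integral_monotone_convergence_SUP)
    show "incseq (\<lambda>n i. w i * indicator (J n) i)"
      using assms(1) by (auto simp: incseq_def le_fun_def split: split_indicator)
  qed simp
  finally show ?thesis .
qed

context oversampling
begin

section \<open>Transfer of frame sums between the two systems\<close>

definition vector_system :: "(nat \<Rightarrow> 'd fn) \<Rightarrow> int \<times> (int^'d) \<times> nat \<Rightarrow> nat \<Rightarrow> 'd fn" where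
  "vector_system psi = (\<lambda>(j, k, i). bDpow M p sigma j (bT P thetas k (Sop p (psi i))))"

lemma vector_system_Hsp: "psi i \<in> L2 \<Longrightarrow> vector_system psi (j, k, i) \<in> Hsp p"
  by (simp add: vector_system_def bDpow_Hsp bT_Hsp Sop_Hsp)

lemma affine_system_L2: "psi i \<in> L2 \<Longrightarrow> affine_system M psi (j, k, i) \<in> L2"
  by (simp add: affine_system_def L2_Dpow[OF M_inv] L2_Tr)

lemma vector_system_PZ: "vector_system psi (j, imat P m, i) = Sop p (affine_system M psi (j, m, i))"
  by (simp add: vector_system_def affine_system_def bT_Sop bDpow_Sop)

lemma H_inner_Sop_Sop: "f \<in> L2 \<Longrightarrow> g \<in> L2 \<Longrightarrow> H_inner p (Sop p f) (Sop p g) = l2_inner f g"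
  by (simp add: H_inner_Sop Sop_Hsp Sadj_Sop p_nz)

lemma Sop_inner_vector_system_PZ:
  "f \<in> L2 \<Longrightarrow> psi i \<in> L2 \<Longrightarrow>
    H_inner p (Sop p f) (vector_system psi (j, imat P m, i)) = l2_inner f (affine_system M psi (j, m, i))"
  by (simp add: vector_system_PZ H_inner_Sop_Sop affine_system_L2)

lemma Sop_inner_vector_system_not_PZ:
  "f \<in> L2 \<Longrightarrow> psi i \<in> L2 \<Longrightarrow> k \<notin> PZ \<Longrightarrow> H_inner p (Sop p f) (vector_system psi (j, k, i)) = 0"
  by (simp add: Sop_H_inner vector_system_Hsp)
    (simp add: vector_system_def Sadj_bDpow Sadj_bT_Sop_not_PZ Dpow_zero)

lemma energy_Sop:
  assumes f: "f \<in> L2" and psi: "\<And>i. i \<in> {1..n} \<Longrightarrow> psi i \<in> L2"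
  shows "energy (H_inner p) (vector_system psi) (UNIV \<times> UNIV \<times> {1..n}) (Sop p f) =
    energy l2_inner (affine_system M psi) (UNIV \<times> UNIV \<times> {1..n}) f"
proof -
  have "energy (H_inner p) (vector_system psi) (UNIV \<times> UNIV \<times> {1..n}) (Sop p f) =
      energy (H_inner p) (vector_system psi) (UNIV \<times> PZ \<times> {1..n}) (Sop p f)"
    using f psi by (intro energy_eq_subset) (auto intro!: Sop_inner_vector_system_not_PZ)
  also have "\<dots> = energy l2_inner (affine_system M psi) (UNIV \<times> UNIV \<times> {1..n}) f"
  proof (rule energy_cong_bij[where h = "\<lambda>(j, m, i). (j, imat P m, i)", symmetric])
    show "bij_betw (\<lambda>(j, m, i). (j, imat P m, i)) (UNIV \<times> UNIV \<times> {1..n}) (UNIV \<times> PZ \<times> {1..n})"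
      by (auto simp: bij_betw_def inj_on_def image_iff dest: imat_P_inj)
  qed (use f psi in \<open>auto simp: Sop_inner_vector_system_PZ\<close>)
  finally show ?thesis .
qed

text \<open>The dilation preserves inner products, so applying its \<open>J\<close>-th power to
  \<open>F\<close> and to the system raises each scale by \<open>J\<close>. The finitely many coarse
  levels down to \<open>- J\<close> become fine ones.\<close>

lemma energy_bD_pow:
  assumes F: "F \<in> Hsp p" and psi: "\<And>i. i \<in> {1..n} \<Longrightarrow> psi i \<in> L2"
  shows "energy (H_inner p) (vector_system psi) ({- int J..} \<times> UNIV \<times> {1..n}) F =
    energy (H_inner p) (vector_system psi) ({0..} \<times> UNIV \<times> {1..n}) ((bD M p sigma ^^ J) F)"
proof (rule energy_cong_bij[where h = "\<lambda>(j, k, i). (j + int J, k, i)"])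
  show "bij_betw (\<lambda>(j, k, i). (j + int J, k, i)) ({- int J..} \<times> UNIV \<times> {1..n}) ({0..} \<times> (UNIV :: (int^'d) set) \<times> {1..n})"
    by (rule bij_betw_byWitness[where f' = "\<lambda>(j, k, i). (j - int J, k, i)"]) auto
  fix t assume "t \<in> {- int J..} \<times> (UNIV :: (int^'d) set) \<times> {1..n}"
  then obtain j k i where t: "t = (j, k, i)" "i \<in> {1..n}" by auto
  define G where "G = bT P thetas k (Sop p (psi i))"
  have G: "G \<in> Hsp p" unfolding G_def using psi t by (simp add: bT_Hsp Sop_Hsp)
  have "H_inner p ((bD M p sigma ^^ J) F) (bDpow M p sigma (j + int J) G) = H_inner p F (bDpow M p sigma j G)"
    unfolding bDpow_add_nat[OF G] by (rule H_inner_bD_pow[OF F bDpow_Hsp[OF G]])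
  then show "cmod (H_inner p F (vector_system psi t)) = cmod (H_inner p ((bD M p sigma ^^ J) F)
      (vector_system psi (case t of (j, k, i) \<Rightarrow> (j + int J, k, i))))"
    by (simp add: t vector_system_def G_def)
qed

text \<open>The translation by \<open>M'^a r\<close> moves to the outside of \<open>D^a\<close> as
  translation by \<open>r\<close> and passes to \<open>G\<close> with opposite sign. What remains
  lies in the range of \<open>Sop\<close>, so the adjoint returns an ordinary affine
  coefficient.\<close>

lemma H_inner_vector_system_coset:
  assumes G: "G \<in> Hsp p" and psi: "psi i \<in> L2"
  shows "H_inner p G (vector_system psi (int a, (iM ^^ a) r + imat P m, i)) =
    l2_inner (Sadj p (bT P thetas (- r) G)) (affine_system M psi (int a, m, i))"
proof -
  have "vector_system psi (int a, (iM ^^ a) r + imat P m, i) =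
      (bD M p sigma ^^ a) (bT P thetas ((iM ^^ a) r) (Sop p (Tr (vec_of_int m) (psi i))))"
    by (simp add: vector_system_def bDpow_of_nat bT_Sop flip: bT_bT)
  also have "\<dots> = bT P thetas r ((bD M p sigma ^^ a) (Sop p (Tr (vec_of_int m) (psi i))))"
    by (rule bT_bD_pow[symmetric])
  also have "(bD M p sigma ^^ a) (Sop p (Tr (vec_of_int m) (psi i))) = Sop p (affine_system M psi (int a, m, i))"
    using bDpow_Sop[of "int a"] by (simp add: bDpow_of_nat affine_system_def)
  finally show ?thesis
    using G psi by (simp add: H_inner_bT_right Sop_Hsp affine_system_L2 H_inner_Sop bT_Hsp)
qed

lemma energy_nonneg_scales:
  assumes G: "G \<in> Hsp p" and psi: "\<And>i. i \<in> {1..n} \<Longrightarrow> psi i \<in> L2"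
  shows "energy (H_inner p) (vector_system psi) ({0..} \<times> UNIV \<times> {1..n}) G =
    (\<Sum>r\<in>R0. energy l2_inner (affine_system M psi) ({0..} \<times> UNIV \<times> {1..n}) (Sadj p (bT P thetas (- r) G)))"
proof -
  define I where "I = {0::int..} \<times> (UNIV :: (int^'d) set) \<times> {1..n}"
  define h where "h = (\<lambda>(r, j, m, i). (j :: int, (iM ^^ nat j) r + imat P m, i :: nat))"
  have "bij_betw h (R0 \<times> I) I"
  proof (rule bij_betw_imageI)
    show "inj_on h (R0 \<times> I)"
    proof (rule inj_onI)
      fix s s' assume s: "s \<in> R0 \<times> I" "s' \<in> R0 \<times> I" "h s = h s'"
      obtain r j m i r' j' m' i' where s': "s = (r, j, m, i)" "s' = (r', j', m', i')"
        by (cases s, cases s') auto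
      have "(\<lambda>(r, m). (iM ^^ nat j) r + imat P m) (r, m) = (\<lambda>(r, m). (iM ^^ nat j) r + imat P m) (r', m')"
        using s unfolding s' h_def by auto
      then have "(r, m) = (r', m')"
        by (rule inj_onD[OF bij_betw_imp_inj_on[OF bij_betw_coset]]) (use s in \<open>auto simp: s'\<close>)
      then show "s = s'" using s unfolding s' h_def by auto
    qed
    show "h ` (R0 \<times> I) = I"
    proof (intro set_eqI iffI)
      fix t assume t: "t \<in> I"
      obtain j k i where t': "t = (j, k, i)" by (cases t)
      have "k \<in> (\<lambda>(r, m). (iM ^^ nat j) r + imat P m) ` (R0 \<times> UNIV)"
        unfolding bij_betw_imp_surj_on[OF bij_betw_coset] by simp
      then obtain r m where "r \<in> R0" "k = (iM ^^ nat j) r + imat P m" by auto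
      then show "t \<in> h ` (R0 \<times> I)"
        using t by (intro image_eqI[of _ _ "(r, j, m, i)"]) (auto simp: h_def t' I_def)
    qed (auto simp: h_def I_def)
  qed
  \<comment> \<open>The doubly indexed coefficients are packed as an energy whose pairing returns
    its second argument; the function argument \<open>0\<close> is a dummy. This makes the
    reindexing and finite-product rules applicable.\<close>
  then have "energy (\<lambda>_ x. x) (\<lambda>(r, t). l2_inner (Sadj p (bT P thetas (- r) G)) (affine_system M psi t)) (R0 \<times> I) 0 =
      energy (H_inner p) (vector_system psi) I G"
  proof (rule energy_cong_bij)
    fix s assume "s \<in> R0 \<times> I"
    then obtain r j m i where s: "s = (r, j, m, i)" "j \<ge> 0" "i \<in> {1..n}" by (auto simp: I_def)
    show "cmod (case s of (r, t) \<Rightarrow> l2_inner (Sadj p (bT P thetas (- r) G)) (affine_system M psi t)) =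
        cmod (H_inner p G (vector_system psi (h s)))"
      using H_inner_vector_system_coset[of G psi i "nat j" r m] G psi[OF s(3)] s by (simp add: h_def)
  qed
  also have "energy (\<lambda>_ x. x) (\<lambda>(r, t). l2_inner (Sadj p (bT P thetas (- r) G)) (affine_system M psi t)) (R0 \<times> I) 0 =
      (\<Sum>r\<in>R0. energy l2_inner (affine_system M psi) I (Sadj p (bT P thetas (- r) G)))"
    unfolding energy_Times_finite[OF finite_R0] by (simp add: energy_def)
  finally show ?thesis unfolding I_def by simp
qed

text \<open>For each \<open>J\<close> the scales from \<open>- J\<close> on are sums of fine-scale
  energies, and adding the missing coarse scales only enlarges them. The bound is uniform in
  \<open>J\<close>, so it passes to the supremum.\<close>

lemma vector_system_energy_upper:
  assumes psi: "\<And>i. i \<in> {1..n} \<Longrightarrow> psi i \<in> L2" and B: "B > 0" and F: "F \<in> Hsp p"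
    and bound: "\<And>f. f \<in> L2 \<Longrightarrow> energy l2_inner (affine_system M psi) (UNIV \<times> UNIV \<times> {1..n}) f \<le> ennreal (B * l2_sq f)"
  shows "energy (H_inner p) (vector_system psi) (UNIV \<times> UNIV \<times> {1..n}) F \<le> ennreal (B * Re (H_inner p F F))"
proof -
  have "energy (H_inner p) (vector_system psi) ({- int J..} \<times> UNIV \<times> {1..n}) F \<le> ennreal (B * Re (H_inner p F F))" for J
  proof -
    define G where "G = (bD M p sigma ^^ J) F"
    have G: "G \<in> Hsp p" unfolding G_def by (rule bD_pow_Hsp[OF F])
    have "energy (H_inner p) (vector_system psi) ({- int J..} \<times> UNIV \<times> {1..n}) F =
        (\<Sum>r\<in>R0. energy l2_inner (affine_system M psi) ({0..} \<times> UNIV \<times> {1..n}) (Sadj p (bT P thetas (- r) G)))"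
      using energy_nonneg_scales[of G n psi, OF G] energy_bD_pow[of F n psi J, OF F] psi
      by (simp add: G_def)
    also have "\<dots> \<le> (\<Sum>r\<in>R0. ennreal (B * l2_sq (Sadj p (bT P thetas (- r) G))))"
      by (intro sum_mono order_trans[OF energy_mono bound] Sadj_L2 bT_Hsp G) auto
    also have "\<dots> = ennreal (B * (\<Sum>r\<in>R0. l2_sq (Sadj p (bT P thetas (- r) G))))"
      using B by (simp add: sum_distrib_left)
    also have "\<dots> = ennreal (B * Re (H_inner p F F))"
      unfolding sum_l2_sq_Sadj_bT[OF G] by (simp add: G_def H_inner_bD_pow F)
    finally show ?thesis .
  qed
  then have "(SUP J. energy (H_inner p) (vector_system psi) ({- int J..} \<times> UNIV \<times> {1..n}) F) \<le> ennreal (B * Re (H_inner p F F))"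
    by (rule SUP_least)
  moreover have "energy (H_inner p) (vector_system psi) (UNIV \<times> UNIV \<times> {1..n}) F =
      (SUP J. energy (H_inner p) (vector_system psi) ({- int J..} \<times> UNIV \<times> {1..n}) F)"
  proof (rule energy_SUP)
    show "incseq (\<lambda>J. {- int J..} \<times> (UNIV :: (int^'d) set) \<times> {1..n})" by (auto simp: incseq_def)
    have "j \<in> {- int (nat (- j))..}" for j :: int by simp
    then show "(\<Union>J. {- int J..} \<times> (UNIV :: (int^'d) set) \<times> {1..n}) = UNIV \<times> UNIV \<times> {1..n}" by blast
  qed
  ultimately show ?thesis by simp
qed

text \<open>Which component \<open>q'\<close> appears is irrelevant later, since the dilation
  exponent is chosen large enough for all components at once.\<close>

lemma bD_pow_component: "q < p \<Longrightarrow> \<exists>q'<p. (bD M p sigma ^^ J) F q = (Dil M ^^ J) (F q')"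
proof (induction J arbitrary: q)
  case (Suc J)
  obtain q' where "q' < p" "(bD M p sigma ^^ J) F (sinv q) = (Dil M ^^ J) (F q')"
    using Suc.IH[of "sinv q"] sinv Suc.prems by auto
  then show ?case using Suc.prems by (intro exI[of _ q']) (simp add: bD_def[of M p sigma "(bD M p sigma ^^ J) F"])
qed auto

lemma Sadj_coarse_energy_tendsto_zero:
  assumes psi: "\<And>i. i \<in> {1..n} \<Longrightarrow> psi i \<in> L2" and B: "B > 0" and F: "F \<in> Hsp p" and \<delta>: "\<delta> > 0"
    and bound: "\<And>f. f \<in> L2 \<Longrightarrow> energy l2_inner (affine_system M psi) (UNIV \<times> UNIV \<times> {1..n}) f \<le> ennreal (B * l2_sq f)"
  obtains J where "\<And>r. r \<in> R0 \<Longrightarrow> energy l2_inner (affine_system M psi) ({..<0} \<times> UNIV \<times> {1..n})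
    (Sadj p (bT P thetas (- r) ((bD M p sigma ^^ J) F))) \<le> ennreal \<delta>"
proof -
  let ?E = "energy l2_inner (affine_system M psi) ({..<0} \<times> UNIV \<times> {1..n})"
  define u where "u r = - (matrix_inv P *v vec_of_int r)" for r
  have u: "u r \<noteq> 0" if "r \<in> R0" for r
  proof
    assume "u r = 0"
    then have "P *v (matrix_inv P *v vec_of_int r) = 0" by (simp add: u_def)
    then have "r = 0" using P_inv by (simp add: matrix_inv_mult_vec)
    then show False using R0_nonzero that by blast
  qed
  \<comment> \<open>The denominator pays for \<open>p\<close> components and for the factor
    \<open>2 ^ p\<close> of the crude sum estimate.\<close>
  define \<epsilon> where "\<epsilon> = \<delta> / (2 ^ p * real p)"
  have eps: "\<epsilon> > 0" using \<delta> p_pos by (simp add: \<epsilon>_def)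
  have "\<exists>J0. \<forall>J\<ge>J0. ?E (Tr (u r) ((Dil M ^^ J) (F q))) \<le> ennreal \<epsilon>" if "r \<in> R0" "q < p" for r q
    using coarse_energy_shifted_dilate_tendsto_zero[OF M_exp M_int u[OF that(1)] psi HspD(1)[OF F that(2)] eps B bound]
    by metis
  then obtain J0 where J0: "\<And>r q J. r \<in> R0 \<Longrightarrow> q < p \<Longrightarrow> J \<ge> J0 r q \<Longrightarrow> ?E (Tr (u r) ((Dil M ^^ J) (F q))) \<le> ennreal \<epsilon>"
    by metis
  define J where "J = Max ((\<lambda>(r, q). J0 r q) ` (R0 \<times> {..<p}))"
  have J: "J \<ge> J0 r q" if "r \<in> R0" "q < p" for r q
    unfolding J_def using that finite_R0 by (intro Max_ge) auto
  show thesis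
  proof (rule that)
    fix r assume r: "r \<in> R0"
    define g where "g q x = (chi (- r) q / complex_of_real (sqrt (real p))) * Tr (u r) ((bD M p sigma ^^ J) F q) x" for q x
    have gL2: "g q \<in> L2" if "q < p" for q
      unfolding g_def using that bD_pow_Hsp[OF F, of J] by (intro L2_scale L2_Tr HspD)
    have eq: "Sadj p (bT P thetas (- r) ((bD M p sigma ^^ J) F)) = (\<lambda>x. \<Sum>q<p. g q x)"
      by (simp add: Sadj_def bT_Tr g_def u_def vec.neg sum_divide_distrib)
    have "?E (Sadj p (bT P thetas (- r) ((bD M p sigma ^^ J) F))) \<le> 2 ^ card {..<p} * (\<Sum>q<p. ?E (g q))"
      unfolding eq by (rule energy_L2_sum_le) (use gL2 psi in \<open>auto intro!: affine_system_L2\<close>)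
    also have "\<dots> \<le> 2 ^ p * (\<Sum>q<p. ennreal \<epsilon>)"
    proof (simp only: card_lessThan, intro mult_left_mono sum_mono)
      fix q assume "q \<in> {..<p}"
      then obtain q' where q': "q' < p" "(bD M p sigma ^^ J) F q = (Dil M ^^ J) (F q')"
        using bD_pow_component by blast
      have "?E (g q) = ennreal (1 / real p) * ?E (Tr (u r) ((Dil M ^^ J) (F q')))"
        unfolding g_def q' energy_L2_scale by (simp add: norm_divide power_divide)
      also have "\<dots> \<le> 1 * ?E (Tr (u r) ((Dil M ^^ J) (F q')))"
        using p_pos by (intro mult_right_mono) (auto simp: ennreal_le_1 divide_le_eq_1)
      also have "\<dots> \<le> ennreal \<epsilon>" using J0[OF r q'(1) J[OF r q'(1)]] by simp
      finally show "?E (g q) \<le> ennreal \<epsilon>" .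
    qed simp
    also have "\<dots> = ennreal (2 ^ p * (real p * \<epsilon>))"
    proof -
      have "(\<Sum>q<p. ennreal \<epsilon>) = ennreal (\<Sum>q<p. \<epsilon>)" using eps by (subst sum_ennreal) auto
      then have "(\<Sum>q<p. ennreal \<epsilon>) = ennreal (real p * \<epsilon>)" by simp
      then show ?thesis using eps by (simp add: ennreal_mult flip: ennreal_power)
    qed
    also have "2 ^ p * (real p * \<epsilon>) = \<delta>" using p_pos by (simp add: \<epsilon>_def)
    finally show "?E (Sadj p (bT P thetas (- r) ((bD M p sigma ^^ J) F))) \<le> ennreal \<delta>" .
  qed
qed

text \<open>The lower bound holds for each \<open>S* T_(-r) G\<close> over all scales. Its coarse
  scales are not part of the frame sum of \<open>F\<close>, but removing them costs at most
  \<open>\<delta> / p\<close> for each of the \<open>p\<close> representatives.\<close>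

lemma vector_system_energy_lower:
  assumes psi: "\<And>i. i \<in> {1..n} \<Longrightarrow> psi i \<in> L2" and A: "A > 0" and B: "B > 0" and F: "F \<in> Hsp p"
    and upper: "\<And>f. f \<in> L2 \<Longrightarrow> energy l2_inner (affine_system M psi) (UNIV \<times> UNIV \<times> {1..n}) f \<le> ennreal (B * l2_sq f)"
    and lower: "\<And>f. f \<in> L2 \<Longrightarrow> ennreal (A * l2_sq f) \<le> energy l2_inner (affine_system M psi) (UNIV \<times> UNIV \<times> {1..n}) f"
  shows "ennreal (A * Re (H_inner p F F)) \<le> energy (H_inner p) (vector_system psi) (UNIV \<times> UNIV \<times> {1..n}) F"
proof (rule ennreal_le_epsilon)
  fix \<delta> :: real assume \<delta>: "\<delta> > 0"
  let ?E = "\<lambda>I. energy l2_inner (affine_system M psi) (I \<times> UNIV \<times> {1..n})"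
  have "\<delta> / real p > 0" using \<delta> p_pos by simp
  then obtain J where J: "\<And>r. r \<in> R0 \<Longrightarrow> ?E {..<0} (Sadj p (bT P thetas (- r) ((bD M p sigma ^^ J) F))) \<le> ennreal (\<delta> / real p)"
    using Sadj_coarse_energy_tendsto_zero[OF psi B F _ upper] by metis
  define G where "G = (bD M p sigma ^^ J) F"
  have G: "G \<in> Hsp p" unfolding G_def by (rule bD_pow_Hsp[OF F])
  define g where "g r = Sadj p (bT P thetas (- r) G)" for r
  have gL2: "g r \<in> L2" for r unfolding g_def by (intro Sadj_L2 bT_Hsp G)
  have split: "?E UNIV f = ?E {0..} f + ?E {..<0} f" for f
  proof -
    have "UNIV \<times> (UNIV :: (int^'d) set) \<times> {1..n} = ({0::int..} \<times> UNIV \<times> {1..n}) \<union> ({..<0} \<times> UNIV \<times> {1..n})"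
      by auto
    then show ?thesis by (simp only:) (rule energy_Un_disjoint, auto)
  qed
  have "ennreal (A * Re (H_inner p F F)) = ennreal (A * (\<Sum>r\<in>R0. l2_sq (g r)))"
    unfolding g_def sum_l2_sq_Sadj_bT[OF G] by (simp add: G_def H_inner_bD_pow F)
  also have "\<dots> = (\<Sum>r\<in>R0. ennreal (A * l2_sq (g r)))"
    using A by (simp add: sum_distrib_left)
  also have "\<dots> \<le> (\<Sum>r\<in>R0. ?E {0..} (g r) + ennreal (\<delta> / real p))"
  proof (rule sum_mono)
    fix r assume r: "r \<in> R0"
    have "ennreal (A * l2_sq (g r)) \<le> ?E {0..} (g r) + ?E {..<0} (g r)"
      using lower[OF gL2] unfolding split .
    also have "\<dots> \<le> ?E {0..} (g r) + ennreal (\<delta> / real p)"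
      using J[OF r] unfolding g_def G_def by (rule add_left_mono)
    finally show "ennreal (A * l2_sq (g r)) \<le> ?E {0..} (g r) + ennreal (\<delta> / real p)" .
  qed
  also have "\<dots> = (\<Sum>r\<in>R0. ?E {0..} (g r)) + ennreal \<delta>"
  proof -
    have "(\<Sum>r\<in>R0. ennreal (\<delta> / real p)) = ennreal (\<Sum>r\<in>R0. \<delta> / real p)" using \<delta> by (subst sum_ennreal) auto
    also have "(\<Sum>r\<in>R0. \<delta> / real p) = \<delta>" using p_pos by (simp add: card_R0)
    finally show ?thesis by (simp add: sum.distrib)
  qed
  also have "(\<Sum>r\<in>R0. ?E {0..} (g r)) = energy (H_inner p) (vector_system psi) ({- int J..} \<times> UNIV \<times> {1..n}) F"
    using energy_nonneg_scales[of G n psi, OF G] energy_bD_pow[of F n psi J, OF F] psi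
    by (simp add: G_def g_def)
  also have "\<dots> + ennreal \<delta> \<le> energy (H_inner p) (vector_system psi) (UNIV \<times> UNIV \<times> {1..n}) F + ennreal \<delta>"
    by (intro add_right_mono energy_mono) auto
  finally show "ennreal (A * Re (H_inner p F F)) \<le>
      energy (H_inner p) (vector_system psi) (UNIV \<times> UNIV \<times> {1..n}) F + ennreal \<delta>" .
qed

section \<open>The two equivalences and the first component\<close>

lemma frame_iff:
  assumes psi: "\<And>i. i \<in> {1..n} \<Longrightarrow> psi i \<in> L2"
  shows "is_frame L2 l2_inner (UNIV \<times> UNIV \<times> {1..n}) (affine_system M psi) A B \<longleftrightarrow>
    is_frame (Hsp p) (H_inner p) (UNIV \<times> UNIV \<times> {1..n}) (vector_system psi) A B"
proof
  assume "is_frame L2 l2_inner (UNIV \<times> UNIV \<times> {1..n}) (affine_system M psi) A B"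
  then have fr: "A > 0" "B > 0"
    "\<And>f. f \<in> L2 \<Longrightarrow> ennreal (A * l2_sq f) \<le> energy l2_inner (affine_system M psi) (UNIV \<times> UNIV \<times> {1..n}) f"
    "\<And>f. f \<in> L2 \<Longrightarrow> energy l2_inner (affine_system M psi) (UNIV \<times> UNIV \<times> {1..n}) f \<le> ennreal (B * l2_sq f)"
    by (simp_all add: is_frame_iff_energy)
  show "is_frame (Hsp p) (H_inner p) (UNIV \<times> UNIV \<times> {1..n}) (vector_system psi) A B"
  proof (subst is_frame_iff_energy[OF Re_H_inner_self_nonneg], intro conjI ballI)
    fix F :: "nat \<Rightarrow> 'd fn" assume F: "F \<in> Hsp p"
    show "ennreal (A * Re (H_inner p F F)) \<le> energy (H_inner p) (vector_system psi) (UNIV \<times> UNIV \<times> {1..n}) F"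
      by (rule vector_system_energy_lower[OF psi fr(1,2) F fr(4,3)])
    show "energy (H_inner p) (vector_system psi) (UNIV \<times> UNIV \<times> {1..n}) F \<le> ennreal (B * Re (H_inner p F F))"
      by (rule vector_system_energy_upper[OF psi fr(2) F fr(4)])
  qed (use fr psi in \<open>auto intro: vector_system_Hsp\<close>)
next
  assume "is_frame (Hsp p) (H_inner p) (UNIV \<times> UNIV \<times> {1..n}) (vector_system psi) A B"
  then have fr: "A > 0" "B > 0"
    "\<And>F. F \<in> Hsp p \<Longrightarrow> ennreal (A * Re (H_inner p F F)) \<le> energy (H_inner p) (vector_system psi) (UNIV \<times> UNIV \<times> {1..n}) F \<and>
      energy (H_inner p) (vector_system psi) (UNIV \<times> UNIV \<times> {1..n}) F \<le> ennreal (B * Re (H_inner p F F))"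
    unfolding is_frame_iff_energy[OF Re_H_inner_self_nonneg] by blast+
  show "is_frame L2 l2_inner (UNIV \<times> UNIV \<times> {1..n}) (affine_system M psi) A B"
  proof (subst is_frame_iff_energy, simp, intro conjI ballI)
    fix f :: "'d fn" assume f: "f \<in> L2"
    show "ennreal (A * Re (l2_inner f f)) \<le> energy l2_inner (affine_system M psi) (UNIV \<times> UNIV \<times> {1..n}) f"
      "energy l2_inner (affine_system M psi) (UNIV \<times> UNIV \<times> {1..n}) f \<le> ennreal (B * Re (l2_inner f f))"
      using fr(3)[OF Sop_Hsp[OF f]] energy_Sop[of f n psi, OF f] psi H_inner_Sop_Sop[OF f f] by simp_all
  qed (use fr psi in \<open>auto intro: affine_system_L2\<close>)
qed

text \<open>Cancelling the common dilation and moving one translation across reduces the product to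
  \<open>D^a S* T_l S\<close> applied to \<open>psi i\<close>, paired with \<open>psi i'\<close>,
  where \<open>l = k - M'^a k'\<close>. For \<open>l\<close> outside \<open>P Z^d\<close> this is
  zero; for \<open>l = P m\<close> it is an inner product of the affine system.\<close>

lemma H_inner_vector_system_onb:
  assumes psi: "\<And>i. i \<in> {1..n} \<Longrightarrow> psi i \<in> L2" and i: "i \<in> {1..n}" "i' \<in> {1..n}"
    and ortho: "\<And>t t'. t \<in> UNIV \<times> UNIV \<times> {1..n} \<Longrightarrow> t' \<in> UNIV \<times> UNIV \<times> {1..n} \<Longrightarrow>
      l2_inner (affine_system M psi t) (affine_system M psi t') = (if t = t' then 1 else 0)"
  shows "H_inner p (vector_system psi (j + int a, k, i)) (vector_system psi (j, k', i')) =
    (if (j + int a, k, i) = (j, k', i') then 1 else 0)"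
proof -
  define X where "X = bT P thetas k (Sop p (psi i))"
  define Y where "Y = bT P thetas k' (Sop p (psi i'))"
  have X: "X \<in> Hsp p" and Y: "Y \<in> Hsp p" unfolding X_def Y_def using psi i by (simp_all add: bT_Hsp Sop_Hsp)
  have XA: "(bD M p sigma ^^ a) X \<in> Hsp p" by (rule bD_pow_Hsp[OF X])
  have cancel: "H_inner p (bDpow M p sigma (j + int a) X) (bDpow M p sigma j Y) = H_inner p ((bD M p sigma ^^ a) X) Y"
  proof (cases "j \<ge> 0")
    case True
    then obtain b where b: "j = int b" using nonneg_int_cases by blast
    have "(bD M p sigma ^^ (b + a)) X = (bD M p sigma ^^ b) ((bD M p sigma ^^ a) X)" by (simp add: funpow_add)
    then show ?thesis unfolding b using H_inner_bD_pow[OF XA Y, of b] by (simp add: bDpow_of_nat flip: of_nat_add)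
  next
    case False
    \<comment> \<open>Powers are only added upwards, so for negative \<open>j\<close> both arguments
      are multiplied by the dilation to the power \<open>b = - j\<close>.\<close>
    then obtain b where b: "j = - int b" by (metis le_cases nonpos_int_cases)
    have "H_inner p (bDpow M p sigma (j + int a) X) (bDpow M p sigma j Y) =
        H_inner p ((bD M p sigma ^^ b) (bDpow M p sigma (j + int a) X)) ((bD M p sigma ^^ b) (bDpow M p sigma j Y))"
      by (rule H_inner_bD_pow[symmetric]) (intro bDpow_Hsp X Y)+
    also have "\<dots> = H_inner p (bDpow M p sigma (int a) X) (bDpow M p sigma 0 Y)"
      unfolding bDpow_add_nat[OF X, symmetric] bDpow_add_nat[OF Y, symmetric] b by simp
    finally show ?thesis by (simp add: bDpow_of_nat bDpow_def[of _ _ _ 0])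
  qed
  define l where "l = (iM ^^ a) (- k') + k"
  have "H_inner p ((bD M p sigma ^^ a) X) Y = H_inner p (bT P thetas (- k') ((bD M p sigma ^^ a) X)) (Sop p (psi i'))"
    unfolding Y_def
    using H_inner_bT[OF XA bT_Hsp[OF Sop_Hsp], of "psi i'" "- k'" k'] psi i by (simp add: bT_bT bT_0)
  also have "bT P thetas (- k') ((bD M p sigma ^^ a) X) = bDpow M p sigma (int a) (bT P thetas l (Sop p (psi i)))"
    unfolding X_def bT_bD_pow bT_bT l_def bDpow_of_nat ..
  also have "H_inner p \<dots> (Sop p (psi i')) = l2_inner (Dpow M (int a) (Sadj p (bT P thetas l (Sop p (psi i))))) (psi i')"
    using psi i by (subst H_inner_Sop) (simp_all add: bDpow_Hsp bT_Hsp Sop_Hsp Sadj_bDpow)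
  finally have eq: "H_inner p (vector_system psi (j + int a, k, i)) (vector_system psi (j, k', i')) =
      l2_inner (Dpow M (int a) (Sadj p (bT P thetas l (Sop p (psi i))))) (psi i')"
    unfolding vector_system_def prod.case using cancel unfolding X_def Y_def by simp
  have l0: "l = 0" if "a = 0" "k = k'" using that by (simp add: l_def)
  show ?thesis
  proof (cases "l \<in> PZ")
    case True
    then obtain m where m: "l = imat P m" by blast
    have "Dpow M (int a) (Sadj p (bT P thetas l (Sop p (psi i)))) = affine_system M psi (int a, m, i)"
      unfolding m Sadj_bT_Sop_PZ affine_system_def by simp
    moreover have "psi i' = affine_system M psi (0, 0, i')"
      by (simp add: affine_system_def Dpow_def Tr_def)
    ultimately have "H_inner p (vector_system psi (j + int a, k, i)) (vector_system psi (j, k', i')) =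
        (if (int a, m, i) = (0, 0, i') then 1 else 0)"
      unfolding eq using ortho[of "(int a, m, i)" "(0, 0, i')"] i by simp
    \<comment> \<open>For \<open>a > 0\<close> both triples differ in their scales. For
      \<open>a = 0\<close> one has \<open>l = k - k'\<close>, so \<open>m = 0\<close> means
      \<open>k = k'\<close>.\<close>
    moreover have "(int a, m, i) = (0, 0, i') \<longleftrightarrow> (j + int a, k, i) = (j, k', i')"
    proof (cases "a = 0")
      case a: True
      have "m = 0 \<longleftrightarrow> imat P m = 0" using imat_P_inj[of m 0] imat_zero[OF P_int] by auto
      also have "\<dots> \<longleftrightarrow> k = k'" unfolding m[symmetric] l_def using a by auto
      finally show ?thesis using a by simp
    qed simp
    ultimately show ?thesis by simp
  next
    case False
    then have "l \<noteq> 0" using PZ_0 by blast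
    then have "(j + int a, k, i) \<noteq> (j, k', i')" using l0 by auto
    then show ?thesis unfolding eq Sadj_bT_Sop_not_PZ[OF False] Dpow_zero by simp
  qed
qed

text \<open>Orthonormality is carried over by operator identities. Completeness in \<open>H\<close>
  follows from the lower frame bound \<open>1\<close>, obtained from Parseval; completeness below
  follows because \<open>Sop p f\<close> has no coefficients outside \<open>P Z^d\<close>.\<close>

lemma onb_iff:
  assumes psi: "\<And>i. i \<in> {1..n} \<Longrightarrow> psi i \<in> L2"
  shows "is_onb L2 l2_inner (UNIV \<times> UNIV \<times> {1..n}) (affine_system M psi) \<longleftrightarrow>
    is_onb (Hsp p) (H_inner p) (UNIV \<times> UNIV \<times> {1..n}) (vector_system psi)"
proof
  assume onb: "is_onb L2 l2_inner (UNIV \<times> UNIV \<times> {1..n}) (affine_system M psi)"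
  then have ortho: "\<And>t t'. t \<in> UNIV \<times> UNIV \<times> {1..n} \<Longrightarrow> t' \<in> UNIV \<times> UNIV \<times> {1..n} \<Longrightarrow>
      l2_inner (affine_system M psi t) (affine_system M psi t') = (if t = t' then 1 else 0)"
    unfolding is_onb_def by blast
  have "is_frame L2 l2_inner (UNIV \<times> UNIV \<times> {1..n}) (affine_system M psi) 1 1"
    unfolding is_frame_def using has_sum_imp_summable[OF parseval[OF onb]] infsumI[OF parseval[OF onb]] psi
    by (auto intro: affine_system_L2)
  then have "is_frame (Hsp p) (H_inner p) (UNIV \<times> UNIV \<times> {1..n}) (vector_system psi) 1 1"
    using frame_iff[of n psi] psi by blast
  then have lower: "ennreal (Re (H_inner p F F)) \<le> energy (H_inner p) (vector_system psi) (UNIV \<times> UNIV \<times> {1..n}) F"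
    if "F \<in> Hsp p" for F
    using that unfolding is_frame_iff_energy[OF Re_H_inner_self_nonneg] by auto
  show "is_onb (Hsp p) (H_inner p) (UNIV \<times> UNIV \<times> {1..n}) (vector_system psi)"
    unfolding is_onb_def
  proof (intro conjI ballI impI)
    fix t t' assume t: "t \<in> (UNIV :: int set) \<times> (UNIV :: (int^'d) set) \<times> {1..n}" "t' \<in> (UNIV :: int set) \<times> (UNIV :: (int^'d) set) \<times> {1..n}"
    obtain j k i j' k' i' where t': "t = (j, k, i)" "t' = (j', k', i')" "i \<in> {1..n}" "i' \<in> {1..n}" using t by auto
    show "H_inner p (vector_system psi t) (vector_system psi t') = (if t = t' then 1 else 0)"
    proof (cases "j' \<le> j")
      case True
      then obtain a where "j = j' + int a" by (metis zle_iff_zadd)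
      then show ?thesis using H_inner_vector_system_onb[of n psi i i' j' a k k'] psi t'(3,4) ortho by (simp add: t')
    next
      case False
      then obtain a where "j' = j + int a" by (metis zle_iff_zadd nle_le)
      then have "H_inner p (vector_system psi t') (vector_system psi t) = (if t' = t then 1 else 0)"
        using H_inner_vector_system_onb[of n psi i' i j a k' k] psi t'(3,4) ortho by (simp add: t')
      then show ?thesis using H_inner_commute[of p "vector_system psi t" "vector_system psi t'"] by (auto split: if_splits)
    qed
  next
    fix F assume F: "F \<in> Hsp p" and "\<forall>t\<in>UNIV \<times> UNIV \<times> {1..n}. H_inner p F (vector_system psi t) = 0"
    then have "energy (H_inner p) (vector_system psi) (UNIV \<times> UNIV \<times> {1..n}) F = energy (H_inner p) (vector_system psi) {} F"
      by (intro energy_eq_subset) auto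
    then have "ennreal (Re (H_inner p F F)) \<le> 0"
      using lower[OF F] by (simp add: energy_def nn_integral_count_space_finite)
    then have "Re (H_inner p F F) = 0"
      using Re_H_inner_self_nonneg[of p F] by (simp add: ennreal_eq_0_iff)
    then show "H_inner p F F = 0" by (simp add: H_inner_self)
  qed (use psi in \<open>auto intro: vector_system_Hsp\<close>)
next
  assume onb: "is_onb (Hsp p) (H_inner p) (UNIV \<times> UNIV \<times> {1..n}) (vector_system psi)"
  show "is_onb L2 l2_inner (UNIV \<times> UNIV \<times> {1..n}) (affine_system M psi)"
    unfolding is_onb_def
  proof (intro conjI ballI impI)
    fix t t' assume t: "t \<in> (UNIV :: int set) \<times> (UNIV :: (int^'d) set) \<times> {1..n}" "t' \<in> (UNIV :: int set) \<times> (UNIV :: (int^'d) set) \<times> {1..n}"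
    obtain j k i j' k' i' where t': "t = (j, k, i)" "t' = (j', k', i')" "i \<in> {1..n}" "i' \<in> {1..n}" using t by auto
    have "l2_inner (affine_system M psi t) (affine_system M psi t') =
        H_inner p (vector_system psi (j, imat P k, i)) (vector_system psi (j', imat P k', i'))"
      unfolding t' vector_system_PZ by (rule H_inner_Sop_Sop[symmetric]) (use t' psi in \<open>auto intro: affine_system_L2\<close>)
    also have "\<dots> = (if (j, imat P k, i) = (j', imat P k', i') then 1 else 0)"
      using onb t' unfolding is_onb_def by blast
    also have "\<dots> = (if t = t' then 1 else 0)" using imat_P_inj[of k k'] by (auto simp: t')
    finally show "l2_inner (affine_system M psi t) (affine_system M psi t') = (if t = t' then 1 else 0)" .
  next
    fix f :: "'d fn" assume f: "f \<in> L2" and zero: "\<forall>t\<in>UNIV \<times> UNIV \<times> {1..n}. l2_inner f (affine_system M psi t) = 0"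
    have "H_inner p (Sop p f) (vector_system psi (j, k, i)) = 0" if "i \<in> {1..n}" for j k i
    proof (cases "k \<in> PZ")
      case True
      then show ?thesis using f psi[OF that] zero that by (auto simp: Sop_inner_vector_system_PZ)
    next
      case False
      then show ?thesis using f psi[OF that] by (simp add: Sop_inner_vector_system_not_PZ)
    qed
    then have "H_inner p (Sop p f) (Sop p f) = 0"
      using onb Sop_Hsp[OF f] unfolding is_onb_def by fastforce
    then show "l2_inner f f = 0" by (simp add: H_inner_Sop_Sop f)
  qed (use psi in \<open>auto intro: affine_system_L2\<close>)
qed

text \<open>The index \<open>0\<close> is fixed by \<open>sigma\<close> and
  \<open>thetas 0 = 0\<close> has trivial character, so in this component neither permutation nor
  phase is left.\<close>

lemma vector_system_component_0:
  "bDpow M p sigma j (bT P thetas k (Sop p f)) 0 =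
    (\<lambda>x. Dpow M j (Tr (matrix_inv P *v vec_of_int k) f) x / complex_of_real (sqrt (real p)))"
proof -
  have s0: "sinv 0 = 0" using sinv(3)[OF p_pos] by (simp add: sigma_0)
  have "(bD M p sigma ^^ a) F 0 = (Dil M ^^ a) (F 0)" "(bDinv M p sigma ^^ a) F 0 = (DilInv M ^^ a) (F 0)" for a F
    by (induction a) (simp_all add: bD_def bDinv_def p_pos s0 sigma_0)
  then have "bDpow M p sigma j (bT P thetas k (Sop p f)) 0 = Dpow M j (bT P thetas k (Sop p f) 0)"
    by (simp add: bDpow_def Dpow_def)
  also have "bT P thetas k (Sop p f) 0 = (\<lambda>x. Tr (matrix_inv P *v vec_of_int k) f x / complex_of_real (sqrt (real p)))"
    using p_pos by (simp add: bT_eq th0 character_def Sop_def Tr_def)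
  finally show ?thesis unfolding Dpow_divide .
qed

end

theorem theorem3p1:
  fixes M P :: "real^'d::finite^'d" and p n :: nat
    and psi :: "nat \<Rightarrow> real^'d \<Rightarrow> complex"
    and thetas :: "nat \<Rightarrow> real^'d" and sigma :: "nat \<Rightarrow> nat" and A B :: real
  assumes M_int: "is_int_matrix M"
    and M_exp: "\<forall>z. is_eigenvalue M z \<longrightarrow> cmod z > 1"
    and P_int: "is_int_matrix P"
    and p_def: "real p = \<bar>det P\<bar>" and p_nz: "p \<noteq> 0"
    and adm: "admissible M P"
    and th0: "thetas 0 = 0"
    and th_in: "\<forall>q<p. thetas q \<in> (\<lambda>k. matrix_inv (transpose P) *v k) ` Zd"
    and th_distinct: "\<forall>q<p. \<forall>q'<p. thetas q - thetas q' \<in> Zd \<longrightarrow> q = q'"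
    and th_complete: "\<forall>x\<in>(\<lambda>k. matrix_inv (transpose P) *v k) ` Zd. \<exists>q<p. x - thetas q \<in> Zd"
    and sigma_def: "\<forall>q<p. sigma q < p \<and>
          transpose (P ** M ** matrix_inv P) *v thetas q - thetas (sigma q) \<in> Zd"
    and psi_L2: "\<forall>i\<in>{1..n}. psi i \<in> L2"
  shows "(is_frame L2 l2_inner (UNIV \<times> UNIV \<times> {1..n})
            (\<lambda>(j, k, i). Dpow M j (Tr (vec_of_int k) (psi i))) A B
          \<longleftrightarrow> is_frame (Hsp p) (H_inner p) (UNIV \<times> UNIV \<times> {1..n})
            (\<lambda>(j, k, i). bDpow M p sigma j (bT P thetas k (Sop p (psi i)))) A B)
       \<and> (is_onb L2 l2_inner (UNIV \<times> UNIV \<times> {1..n})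
            (\<lambda>(j, k, i). Dpow M j (Tr (vec_of_int k) (psi i)))
          \<longleftrightarrow> is_onb (Hsp p) (H_inner p) (UNIV \<times> UNIV \<times> {1..n})
            (\<lambda>(j, k, i). bDpow M p sigma j (bT P thetas k (Sop p (psi i)))))
       \<and> (\<forall>j k. \<forall>i\<in>{1..n}.
            bDpow M p sigma j (bT P thetas k (Sop p (psi i))) 0
          = (\<lambda>x. Dpow M j (Tr (matrix_inv P *v vec_of_int k) (psi i)) x
                 / complex_of_real (sqrt (real p))))"
proof -
  interpret oversampling M P p thetas sigma
    by (rule oversampling.intro) fact+
  have psi: "\<And>i. i \<in> {1..n} \<Longrightarrow> psi i \<in> L2" using psi_L2 by blast
  show ?thesis
    using frame_iff[of n psi A B] onb_iff[of n psi] psi vector_system_component_0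
    unfolding affine_system_def vector_system_def by blast
qed

end
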